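(* Let $X$ be a Banach space, $A:D(A)\subset X\to X$ a Hille-Yosida operator with constants $M_A,\omega_A$, $X_0=\overline{D(A)}$, and let $F,V:\mathbb R\to\mathcal L(X_0,X)$ be almost periodic (in the operator norm), with the ordered-space conventions given in the context. Assume: (1) there is $\omega\in\mathbb R$ with $(\omega,+\infty)\subset\rho(A)$ and $(\lambda I-A)^{-1}$ is a positive operator for all $\lambda>\omega$; there exists $\lambda_1>\omega_A$ such that $\lambda_1\phi-V(t)\phi\in X_+$ for all $\phi\in X_0^+$, $t\in\mathbb R$; and $F(t)\phi\in X_+$ for all $t\in\mathbb R$, $\phi\in X_0^+$; (2) $\omega(\Gamma)<0$; (3) for any $\epsilon>0$ and $\nu>0$ there exist $\eta=\eta(\epsilon,\nu)>0$ and $\delta=\delta(\epsilon,\nu)<0$ such that $\|\Gamma(t+\tau,s+\tau)-\Gamma(t,s)\|\le\epsilon e^{\delta(t-s)}$ for all $t\ge s$ with $t-s\ge\nu$ and all $\tau\in\mathcal T(V,\eta)$. Let $\mathcal B_0:D(\mathcal B_0)\subset AP(\mathbb R,X_0)\to AP(\mathbb R,X_0)$ be the infinitesimal generator of the evolution semigroup $\{\mathbb V(t)\}_{t\ge0}$. Then: (i) there exists a Hille-Yosida operator $\mathcal B:D(\mathcal B)\subset AP(\mathbb R,X)\to AP(\mathbb R,X)$ such that $\mathcal B_0$ is the part of $\mathcal B$ in $AP(\mathbb R,X_0)$; and this operator $\mathcal B$ satisfies (ii) $(\omega(\Gamma),+\infty)\subset\rho(\mathcal B)$; (iii) for any $\phi\in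 AP(\mathbb R,X)$ and $\lambda>\omega(\Gamma)$, $(\lambda I-\mathcal B)^{-1}(\phi)=\mathcal L_\lambda(\phi)$, and $$\|(\lambda I-\mathcal B)^{-n}(\phi)\|\le\frac{M_\Gamma^2M_A}{(\lambda-\omega(\Gamma))^n}\|\phi\|,\quad\forall n\ge1,$$ where $M_\Gamma\ge1$ is a constant with $\|\Gamma(t,s)\|\le M_\Gamma e^{\omega(\Gamma)(t-s)}$ for all $t\ge s$.
   Context: Almost periodicity: for a metric space $(Y,d)$, $f\in C(\mathbb R,Y)$ is almost periodic if for every $\epsilon>0$ the set $\mathcal T(f,\epsilon)=\{\tau\in\mathbb R:d(f(t+\tau),f(t))<\epsilon\ \forall t\in\mathbb R\}$ is relatively dense (there is $l>0$ with $[c,c+l]\cap\mathcal T(f,\epsilon)\ne\emptyset$ for all $c\in\mathbb R$). $AP(\mathbb R,Y)$ is the space of such functions; for $Y$ a Banach space it is a Banach space with the supremum norm. Hille-Yosida operator: a linear operator $A$ (possibly not densely defined) for which there are $\omega_A\in\mathbb R$, $M_A\ge1$ with $(\omega_A,+\infty)\subset\rho(A)$ and $\|(\lambda I-A)^{-n}\|\le M_A(\lambda-\omega_A)^{-n}$ for all $\lambda>\omega_A$, $n\ge1$. The part of an operator $\mathcal B$ in a subspace $Z$ is $\mathcal B$ restricted to $\{\psi\in D(\mathcal B)\cap Z:\mathcal B\psi\in Z\}$. Order: $X$ and $X_0$ have normal and generating positive cones $X_+$ and $X_0^+=X_0\cap X_+$. Evolution family: $\{\Gamma(t,s)\}_{t\ge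 s}$ is the exponentially bounded evolution family on $X_0$ such that $v(t)=\Gamma(t,t_0)v_0$ is the unique mild (integrated) solution of $v'(t)=Av(t)-V(t)v(t)$, $t>t_0$, $v(t_0)=v_0\in X_0$, i.e. $v\in C([t_0,\infty),X_0)$, $\int_{t_0}^tv(s)ds\in D(A)$ and $v(t)=v_0+A\int_{t_0}^tv(s)ds-\int_{t_0}^tV(s)v(s)ds$. Its exponential growth bound is $\omega(\Gamma)=\inf\{\hat\omega:\exists M\ge1,\ \forall s\in\mathbb R,\ t\ge s:\ \|\Gamma(t,s)\|\le Me^{\hat\omega(t-s)}\}$. Evolution semigroup: $[\mathbb V(t)\phi](s)=\Gamma(s,s-t)\phi(s-t)$ for $\phi\in AP(\mathbb R,X_0)$, $t\ge0$, $s\in\mathbb R$; it is a $C_0$-semigroup on $AP(\mathbb R,X_0)$. For real $\lambda>\omega(\Gamma)$ and $\phi\in AP(\mathbb R,X)$, $$\mathcal L_\lambda(\phi)(t)=\lim_{\mu\to+\infty}\int_{-\infty}^te^{-\lambda(t-s)}\Gamma(t,s)\mu(\mu I-A)^{-1}\phi(s)\,ds,\quad t\in\mathbb R,$$ the limit existing uniformly in $t\in\mathbb R$. *)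

theory Defs
  imports "HOL-Analysis.Analysis"
begin

section \<open>Almost periodic functions\<close>

text \<open>The metric is passed as a distance function, so that the same notion applies to functions
  into a normed space (with \<open>dist\<close>) and to functions into the bounded linear operators on a
  subspace (with \<open>opdist\<close> below), which is not a type.\<close>

definition translation_set :: "('y \<Rightarrow> 'y \<Rightarrow> real) \<Rightarrow> (real \<Rightarrow> 'y) \<Rightarrow> real \<Rightarrow> real set" where
  "translation_set d f eps = {tau. \<forall>t. d (f (t + tau)) (f t) < eps}"

definition relatively_dense :: "real set \<Rightarrow> bool" where
  "relatively_dense S \<longleftrightarrow> (\<exists>l>0. \<forall>c. {c..c + l} \<inter> S \<noteq> {})"

definition almost_periodic :: "('y \<Rightarrow> 'y \<Rightarrow> real) \<Rightarrow> (real \<Rightarrow> 'y) \<Rightarrow> bool" where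
  "almost_periodic d f \<longleftrightarrow>
     (\<forall>t. ((\<lambda>s. d (f s) (f t)) \<longlongrightarrow> 0) (at t)) \<and>
     (\<forall>eps>0. relatively_dense (translation_set d f eps))"

lemma almost_periodic_dist_iff:
  "almost_periodic dist f \<longleftrightarrow>
     continuous_on UNIV f \<and> (\<forall>eps>0. relatively_dense (translation_set dist f eps))"
  unfolding almost_periodic_def continuous_on_def
  by (subst tendsto_dist_iff) simp

text \<open>Almost periodic functions are bounded, so realising them inside the Banach space of bounded
  continuous functions (whose norm is the supremum norm) loses nothing.\<close>

lemma almost_periodic_imp_bcontfun:
  fixes f :: "real \<Rightarrow> 'a::metric_space"
  assumes "almost_periodic dist f"
  shows "f \<in> bcontfun"
proof -
  have cont: "continuous_on UNIV f"
    and rd: "relatively_dense (translation_set dist f 1)"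
    using assms by (auto simp: almost_periodic_dist_iff)
  from rd obtain l where l: "\<And>c. {c..c + l} \<inter> translation_set dist f 1 \<noteq> {}"
    unfolding relatively_dense_def by blast
  have "compact (f ` {0..l})"
    using cont by (intro compact_continuous_image) (auto intro: continuous_on_subset)
  then obtain e where e: "\<And>u. u \<in> {0..l} \<Longrightarrow> dist (f 0) (f u) \<le> e"
    using compact_imp_bounded bounded_any_center[of "f ` {0..l}" "f 0"] by blast
  have "dist (f 0) (f t) \<le> e + 1" for t
  proof -
    obtain tau where tau: "tau \<in> {-t..-t + l}" "tau \<in> translation_set dist f 1"
      using l[of "-t"] by blast
    have "dist (f (t + tau)) (f t) < 1"
      using tau(2) by (simp add: translation_set_def)
    moreover have "dist (f 0) (f (t + tau)) \<le> e"
      using tau(1) by (intro e) auto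
    ultimately show ?thesis
      using dist_triangle[of "f 0" "f t" "f (t + tau)"] by linarith
  qed
  then have "bounded (range f)"
    unfolding bounded_def by blast
  with cont show ?thesis
    by (simp add: bcontfun_def)
qed

definition AP :: "'a::metric_space set \<Rightarrow> (real \<Rightarrow>\<^sub>C 'a) set" where
  "AP Z = {\<phi>. range (apply_bcontfun \<phi>) \<subseteq> Z \<and> almost_periodic dist (apply_bcontfun \<phi>)}"


section \<open>Linear operators on subspaces\<close>

definition linear_on_subspace ::
  "'b::real_vector set \<Rightarrow> ('b \<Rightarrow> 'c::real_vector) \<Rightarrow> bool" where
  "linear_on_subspace S T \<longleftrightarrow> subspace S \<and>
     (\<forall>x\<in>S. \<forall>y\<in>S. T (x + y) = T x + T y) \<and> (\<forall>c. \<forall>x\<in>S. T (c *\<^sub>R x) = c *\<^sub>R T x)"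

definition bounded_linear_on ::
  "'b::real_normed_vector set \<Rightarrow> ('b \<Rightarrow> 'c::real_normed_vector) \<Rightarrow> bool" where
  "bounded_linear_on S T \<longleftrightarrow> linear_on_subspace S T \<and> (\<exists>K. \<forall>x\<in>S. norm (T x) \<le> norm x * K)"

definition onorm_on ::
  "'b::real_normed_vector set \<Rightarrow> ('b \<Rightarrow> 'c::real_normed_vector) \<Rightarrow> real" where
  "onorm_on S T = (SUP x\<in>S. norm (T x) / norm x)"

definition opdist ::
  "'b::real_normed_vector set \<Rightarrow> ('b \<Rightarrow> 'c::real_normed_vector) \<Rightarrow> ('b \<Rightarrow> 'c) \<Rightarrow> real" where
  "opdist S T U = onorm_on S (\<lambda>x. T x - U x)"

text \<open>An unbounded operator in a Banach space \<open>Y\<close> (a closed subspace of the ambient type) is given by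
  its domain \<open>D\<close> and a function \<open>A\<close> whose values outside \<open>D\<close> are irrelevant.\<close>

definition linear_operator :: "'b::real_vector set \<Rightarrow> 'b set \<Rightarrow> ('b \<Rightarrow> 'b) \<Rightarrow> bool" where
  "linear_operator Y D A \<longleftrightarrow> subspace Y \<and> D \<subseteq> Y \<and> linear_on_subspace D A \<and> A ` D \<subseteq> Y"

definition resolvent :: "'b::real_vector set \<Rightarrow> ('b \<Rightarrow> 'b) \<Rightarrow> real \<Rightarrow> 'b \<Rightarrow> 'b" where
  "resolvent D A lam = inv_into D (\<lambda>x. lam *\<^sub>R x - A x)"

definition resolvent_set ::
  "'b::real_normed_vector set \<Rightarrow> 'b set \<Rightarrow> ('b \<Rightarrow> 'b) \<Rightarrow> real set" where
  "resolvent_set Y D A =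
     {lam. bij_betw (\<lambda>x. lam *\<^sub>R x - A x) D Y \<and> bounded_linear_on Y (resolvent D A lam)}"

definition hille_yosida ::
  "'b::real_normed_vector set \<Rightarrow> 'b set \<Rightarrow> ('b \<Rightarrow> 'b) \<Rightarrow> real \<Rightarrow> real \<Rightarrow> bool" where
  "hille_yosida Y D A M w \<longleftrightarrow> linear_operator Y D A \<and> M \<ge> 1 \<and> {w<..} \<subseteq> resolvent_set Y D A \<and>
     (\<forall>lam>w. \<forall>n\<ge>1. onorm_on Y (resolvent D A lam ^^ n) \<le> M / (lam - w) ^ n)"

definition part_dom :: "'b set \<Rightarrow> 'b set \<Rightarrow> ('b \<Rightarrow> 'b) \<Rightarrow> 'b set" where
  "part_dom Z D B = {x \<in> D \<inter> Z. B x \<in> Z}"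

definition is_part ::
  "'b set \<Rightarrow> 'b set \<Rightarrow> ('b \<Rightarrow> 'b) \<Rightarrow> 'b set \<Rightarrow> ('b \<Rightarrow> 'b) \<Rightarrow> bool" where
  "is_part Z D B D0 B0 \<longleftrightarrow> D0 = part_dom Z D B \<and> (\<forall>x\<in>D0. B0 x = B x)"

definition generator_dom ::
  "'b::real_normed_vector set \<Rightarrow> (real \<Rightarrow> 'b \<Rightarrow> 'b) \<Rightarrow> 'b set" where
  "generator_dom Y T = {x \<in> Y. \<exists>y\<in>Y. ((\<lambda>h. (T h x - x) /\<^sub>R h) \<longlongrightarrow> y) (at_right 0)}"

definition generator :: "(real \<Rightarrow> 'b \<Rightarrow> 'b) \<Rightarrow> 'b \<Rightarrow> 'b::real_normed_vector" where
  "generator T x = Lim (at_right 0) (\<lambda>h. (T h x - x) /\<^sub>R h)"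


section \<open>Ordered Banach spaces\<close>

definition positive_cone :: "'a::real_normed_vector set \<Rightarrow> bool" where
  "positive_cone P \<longleftrightarrow> closed P \<and> convex P \<and> cone P \<and> P \<inter> uminus ` P = {0}"

definition normal_cone :: "'a::real_normed_vector set \<Rightarrow> bool" where
  "normal_cone P \<longleftrightarrow> (\<exists>N>0. \<forall>x\<in>P. \<forall>y. y - x \<in> P \<longrightarrow> norm x \<le> N * norm y)"

definition generating_cone :: "'a::real_vector set \<Rightarrow> 'a set \<Rightarrow> bool" where
  "generating_cone Z P \<longleftrightarrow> P \<subseteq> Z \<and> (\<forall>x\<in>Z. \<exists>u\<in>P. \<exists>v\<in>P. x = u - v)"

definition ordered_with_cone :: "'a::real_normed_vector set \<Rightarrow> 'a set \<Rightarrow> bool" where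
  "ordered_with_cone Z P \<longleftrightarrow> positive_cone P \<and> normal_cone P \<and> generating_cone Z P"


section \<open>Evolution families\<close>

definition exp_bound ::
  "'a::real_normed_vector set \<Rightarrow> (real \<Rightarrow> real \<Rightarrow> 'a \<Rightarrow> 'a) \<Rightarrow> real \<Rightarrow> real \<Rightarrow> bool" where
  "exp_bound X0 \<Gamma> M w \<longleftrightarrow> (\<forall>s t. s \<le> t \<longrightarrow> onorm_on X0 (\<Gamma> t s) \<le> M * exp (w * (t - s)))"

text \<open>Only the operators \<open>\<Gamma> t s\<close> with \<open>s \<le> t\<close>, restricted to \<open>X0\<close>, matter.\<close>

definition exp_bounded_evolution_family ::
  "'a::real_normed_vector set \<Rightarrow> (real \<Rightarrow> real \<Rightarrow> 'a \<Rightarrow> 'a) \<Rightarrow> bool" where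
  "exp_bounded_evolution_family X0 \<Gamma> \<longleftrightarrow>
     (\<forall>s t. s \<le> t \<longrightarrow> bounded_linear_on X0 (\<Gamma> t s) \<and> \<Gamma> t s ` X0 \<subseteq> X0) \<and>
     (\<forall>t. \<forall>x\<in>X0. \<Gamma> t t x = x) \<and>
     (\<forall>s r t. s \<le> r \<longrightarrow> r \<le> t \<longrightarrow> (\<forall>x\<in>X0. \<Gamma> t r (\<Gamma> r s x) = \<Gamma> t s x)) \<and>
     (\<forall>x\<in>X0. continuous_on {(t, s). s \<le> t} (\<lambda>(t, s). \<Gamma> t s x)) \<and>
     (\<exists>M\<ge>1. \<exists>w. exp_bound X0 \<Gamma> M w)"

text \<open>The infimum is taken in the extended reals, since it is \<open>-\<infinity>\<close> for instance when \<open>\<Gamma> t s\<close> vanishes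
  for large \<open>t - s\<close>.\<close>

definition growth_bound ::
  "'a::real_normed_vector set \<Rightarrow> (real \<Rightarrow> real \<Rightarrow> 'a \<Rightarrow> 'a) \<Rightarrow> ereal" where
  "growth_bound X0 \<Gamma> = Inf (ereal ` {w. \<exists>M\<ge>1. exp_bound X0 \<Gamma> M w})"

text \<open>Mild solutions of \<open>v' = A v - V(t) v\<close> on \<open>[t0, \<infinity>)\<close> with initial value \<open>v0\<close>; the integrals
  are those of continuous Banach-space valued functions.\<close>

definition mild_solution ::
  "'a::banach set \<Rightarrow> ('a \<Rightarrow> 'a) \<Rightarrow> (real \<Rightarrow> 'a \<Rightarrow> 'a) \<Rightarrow> real \<Rightarrow> 'a \<Rightarrow> (real \<Rightarrow> 'a) \<Rightarrow> bool" where
  "mild_solution D A V t0 v0 v \<longleftrightarrow>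
     continuous_on {t0..} v \<and> v ` {t0..} \<subseteq> closure D \<and>
     (\<forall>t\<ge>t0. integral {t0..t} v \<in> D \<and>
        v t = v0 + A (integral {t0..t} v) - integral {t0..t} (\<lambda>s. V s (v s)))"

definition solution_family ::
  "'a::banach set \<Rightarrow> ('a \<Rightarrow> 'a) \<Rightarrow> (real \<Rightarrow> 'a \<Rightarrow> 'a) \<Rightarrow> (real \<Rightarrow> real \<Rightarrow> 'a \<Rightarrow> 'a) \<Rightarrow> bool" where
  "solution_family D A V \<Gamma> \<longleftrightarrow> exp_bounded_evolution_family (closure D) \<Gamma> \<and>
     (\<forall>t0. \<forall>v0\<in>closure D. mild_solution D A V t0 v0 (\<lambda>t. \<Gamma> t t0 v0) \<and>
        (\<forall>v. mild_solution D A V t0 v0 v \<longrightarrow> (\<forall>t\<ge>t0. v t = \<Gamma> t t0 v0)))"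

definition evolution_semigroup ::
  "(real \<Rightarrow> real \<Rightarrow> 'a \<Rightarrow> 'a) \<Rightarrow> real \<Rightarrow> (real \<Rightarrow>\<^sub>C 'a) \<Rightarrow> (real \<Rightarrow>\<^sub>C 'a::metric_space)" where
  "evolution_semigroup \<Gamma> t \<phi> = Bcontfun (\<lambda>s. \<Gamma> s (s - t) (apply_bcontfun \<phi> (s - t)))"


section \<open>The operators $\mathcal{L}_\lambda$\<close>

definition L_integrand ::
  "'a::banach set \<Rightarrow> ('a \<Rightarrow> 'a) \<Rightarrow> (real \<Rightarrow> real \<Rightarrow> 'a \<Rightarrow> 'a) \<Rightarrow> real \<Rightarrow> (real \<Rightarrow> 'a) \<Rightarrow>
   real \<Rightarrow> real \<Rightarrow> real \<Rightarrow> 'a" where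
  "L_integrand D A \<Gamma> lam \<phi> \<mu> t s =
     exp (- lam * (t - s)) *\<^sub>R \<Gamma> t s (\<mu> *\<^sub>R resolvent D A \<mu> (\<phi> s))"

definition L_op ::
  "'a::banach set \<Rightarrow> ('a \<Rightarrow> 'a) \<Rightarrow> (real \<Rightarrow> real \<Rightarrow> 'a \<Rightarrow> 'a) \<Rightarrow> real \<Rightarrow> (real \<Rightarrow> 'a) \<Rightarrow> real \<Rightarrow> 'a" where
  "L_op D A \<Gamma> lam \<phi> t = Lim at_top (\<lambda>\<mu>. integral {..t} (L_integrand D A \<Gamma> lam \<phi> \<mu> t))"

text \<open>The integrals and the limit in \<open>L_op\<close> exist, the latter uniformly in \<open>t\<close>.
  (\<open>(\<mu>I - A)\<^sup>-\<^sup>1\<close> is available for \<open>\<mu> > wA\<close>.)\<close>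

definition L_exists ::
  "'a::banach set \<Rightarrow> ('a \<Rightarrow> 'a) \<Rightarrow> real \<Rightarrow> (real \<Rightarrow> real \<Rightarrow> 'a \<Rightarrow> 'a) \<Rightarrow> real \<Rightarrow> (real \<Rightarrow> 'a) \<Rightarrow> bool"
  where
  "L_exists D A wA \<Gamma> lam \<phi> \<longleftrightarrow>
     (\<forall>\<mu>>wA. \<forall>t. L_integrand D A \<Gamma> lam \<phi> \<mu> t integrable_on {..t}) \<and>
     uniform_limit UNIV (\<lambda>\<mu> t. integral {..t} (L_integrand D A \<Gamma> lam \<phi> \<mu> t))
       (L_op D A \<Gamma> lam \<phi>) at_top"

end

theory Submission
  imports Defs
begin

text \<open>
  On functions with values in \<open>X0\<close> the operator \<open>L(\<lambda>)\<close> is the Laplace transform of the evolution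
  semigroup, hence the resolvent of its generator.  The point is the existence of
  \<open>lim L(\<lambda>)(\<mu> R(\<mu>) \<phi>)\<close> for \<open>\<phi>\<close> with values in \<open>X\<close>, where \<open>R(\<mu>) = (\<mu> - A)\<^sup>-\<^sup>1\<close>.  Since \<open>V(s)\<close> does not map
  into \<open>X0\<close>, one cannot integrate by parts under \<open>\<Gamma>(t,s)\<close>.  Instead, the implicit Euler scheme and the
  Hille-Yosida estimate bound every mild solution of \<open>y' = A y + f\<close> by \<open>f\<close> and its initial value.
  For \<open>g = \<mu> R(\<mu>) \<phi> - \<nu> R(\<nu>) \<phi>\<close> with \<open>\<phi>\<close> continuously differentiable, the function \<open>W(t)\<close>, defined as the
  integral of \<open>\<Gamma>(t,s) g(s)\<close> over \<open>[a,t]\<close>, solves \<open>W' = A W - V W + g\<close>, and the bound applied to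
  \<open>W - R(\<kappa>) g\<close> gives \<open>W = O(1/\<mu> + 1/\<nu>)\<close> on intervals so short that the term \<open>V W\<close> is absorbed.  The
  semigroup law extends this to \<open>L(\<lambda>) g\<close>, and averaging extends it to all almost periodic \<open>\<phi>\<close>.  The
  limits form a pseudo-resolvent; it is injective because the mild equation survives the limit, so it
  is the resolvent of an operator \<open>B\<close>, and the power bounds pass to the limit as well.
\<close>

section \<open>Integrals of vector-valued functions\<close>

text \<open>The infimum in \<open>growth_bound\<close> need not be attained, so estimates are proved
  for an arbitrary pair with \<open>exp_bound\<close> and exponent \<open>w'\<close> below
  \<open>lam\<close>; the operators themselves do not depend on the pair. As \<open>A\<close> does
  not pass through limits, every mild equation is stated after applying the bounded injective
  operator \<open>R kap\<close>. That operator also supplies the rate: \<open>mu R mu - I\<close>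
  does not tend to 0 off \<open>X0\<close>, but composed with \<open>R kap\<close> it is O(1/mu) on
  the whole space. The Duhamel estimate holds only on windows of a fixed length \<open>T0\<close>,
  whose position does not matter; since the Laplace transform minus its damped time shift is the
  integral over one window, a geometric series recovers it from there. Constants must not compound
  with the power \<open>n\<close>: iterates are therefore estimated together with all their further
  time shifts. The hypothesis on near-periods of \<open>V\<close> enters where
  \<open>\<Gamma>\<close> has to preserve almost periodicity. Almost periodic functions have totally
  bounded range, and finite nets turn convergence at vectors of \<open>D\<close> into uniform
  convergence.\<close>

lemma linear_on_subspaceD:
  assumes "linear_on_subspace S T"
  shows "subspace S" "x \<in> S \<Longrightarrow> y \<in> S \<Longrightarrow> T (x + y) = T x + T y"
    "x \<in> S \<Longrightarrow> T (c *\<^sub>R x) = c *\<^sub>R T x"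
    "x \<in> S \<Longrightarrow> y \<in> S \<Longrightarrow> T (x - y) = T x - T y" "T 0 = 0"
proof -
  show s: "subspace S" using assms by (auto simp: linear_on_subspace_def)
  show a: "x \<in> S \<Longrightarrow> y \<in> S \<Longrightarrow> T (x + y) = T x + T y" for x y
    using assms by (auto simp: linear_on_subspace_def)
  show c: "x \<in> S \<Longrightarrow> T (c *\<^sub>R x) = c *\<^sub>R T x" for x c
    using assms by (auto simp: linear_on_subspace_def)
  show "x \<in> S \<Longrightarrow> y \<in> S \<Longrightarrow> T (x - y) = T x - T y"
    using a[of x "(-1) *\<^sub>R y"] c[of y "-1"] subspace_scale[OF s, of y "-1"] by simp
  show "T 0 = 0" using c[of 0 0] subspace_0[OF s] by simp
qed

lemma linear_on_subspace_sum:
  assumes "linear_on_subspace S T" "\<And>i. i \<in> I \<Longrightarrow> f i \<in> S"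
  shows "T (\<Sum>i\<in>I. f i) = (\<Sum>i\<in>I. T (f i))"
  using assms(2)
proof (induction I rule: infinite_finite_induct)
  case (insert x F)
  then show ?case
    by (simp add: linear_on_subspaceD(2)[OF assms(1)]
        subspace_sum[OF linear_on_subspaceD(1)[OF assms(1)]])
qed (auto simp: linear_on_subspaceD(5)[OF assms(1)])

lemma bounded_linear_on_pos_bound:
  assumes "bounded_linear_on S T"
  obtains K where "K > 0" "\<And>x. x \<in> S \<Longrightarrow> norm (T x) \<le> K * norm x"
proof -
  obtain K where K: "\<And>x. x \<in> S \<Longrightarrow> norm (T x) \<le> norm x * K"
    using assms by (auto simp: bounded_linear_on_def)
  have "norm (T x) \<le> (\<bar>K\<bar> + 1) * norm x" if "x \<in> S" for x
  proof -
    have "norm x * K \<le> norm x * (\<bar>K\<bar> + 1)" by (intro mult_left_mono) auto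
    with K[OF that] show ?thesis by (simp add: mult.commute)
  qed
  then show ?thesis using that[of "\<bar>K\<bar> + 1"] by auto
qed

text \<open>\<open>T\<close> may behave arbitrarily off \<open>Z\<close>, so the arguments have to
  lie in \<open>Z\<close>, at least eventually.\<close>

lemma bounded_linear_on_tendsto:
  assumes T: "bounded_linear_on Z T" and l: "l \<in> Z"
    and f: "\<forall>\<^sub>F x in F. f x \<in> Z" "(f \<longlongrightarrow> l) F"
  shows "((\<lambda>x. T (f x)) \<longlongrightarrow> T l) F"
proof -
  have lin: "linear_on_subspace Z T" using T by (simp add: bounded_linear_on_def)
  obtain K where K: "K > 0" "\<And>x. x \<in> Z \<Longrightarrow> norm (T x) \<le> K * norm x"
    using bounded_linear_on_pos_bound[OF T] by blast
  have "((\<lambda>x. K * norm (f x - l)) \<longlongrightarrow> 0) F"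
    using f(2) by (intro tendsto_mult_right_zero tendsto_norm_zero) (simp add: LIM_zero)
  moreover have "\<forall>\<^sub>F x in F. norm (T (f x) - T l) \<le> K * norm (f x - l)"
    using f(1)
  proof eventually_elim
    case (elim x)
    show ?case
      unfolding linear_on_subspaceD(4)[OF lin elim l, symmetric]
      by (rule K(2)[OF subspace_diff[OF linear_on_subspaceD(1)[OF lin] elim l]])
  qed
  ultimately have "((\<lambda>x. T (f x) - T l) \<longlongrightarrow> 0) F" by (rule Lim_null_comparison[rotated])
  then show ?thesis by (simp add: LIM_zero_iff)
qed

lemma tagged_sum_in_subspace:
  assumes "subspace Z" "p tagged_division_of {a..b::real}" "\<And>x. x \<in> {a..b} \<Longrightarrow> f x \<in> Z"
  shows "(\<Sum>(x, k)\<in>p. measure lborel k *\<^sub>R f x) \<in> Z"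
proof (rule subspace_sum[OF assms(1)], clarify)
  fix x k assume "(x, k) \<in> p"
  then have "x \<in> {a..b}" using tagged_division_ofD(2,3)[OF assms(2)] by blast
  then show "measure lborel k *\<^sub>R f x \<in> Z" by (intro subspace_scale[OF assms(1)] assms(3))
qed

text \<open>Riemann sums are linear combinations of values of \<open>f\<close>, so they lie in
  \<open>Z\<close>, and closedness keeps their limit there.\<close>

lemma has_integral_in_closed_subspace:
  fixes f :: "real \<Rightarrow> 'b::real_normed_vector"
  assumes I: "(f has_integral I) {a..b}" and Z: "subspace Z" "closed Z"
    and f: "\<And>x. x \<in> {a..b} \<Longrightarrow> f x \<in> Z"
  shows "I \<in> Z"
proof -
  have "\<exists>y\<in>Z. dist y I < e" if e: "e > 0" for e
  proof -
    obtain \<gamma> where g: "gauge \<gamma> \<and> (\<forall>\<D>. \<D> tagged_division_of {a..b} \<and> \<gamma> fine \<D> \<longrightarrow>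
        norm ((\<Sum>(x,k)\<in>\<D>. measure lborel k *\<^sub>R f x) - I) < e)"
      using I[unfolded has_integral_real, rule_format, OF e] by (rule exE)
    obtain p where p: "p tagged_division_of {a..b}" "\<gamma> fine p"
      using fine_division_exists_real[OF conjunct1[OF g]] by blast
    show ?thesis
      using conjunct2[OF g, rule_format, OF conjI, OF p] tagged_sum_in_subspace[OF Z(1) p(1) f] by (auto simp: dist_norm)
  qed
  then have "I \<in> closure Z" by (simp add: closure_approachable)
  with Z(2) show ?thesis by simp
qed

text \<open>As \<open>T\<close> is linear only on \<open>Z\<close>, it is applied to the Riemann
  sums, which lie in \<open>Z\<close> together with \<open>I\<close>. A gauge for error
  \<open>e / K\<close> before applying \<open>T\<close>, with \<open>K\<close> a bound for
  \<open>T\<close>, gives error \<open>e\<close> afterwards.\<close>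

lemma has_integral_bounded_linear_on:
  fixes f :: "real \<Rightarrow> 'b::real_normed_vector" and T :: "'b \<Rightarrow> 'c::real_normed_vector"
  assumes I: "(f has_integral I) {a..b}" and Z: "closed Z" and T: "bounded_linear_on Z T"
    and f: "\<And>x. x \<in> {a..b} \<Longrightarrow> f x \<in> Z"
  shows "((\<lambda>x. T (f x)) has_integral T I) {a..b}"
  unfolding has_integral_real
proof (intro allI impI)
  fix e :: real assume e: "e > 0"
  have lin: "linear_on_subspace Z T" using T by (simp add: bounded_linear_on_def)
  note sub = linear_on_subspaceD(1)[OF lin]
  have IZ: "I \<in> Z" using has_integral_in_closed_subspace[OF I sub Z f] .
  obtain K where K: "K > 0" "\<And>x. x \<in> Z \<Longrightarrow> norm (T x) \<le> K * norm x"
    using bounded_linear_on_pos_bound[OF T] by blast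
  obtain \<gamma> where g: "gauge \<gamma> \<and> (\<forall>\<D>. \<D> tagged_division_of {a..b} \<and> \<gamma> fine \<D> \<longrightarrow>
      norm ((\<Sum>(x,k)\<in>\<D>. measure lborel k *\<^sub>R f x) - I) < e / K)"
    using I[unfolded has_integral_real, rule_format, OF divide_pos_pos[OF e K(1)]] by (rule exE)
  have key: "norm ((\<Sum>(x,k)\<in>p. measure lborel k *\<^sub>R T (f x)) - T I) < e"
    if p: "p tagged_division_of {a..b}" "\<gamma> fine p" for p
  proof -
    have fz: "f x \<in> Z" if "(x, k) \<in> p" for x k
      using tagged_division_ofD(2,3)[OF p(1) that] f by blast
    have "T (\<Sum>(x,k)\<in>p. measure lborel k *\<^sub>R f x) = (\<Sum>z\<in>p. T (case z of (x,k) \<Rightarrow> measure lborel k *\<^sub>R f x))"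
      by (rule linear_on_subspace_sum[OF lin]) (auto intro!: subspace_scale[OF sub] fz)
    also have "\<dots> = (\<Sum>(x,k)\<in>p. measure lborel k *\<^sub>R T (f x))"
      by (intro sum.cong) (auto simp: linear_on_subspaceD(3)[OF lin] fz)
    finally have "(\<Sum>(x,k)\<in>p. measure lborel k *\<^sub>R T (f x)) - T I = T ((\<Sum>(x,k)\<in>p. measure lborel k *\<^sub>R f x) - I)"
      using tagged_sum_in_subspace[OF sub p(1) f] IZ by (simp add: linear_on_subspaceD(4)[OF lin])
    also have "norm \<dots> \<le> K * norm ((\<Sum>(x,k)\<in>p. measure lborel k *\<^sub>R f x) - I)"
      using tagged_sum_in_subspace[OF sub p(1) f] IZ by (intro K subspace_diff[OF sub])
    also have "\<dots> < K * (e / K)" using conjunct2[OF g, rule_format, OF conjI, OF p] K(1) by (intro mult_strict_left_mono)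
    finally show ?thesis using K(1) by simp
  qed
  show "\<exists>\<gamma>. gauge \<gamma> \<and> (\<forall>\<D>. \<D> tagged_division_of {a..b} \<and> \<gamma> fine \<D> \<longrightarrow>
      norm ((\<Sum>(x, k)\<in>\<D>. measure lborel k *\<^sub>R T (f x)) - T I) < e)"
    by (intro exI[of _ \<gamma>] conjI allI impI, rule conjunct1[OF g], elim conjE, rule key)
qed

lemma integral_bounded_linear_on:
  fixes f :: "real \<Rightarrow> 'b::banach" and T :: "'b \<Rightarrow> 'c::real_normed_vector"
  assumes "continuous_on {a..b} f" "closed Z" "bounded_linear_on Z T" "\<And>x. x \<in> {a..b} \<Longrightarrow> f x \<in> Z"
  shows "integral {a..b} (\<lambda>x. T (f x)) = T (integral {a..b} f)"
  using has_integral_bounded_linear_on[OF integrable_integral[OF integrable_continuous_real[OF assms(1)]]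
      assms(2,3,4)] by (simp add: integral_unique)

lemma integral_in_closed_subspace:
  fixes f :: "real \<Rightarrow> 'b::banach"
  assumes "continuous_on {a..b} f" "subspace Z" "closed Z" "\<And>x. x \<in> {a..b} \<Longrightarrow> f x \<in> Z"
  shows "integral {a..b} f \<in> Z"
  using has_integral_in_closed_subspace[OF integrable_integral[OF integrable_continuous_real[OF assms(1)]]
      assms(2,3,4)] .

section \<open>Improper integrals of exponentially decaying functions\<close>

lemma real_at_top_cauchy:
  fixes f :: "real \<Rightarrow> 'b::banach"
  assumes "\<And>e. e > 0 \<Longrightarrow> \<exists>N. \<forall>x\<ge>N. \<forall>y\<ge>N. dist (f x) (f y) < e"
  shows "\<exists>l. (f \<longlongrightarrow> l) at_top"
proof -
  have "Cauchy (\<lambda>n. f (real n))"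
  proof (rule metric_CauchyI)
    fix e :: real assume "e > 0"
    then obtain N where N: "\<And>x y. x \<ge> N \<Longrightarrow> y \<ge> N \<Longrightarrow> dist (f x) (f y) < e" using assms by blast
    have "real n \<ge> N" if "n \<ge> nat \<lceil>N\<rceil>" for n using that by linarith
    then show "\<exists>M. \<forall>m\<ge>M. \<forall>n\<ge>M. dist (f (real m)) (f (real n)) < e" using N by blast
  qed
  then obtain l where l: "(\<lambda>n. f (real n)) \<longlonglongrightarrow> l" using Cauchy_convergent_iff convergent_def by blast
  have "(f \<longlongrightarrow> l) at_top"
  proof (rule tendstoI)
    fix e :: real assume "e > 0"
    then obtain N where N: "\<And>x y. x \<ge> N \<Longrightarrow> y \<ge> N \<Longrightarrow> dist (f x) (f y) < e/2"
      using assms[of "e/2"] by auto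
    have "eventually (\<lambda>n. dist (f (real n)) l < e/2) sequentially"
      using tendstoD[OF l, of "e/2"] \<open>e > 0\<close> by simp
    then obtain m where m: "\<And>n. n \<ge> m \<Longrightarrow> dist (f (real n)) l < e/2"
      by (auto simp: eventually_sequentially)
    define n where "n = max m (nat \<lceil>N\<rceil>)"
    have n: "real n \<ge> N" "n \<ge> m" unfolding n_def by linarith+
    have "dist (f x) l < e" if "x \<ge> N" for x
      using N[OF that n(1)] m[OF n(2)] dist_triangle[of "f x" l "f (real n)"] by linarith
    then show "eventually (\<lambda>x. dist (f x) l < e) at_top"
      unfolding eventually_at_top_linorder by blast
  qed
  then show ?thesis by blast
qed

text \<open>The right side is the integral of the majorant from \<open>a\<close> to infinity, which
  makes the estimate independent of \<open>b\<close>: it bounds all tails at once.\<close>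

lemma integral_exp_decay_le:
  fixes f :: "real \<Rightarrow> 'b::banach"
  assumes "continuous_on {0..} f" "\<And>r. r \<ge> 0 \<Longrightarrow> norm (f r) \<le> C * exp (- c * r)" "c > 0"
    "0 \<le> a" "a \<le> b"
  shows "norm (integral {a..b} f) \<le> C / c * exp (- c * a)"
proof -
  have C: "C \<ge> 0" using order_trans[OF norm_ge_zero assms(2)[of 0]] by simp
  have "((\<lambda>r. C * exp (- c * r)) has_integral
      ((\<lambda>r. - C / c * exp (- c * r)) b - (\<lambda>r. - C / c * exp (- c * r)) a)) {a..b}"
    using assms(3,5)
    by (intro fundamental_theorem_of_calculus)
      (auto intro!: derivative_eq_intros simp flip: has_real_derivative_iff_has_vector_derivative)
  then have I: "((\<lambda>r. C * exp (- c * r)) has_integral (C / c * exp (- c * a) - C / c * exp (- c * b))) {a..b}"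
    by simp
  have "f integrable_on {a..b}"
    using assms(4) by (intro integrable_continuous_real continuous_on_subset[OF assms(1)]) auto
  then have "norm (integral {a..b} f) \<le> integral {a..b} (\<lambda>r. C * exp (- c * r))"
    using assms(2,4) I by (intro integral_norm_bound_integral) (auto intro: has_integral_integrable)
  also have "\<dots> = C / c * exp (- c * a) - C / c * exp (- c * b)" using I by (rule integral_unique)
  also have "\<dots> \<le> C / c * exp (- c * a)" using C assms(3) by simp
  finally show ?thesis .
qed

lemma integral_reflect_shift:
  fixes f :: "real \<Rightarrow> 'b::banach"
  assumes "continuous_on {t - b..t - a} f"
  shows "integral {a..b} (\<lambda>s. f (t - s)) = integral {t - b..t - a} f"
proof -
  have "integral {a..b} (\<lambda>s. f (t - s)) = integral {-b..-a} (\<lambda>s. f (t + s))"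
    using Henstock_Kurzweil_Integration.integral_reflect_real[of b a "\<lambda>s. f (t - s)"] by simp
  also have "\<dots> = integral {-b + t..-a + t} f"
    using integral_shift_Icc_real[of "-b" "-a" f t] by (simp add: o_def)
  finally show ?thesis by (simp add: algebra_simps)
qed

lemma exp_decay_integrals:
  fixes f :: "real \<Rightarrow> 'b::banach"
  assumes cont: "continuous_on {0..} f"
    and bound: "\<And>r. r \<ge> 0 \<Longrightarrow> norm (f r) \<le> C * exp (- c * r)" and c: "c > 0"
  shows "(f has_integral integral {0..} f) {0..}"
    and "((\<lambda>N. integral {0..N} f) \<longlongrightarrow> integral {0..} f) at_top"
    and "norm (integral {0..} f) \<le> C / c"
    and "((\<lambda>s. f (t - s)) has_integral integral {0..} f) {..t}"
proof -
  have tail: "norm (integral {a..b} f) \<le> C / c * exp (- c * a)" if "0 \<le> a" "a \<le> b" for a b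
    using integral_exp_decay_le[OF cont bound c that] .
  have C: "C \<ge> 0" using order_trans[OF norm_ge_zero bound[of 0]] by simp
  have intf: "f integrable_on {a..b}" if "0 \<le> a" for a b
    using that by (intro integrable_continuous_real continuous_on_subset[OF cont]) auto
  have diff: "norm (integral {0..y} f - integral {0..x} f) \<le> C / c * exp (- c * x)"
    if "0 \<le> x" "x \<le> y" for x y
  proof -
    have "integral {0..x} f + integral {x..y} f = integral {0..y} f"
      using that by (intro Henstock_Kurzweil_Integration.integral_combine intf) auto
    then have "integral {0..y} f - integral {0..x} f = integral {x..y} f" by (simp add: algebra_simps)
    then show ?thesis using tail[OF that] by simp
  qed
  have lim0: "((\<lambda>x. C / c * exp (- c * x)) \<longlongrightarrow> 0) at_top"
  proof -
    have "filterlim (\<lambda>x. - c * x) at_bot at_top"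
      using c filterlim_tendsto_neg_mult_at_bot[OF tendsto_const, of "-c" "\<lambda>x. x" at_top]
      by (simp add: filterlim_ident)
    then have "((\<lambda>x. exp (- c * x)) \<longlongrightarrow> 0) at_top"
      by (rule filterlim_compose[OF exp_at_bot])
    from tendsto_mult_left[OF this, of "C / c"] show ?thesis by simp
  qed
  have "\<exists>l. ((\<lambda>N. integral {0..N} f) \<longlongrightarrow> l) at_top"
  proof (rule real_at_top_cauchy)
    fix e :: real assume e: "e > 0"
    have "eventually (\<lambda>x. C / c * exp (- c * x) < e) at_top"
      using lim0 e by (auto simp: order_tendsto_iff)
    then obtain N where N: "\<And>x. x \<ge> N \<Longrightarrow> C / c * exp (- c * x) < e"
      by (auto simp: eventually_at_top_linorder)
    have "dist (integral {0..x} f) (integral {0..y} f) < e" if "x \<ge> max 0 N" "y \<ge> max 0 N" for x y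
      using that diff[of x y] diff[of y x] N[of x] N[of y]
      by (cases "x \<le> y") (auto simp: dist_norm norm_minus_commute)
    then show "\<exists>N. \<forall>x\<ge>N. \<forall>y\<ge>N. dist (integral {0..x} f) (integral {0..y} f) < e" by blast
  qed
  then obtain I where I: "((\<lambda>N. integral {0..N} f) \<longlongrightarrow> I) at_top" by blast
  have near: "norm (integral {0..x} f - I) \<le> C / c * exp (- c * x)" if x: "0 \<le> x" for x
  proof -
    have "((\<lambda>y. norm (integral {0..y} f - integral {0..x} f)) \<longlongrightarrow> norm (I - integral {0..x} f)) at_top"
      by (intro tendsto_intros I)
    moreover have "eventually (\<lambda>y. norm (integral {0..y} f - integral {0..x} f) \<le> C / c * exp (- c * x)) at_top"
      using eventually_ge_at_top[of x] by eventually_elim (use x diff in auto)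
    ultimately have "norm (I - integral {0..x} f) \<le> C / c * exp (- c * x)"
      by (rule tendsto_upperbound) simp
    then show ?thesis by (simp add: norm_minus_commute)
  qed
  have small: "\<exists>B>0. \<forall>x\<ge>B. norm (integral {0..x} f - I) < e" if "e > 0" for e
  proof -
    have "eventually (\<lambda>x. C / c * exp (- c * x) < e) at_top"
      using lim0 that by (auto simp: order_tendsto_iff)
    then obtain N where N: "\<And>x. x \<ge> N \<Longrightarrow> C / c * exp (- c * x) < e"
      by (auto simp: eventually_at_top_linorder)
    have "norm (integral {0..x} f - I) < e" if "x \<ge> max 1 N" for x
      using near[of x] N[of x] that by auto
    then show ?thesis by (intro exI[of _ "max 1 N"]) auto
  qed
  \<comment> \<open>The improper integral is tested on intervals that contain a large ball; only the
    position of their endpoints matters.\<close>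
  have ends: "a \<le> - B \<and> B \<le> b" if "ball 0 B \<subseteq> {a..b}" "B > 0" for a b B :: real
  proof -
    have "{-B<..<B} \<subseteq> {a..b}" using that by (simp add: ball_eq_greaterThanLessThan)
    then have "closure {-B<..<B} \<subseteq> {a..b}" by (rule closure_minimal) simp
    then have "{-B..B} \<subseteq> {a..b}" using that(2) by simp
    then show ?thesis using that(2) by auto
  qed
  have hasI: "(f has_integral I) {0..}"
    unfolding has_integral_alt' cbox_interval
  proof (intro conjI allI impI)
    have eq: "{0..} \<inter> {a..b} = {max 0 a..b}" for a b :: real by auto
    show "(\<lambda>x. if x \<in> {0..} then f x else 0) integrable_on {a..b}" for a b
      by (subst integrable_restrict_Int) (simp add: eq intf)
    fix e :: real assume "e > 0"
    then obtain B where B: "B > 0" "\<And>x. x \<ge> B \<Longrightarrow> norm (integral {0..x} f - I) < e"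
      using small by blast
    have "norm (integral {a..b} (\<lambda>x. if x \<in> {0..} then f x else 0) - I) < e"
      if "ball 0 B \<subseteq> {a..b}" for a b
      using ends[OF that B(1)] B by (subst integral_restrict_Int) (simp add: eq max_def)
    with B(1) show "\<exists>B>0. \<forall>a b. ball 0 B \<subseteq> {a..b} \<longrightarrow>
        norm (integral {a..b} (\<lambda>x. if x \<in> {0..} then f x else 0) - I) < e" by blast
  qed
  then have Ieq: "integral {0..} f = I" by (rule integral_unique)
  show "(f has_integral integral {0..} f) {0..}" using hasI Ieq by simp
  show "((\<lambda>N. integral {0..N} f) \<longlongrightarrow> integral {0..} f) at_top" using I Ieq by simp
  show "norm (integral {0..} f) \<le> C / c"
    using near[of 0] Ieq by simp
  have "((\<lambda>s. f (t - s)) has_integral I) {..t}"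
    unfolding has_integral_alt' cbox_interval
  proof (intro conjI allI impI)
    have eq: "{..t} \<inter> {a..b} = {a..min t b}" for a b :: real by auto
    have contr: "continuous_on {a..min t b} (\<lambda>s. f (t - s))" for a b
      by (intro continuous_on_compose2[OF cont]) (auto intro!: continuous_intros)
    show "(\<lambda>x. if x \<in> {..t} then f (t - x) else 0) integrable_on {a..b}" for a b
      by (subst integrable_restrict_Int)
        (use contr in \<open>auto simp: eq intro: integrable_continuous_real\<close>)
    fix e :: real assume "e > 0"
    then obtain B where B: "B > 0" "\<And>x. x \<ge> B \<Longrightarrow> norm (integral {0..x} f - I) < e"
      using small by blast
    \<comment> \<open>Enlarging the radius by \<open>\<bar>t\<bar>\<close> ensures both
      \<open>t \<le> b\<close> and \<open>t - a \<ge> B\<close>, so the reflected integral runs over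
      \<open>{0..t - a}\<close>.\<close>
    have "norm (integral {a..b} (\<lambda>x. if x \<in> {..t} then f (t - x) else 0) - I) < e"
      if "ball 0 (B + \<bar>t\<bar>) \<subseteq> {a..b}" for a b
    proof -
      have ab: "a \<le> - (B + \<bar>t\<bar>)" "B + \<bar>t\<bar> \<le> b" using ends[OF that] B(1) by auto
      have "integral {a..b} (\<lambda>x. if x \<in> {..t} then f (t - x) else 0) = integral {a..t} (\<lambda>x. f (t - x))"
        using ab B(1) by (subst integral_restrict_Int) (simp add: eq min_def)
      also have "\<dots> = integral {0..t - a} f"
        using integral_reflect_shift[of t t a f] continuous_on_subset[OF cont, of "{t-t..t-a}"] by auto
      finally show ?thesis using B(2)[of "t - a"] ab by auto
    qed
    with B(1) show "\<exists>B>0. \<forall>a b. ball 0 B \<subseteq> {a..b} \<longrightarrow>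
        norm (integral {a..b} (\<lambda>x. if x \<in> {..t} then f (t - x) else 0) - I) < e"
      by (intro exI[of _ "B + \<bar>t\<bar>"]) auto
  qed
  then show "((\<lambda>s. f (t - s)) has_integral integral {0..} f) {..t}" using Ieq by simp
qed

text \<open>Integration by parts: the product of \<open>r - a\<close> and the tail integral
  \<open>P r\<close> vanishes at both ends. It evaluates the correction that arises when an integral
  over a triangle is completed to one over a square.\<close>

lemma integral_triangle_const:
  fixes h :: "real \<Rightarrow> 'b::banach"
  assumes "a \<le> b" "continuous_on {a..b} h"
  shows "integral {a..b} (\<lambda>r. integral {r..b} h) = integral {a..b} (\<lambda>r. (r - a) *\<^sub>R h r)"
proof -
  have inth: "h integrable_on {x..y}" if "a \<le> x" "y \<le> b" for x y
    using that by (intro integrable_continuous_real continuous_on_subset[OF assms(2)]) auto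
  define P where "P r = integral {a..b} h - integral {a..r} h" for r
  have P: "integral {r..b} h = P r" if "r \<in> {a..b}" for r
    using Henstock_Kurzweil_Integration.integral_combine[of a r b h] inth[of a b] that by (simp add: P_def algebra_simps)
  have dP: "(P has_vector_derivative - h r) (at r within {a..b})" if "r \<in> {a..b}" for r
    unfolding P_def
    using integral_has_vector_derivative[OF assms(2) that]
    by (auto intro!: derivative_eq_intros)
  have "((\<lambda>r. (r - a) *\<^sub>R (- h r) + 1 *\<^sub>R P r) has_integral ((b - a) *\<^sub>R P b - (a - a) *\<^sub>R P a)) {a..b}"
    using assms(1)
    by (intro fundamental_theorem_of_calculus has_vector_derivative_scaleR dP)
      (auto intro!: derivative_eq_intros)
  then have 1: "((\<lambda>r. P r - (r - a) *\<^sub>R h r) has_integral 0) {a..b}"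
    by (simp add: P_def algebra_simps)
  have 2: "((\<lambda>r. (r - a) *\<^sub>R h r) has_integral integral {a..b} (\<lambda>r. (r - a) *\<^sub>R h r)) {a..b}"
    by (intro integrable_integral integrable_continuous_real continuous_intros assms(2))
  have "(P has_integral integral {a..b} (\<lambda>r. (r - a) *\<^sub>R h r)) {a..b}"
    using has_integral_add[OF 1 2] by simp
  then have "integral {a..b} P = integral {a..b} (\<lambda>r. (r - a) *\<^sub>R h r)" by (rule integral_unique)
  moreover have "integral {a..b} (\<lambda>r. integral {r..b} h) = integral {a..b} P"
    by (intro integral_cong P)
  ultimately show ?thesis by simp
qed

text \<open>Extending \<open>H\<close> to the square by \<open>H (max r s) s\<close> keeps it continuous.\<close>

lemma
  fixes H :: "real \<Rightarrow> real \<Rightarrow> 'b::banach"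
  assumes cont: "continuous_on {(r, s). s \<le> r} (\<lambda>(r, s). H r s)" and ab: "a \<le> b"
  shows continuous_on_triangle_integral: "continuous_on {a..b} (\<lambda>r. integral {a..r} (H r))"
    and continuous_on_triangle_integral2: "continuous_on {a..b} (\<lambda>s. integral {s..b} (\<lambda>r. H r s))"
    and integral_triangle_swap:
      "integral {a..b} (\<lambda>s. integral {s..b} (\<lambda>r. H r s)) = integral {a..b} (\<lambda>r. integral {a..r} (H r))"
proof -
  define K where "K r s = H (max r s) s" for r s
  have "continuous_on UNIV (\<lambda>p. case (max (fst p) (snd p), snd p) of (r, s) \<Rightarrow> H r s)"
    by (intro continuous_on_compose2[OF cont] continuous_intros) auto
  then have K: "continuous_on S (\<lambda>(r, s). K r s)" for S
    by (auto simp: K_def case_prod_beta intro: continuous_on_subset)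
  have h: "continuous_on S (\<lambda>s. H s s)" for S
    by (intro continuous_on_compose2[OF cont, of _ "\<lambda>s. (s, s)", simplified] continuous_intros) auto
  have Kr: "continuous_on S (K r)" for S r
    using continuous_on_compose2[OF K[of UNIV], of S "\<lambda>s. (r, s)"]
      continuous_on_Pair[OF continuous_on_const continuous_on_id, of S r] by simp
  have Ks: "continuous_on S (\<lambda>r. K r s)" for S s
    using continuous_on_compose2[OF K[of UNIV], of S "\<lambda>r. (r, s)"]
      continuous_on_Pair[OF continuous_on_id continuous_on_const, of S s] by simp
  \<comment> \<open>The extension \<open>K\<close> takes the diagonal value \<open>H s s\<close> for
    \<open>r < s\<close>, so completing the triangle to the square adds an explicit integral of
    diagonal values, here and in \<open>ints\<close>.\<close>
  have intr: "integral {a..r} (H r) = integral {a..b} (K r) - integral {r..b} (\<lambda>s. H s s)"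
    if "r \<in> {a..b}" for r
  proof -
    have "integral {a..b} (K r) = integral {a..r} (K r) + integral {r..b} (K r)"
      using Henstock_Kurzweil_Integration.integral_combine[of a r b "K r"] that Kr by (simp add: integrable_continuous_real)
    moreover have "integral {a..r} (K r) = integral {a..r} (H r)"
      by (intro integral_cong) (auto simp: K_def max_def)
    moreover have "integral {r..b} (K r) = integral {r..b} (\<lambda>s. H s s)"
      by (intro integral_cong) (auto simp: K_def max_def)
    ultimately show ?thesis by simp
  qed
  have ints: "integral {s..b} (\<lambda>r. H r s) = integral {a..b} (\<lambda>r. K r s) - (s - a) *\<^sub>R H s s"
    if "s \<in> {a..b}" for s
  proof -
    have "integral {a..b} (\<lambda>r. K r s) = integral {a..s} (\<lambda>r. K r s) + integral {s..b} (\<lambda>r. K r s)"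
      using Henstock_Kurzweil_Integration.integral_combine[of a s b "\<lambda>r. K r s"] that Ks by (simp add: integrable_continuous_real)
    moreover have "integral {a..s} (\<lambda>r. K r s) = integral {a..s} (\<lambda>r. H s s)"
      by (intro integral_cong) (auto simp: K_def max_def)
    moreover have "integral {s..b} (\<lambda>r. K r s) = integral {s..b} (\<lambda>r. H r s)"
      by (intro integral_cong) (auto simp: K_def max_def)
    ultimately show ?thesis using that by simp
  qed
  have cK1: "continuous_on {a..b} (\<lambda>r. integral {a..b} (K r))"
    using integral_continuous_on_param[of "{a..b}" a b K] K by simp
  have cK2: "continuous_on {a..b} (\<lambda>s. integral {a..b} (\<lambda>r. K r s))"
  proof -
    have "continuous_on UNIV (\<lambda>p. (\<lambda>(r, s). K r s) (snd p, fst p))"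
      by (intro continuous_on_compose2[OF K[of UNIV]] continuous_intros) auto
    then show ?thesis
      using integral_continuous_on_param[of "{a..b}" a b "\<lambda>s r. K r s"]
      by (auto simp: case_prod_beta intro: continuous_on_subset)
  qed
  have ch: "continuous_on {a..b} (\<lambda>r. integral {r..b} (\<lambda>s. H s s))"
    using indefinite_integral_continuous_1'[OF integrable_continuous_real[OF h, of a b]] by simp
  show "continuous_on {a..b} (\<lambda>r. integral {a..r} (H r))"
    by (subst continuous_on_cong[OF refl intr]) (auto intro!: continuous_intros cK1 ch)
  show "continuous_on {a..b} (\<lambda>s. integral {s..b} (\<lambda>r. H r s))"
    by (subst continuous_on_cong[OF refl ints]) (auto intro!: continuous_intros cK2 h)
  have "integral {a..b} (\<lambda>s. integral {s..b} (\<lambda>r. H r s)) =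
      integral {a..b} (\<lambda>s. integral {a..b} (\<lambda>r. K r s) - (s - a) *\<^sub>R H s s)"
    by (intro integral_cong ints)
  also have "\<dots> = integral {a..b} (\<lambda>s. integral {a..b} (\<lambda>r. K r s)) - integral {a..b} (\<lambda>s. (s - a) *\<^sub>R H s s)"
    by (intro integral_diff integrable_continuous_real cK2 continuous_intros h)
  also have "integral {a..b} (\<lambda>s. integral {a..b} (\<lambda>r. K r s)) = integral {a..b} (\<lambda>r. integral {a..b} (K r))"
    using integral_swap_continuous[of a a b b K] K by (simp add: eta_contract_eq)
  \<comment> \<open>The two diagonal corrections agree, so exchanging the integrals over the square
    exchanges them over the triangle.\<close>
  also have "integral {a..b} (\<lambda>s. (s - a) *\<^sub>R H s s) = integral {a..b} (\<lambda>r. integral {r..b} (\<lambda>s. H s s))"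
    by (rule integral_triangle_const[OF ab h, symmetric])
  also have "integral {a..b} (\<lambda>r. integral {a..b} (K r)) - integral {a..b} (\<lambda>r. integral {r..b} (\<lambda>s. H s s)) =
      integral {a..b} (\<lambda>r. integral {a..b} (K r) - integral {r..b} (\<lambda>s. H s s))"
    by (intro integral_diff[symmetric] integrable_continuous_real cK1 ch)
  also have "\<dots> = integral {a..b} (\<lambda>r. integral {a..r} (H r))"
    by (intro integral_cong intr[symmetric])
  finally show "integral {a..b} (\<lambda>s. integral {s..b} (\<lambda>r. H r s)) =
      integral {a..b} (\<lambda>r. integral {a..r} (H r))" .
qed

section \<open>Operators on subspaces\<close>

lemma onorm_on_bound:
  assumes "bounded_linear_on S T" "x \<in> S"
  shows "norm (T x) \<le> onorm_on S T * norm x"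
proof (cases "x = 0")
  case True
  then show ?thesis
    using linear_on_subspaceD(5)[of S T] assms by (simp add: bounded_linear_on_def)
next
  case False
  obtain K where K: "K > 0" "\<And>x. x \<in> S \<Longrightarrow> norm (T x) \<le> K * norm x"
    using bounded_linear_on_pos_bound[OF assms(1)] by blast
  have "norm (T x) / norm x \<le> K" if "x \<in> S" for x
    using K(1) K(2)[OF that] by (cases "x = 0") (auto simp: field_simps)
  then have "bdd_above ((\<lambda>x. norm (T x) / norm x) ` S)" by (auto intro!: bdd_aboveI)
  then have "norm (T x) / norm x \<le> onorm_on S T"
    unfolding onorm_on_def using assms(2) by (intro cSUP_upper)
  with False show ?thesis by (simp add: field_simps)
qed

text \<open>Nonnegativity of \<open>C\<close> covers the vector 0, where the quotient in
  \<open>onorm_on\<close> is \<open>0 / 0 = 0\<close>.\<close>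

lemma onorm_on_le:
  assumes "S \<noteq> {}" "0 \<le> C" "\<And>x. x \<in> S \<Longrightarrow> norm (T x) \<le> C * norm x"
  shows "onorm_on S T \<le> C"
  unfolding onorm_on_def
proof (rule cSUP_least[OF assms(1)])
  fix x assume "x \<in> S"
  then show "norm (T x) / norm x \<le> C"
    using assms(2) assms(3)[of x] by (cases "x = 0") (auto simp: field_simps)
qed

lemma bounded_linear_on_subspace: "bounded_linear_on S T \<Longrightarrow> subspace S"
  by (simp add: bounded_linear_on_def linear_on_subspace_def)

lemma onorm_on_nonneg:
  assumes "bounded_linear_on S T"
  shows "0 \<le> onorm_on S T"
proof -
  obtain K where K: "K > 0" "\<And>x. x \<in> S \<Longrightarrow> norm (T x) \<le> K * norm x"
    using bounded_linear_on_pos_bound[OF assms] by blast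
  have "norm (T x) / norm x \<le> K" if "x \<in> S" for x
    using K(1) K(2)[OF that] by (cases "x = 0") (auto simp: field_simps)
  then have "bdd_above ((\<lambda>x. norm (T x) / norm x) ` S)" by (auto intro!: bdd_aboveI)
  then have "norm (T 0) / norm (0::'a) \<le> onorm_on S T"
    unfolding onorm_on_def
    using subspace_0[OF bounded_linear_on_subspace[OF assms]] by (rule cSUP_upper[rotated])
  then show ?thesis by simp
qed

lemma bounded_linear_on_diff:
  assumes T: "bounded_linear_on S T" and U: "bounded_linear_on S U"
  shows "bounded_linear_on S (\<lambda>x. T x - U x)"
proof -
  have lT: "linear_on_subspace S T" and lU: "linear_on_subspace S U"
    using assms by (auto simp: bounded_linear_on_def)
  have "norm (T x - U x) \<le> norm x * (onorm_on S T + onorm_on S U)" if "x \<in> S" for x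
    using onorm_on_bound[OF T that] onorm_on_bound[OF U that] norm_triangle_ineq4[of "T x" "U x"]
    by (simp add: algebra_simps)
  moreover have "linear_on_subspace S (\<lambda>x. T x - U x)"
    unfolding linear_on_subspace_def
    using linear_on_subspaceD(1)[OF lT]
    by (auto simp: algebra_simps linear_on_subspaceD(2,3)[OF lT] linear_on_subspaceD(2,3)[OF lU])
  ultimately show ?thesis unfolding bounded_linear_on_def by blast
qed

lemma opdist_bound:
  assumes "bounded_linear_on S T" "bounded_linear_on S U" "x \<in> S"
  shows "norm (T x - U x) \<le> opdist S T U * norm x"
  using onorm_on_bound[OF bounded_linear_on_diff[OF assms(1,2)] assms(3)] by (simp add: opdist_def)


section \<open>Almost periodicity\<close>

text \<open>Distances are required to behave like a metric only between values of \<open>f\<close>: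
  \<open>opdist S\<close> vanishes for operators that differ merely off \<open>S\<close>, and its
  supremum is meaningful only for operators bounded on \<open>S\<close>.\<close>

definition pseudometric_along :: "('y \<Rightarrow> 'y \<Rightarrow> real) \<Rightarrow> (real \<Rightarrow> 'y) \<Rightarrow> bool" where
  "pseudometric_along d f \<longleftrightarrow> (\<forall>t. d (f t) (f t) = 0) \<and> (\<forall>s t. d (f s) (f t) = d (f t) (f s)) \<and>
     (\<forall>r s t. d (f r) (f t) \<le> d (f r) (f s) + d (f s) (f t))"

lemma pseudometric_along_dist: "pseudometric_along dist f"
  by (auto simp: pseudometric_along_def dist_commute dist_triangle)

lemma pseudometric_along_opdist:
  assumes "\<And>t. bounded_linear_on S (V t)"
  shows "pseudometric_along (opdist S) V"
  unfolding pseudometric_along_def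
proof (intro conjI allI)
  note sub = bounded_linear_on_subspace[OF assms[of 0]]
  have ne: "S \<noteq> {}" using subspace_0[OF sub] by blast
  show "opdist S (V t) (V t) = 0" for t
    unfolding opdist_def onorm_on_def using ne by simp
  show "opdist S (V s) (V t) = opdist S (V t) (V s)" for s t
    unfolding opdist_def onorm_on_def by (simp add: norm_minus_commute)
  show "opdist S (V r) (V t) \<le> opdist S (V r) (V s) + opdist S (V s) (V t)" for r s t
    unfolding opdist_def[of S "V r" "V t"]
  proof (rule onorm_on_le[OF ne])
    show "0 \<le> opdist S (V r) (V s) + opdist S (V s) (V t)"
      unfolding opdist_def by (intro add_nonneg_nonneg onorm_on_nonneg bounded_linear_on_diff assms)
    fix x assume x: "x \<in> S"
    show "norm (V r x - V t x) \<le> (opdist S (V r) (V s) + opdist S (V s) (V t)) * norm x"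
      using opdist_bound[OF assms[of r] assms[of s] x] opdist_bound[OF assms[of s] assms[of t] x]
        norm_triangle_ineq[of "V r x - V s x" "V s x - V t x"]
      by (simp add: algebra_simps)
  qed
qed

lemma relatively_dense_mono: "relatively_dense S \<Longrightarrow> S \<subseteq> S' \<Longrightarrow> relatively_dense S'"
  unfolding relatively_dense_def by blast

text \<open>Compare both values with the one at \<open>t - rho\<close>; symmetry turns the
  near-period \<open>rho\<close> into \<open>- rho\<close>.\<close>

lemma translation_set_diff:
  assumes "pseudometric_along d f" "tau \<in> translation_set d f e" "rho \<in> translation_set d f e'"
  shows "tau - rho \<in> translation_set d f (e + e')"
  unfolding translation_set_def
proof (intro CollectI allI)
  fix t
  have "d (f (t - rho + tau)) (f (t - rho)) < e" "d (f (t - rho + rho)) (f (t - rho)) < e'"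
    using assms(2,3) unfolding translation_set_def by blast+
  moreover have "d (f (t - rho + tau)) (f t) \<le> d (f (t - rho + tau)) (f (t - rho)) + d (f (t - rho)) (f t)"
    and "d (f (t - rho)) (f t) = d (f t) (f (t - rho))"
    using assms(1) unfolding pseudometric_along_def by blast+
  ultimately show "d (f (t + (tau - rho))) (f t) < e + e'" by (simp add: algebra_simps)
qed

text \<open>A near-period carries any \<open>t\<close> into a fixed compact interval, and there
  continuity is uniform by the Lebesgue number of a cover. The covering argument takes place on the
  real line because \<open>d\<close> need not be the metric of a type.\<close>

lemma almost_periodic_uniformly_continuous:
  assumes pm: "pseudometric_along d f" and ap: "almost_periodic d f" and e: "e > 0"
  obtains \<delta> where "\<delta> > 0" "\<And>tau. \<bar>tau\<bar> < \<delta> \<Longrightarrow> tau \<in> translation_set d f e"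
proof -
  have refl: "d (f t) (f t) = 0" and sym: "d (f s) (f t) = d (f t) (f s)"
    and tri: "d (f r) (f t) \<le> d (f r) (f s) + d (f s) (f t)" for r s t
    using pm by (auto simp: pseudometric_along_def)
  obtain l where l: "l > 0" "\<And>c. {c..c + l} \<inter> translation_set d f (e/3) \<noteq> {}"
    using ap e unfolding almost_periodic_def relatively_dense_def by (meson divide_pos_pos zero_less_numeral)
  have "\<exists>r>0. \<forall>s. \<bar>s - x\<bar> < r \<longrightarrow> d (f s) (f x) < e/6" for x
  proof -
    have "((\<lambda>s. d (f s) (f x)) \<longlongrightarrow> 0) (at x)" using ap by (simp add: almost_periodic_def)
    then have "\<forall>\<^sub>F s in at x. dist (d (f s) (f x)) 0 < e/6" using e by (intro tendstoD) auto
    then obtain r where r: "r > 0" "\<And>s. s \<noteq> x \<Longrightarrow> dist s x < r \<Longrightarrow> dist (d (f s) (f x)) 0 < e/6"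
      unfolding eventually_at by blast
    have "d (f s) (f x) < e/6" if "\<bar>s - x\<bar> < r" for s
      using r(2)[of s] that e refl by (cases "s = x") (auto simp: dist_real_def)
    with r(1) show ?thesis by blast
  qed
  then obtain r where r: "\<And>x. r x > 0" "\<And>x s. \<bar>s - x\<bar> < r x \<Longrightarrow> d (f s) (f x) < e/6" by metis
  obtain \<delta> where \<delta>: "\<delta> > 0" "\<And>x. x \<in> {-1..l+1} \<Longrightarrow> \<exists>g\<in>range (\<lambda>x. ball x (r x)). ball x \<delta> \<subseteq> g"
  proof (rule Heine_Borel_lemma[of "{-1..l+1}" "range (\<lambda>x. ball x (r x))"])
    show "{-1..l+1} \<subseteq> \<Union> (range (\<lambda>x. ball x (r x)))"
      by (intro subsetI, rule_tac X = "ball x (r x)" in UnionI) (simp_all add: r(1))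
  qed (use that in auto)
  have close: "d (f s) (f t) < e/3" if st: "t \<in> {-1..l+1}" "\<bar>s - t\<bar> < \<delta>" for s t
  proof -
    obtain x where x: "ball t \<delta> \<subseteq> ball x (r x)" using \<delta>(2)[OF st(1)] by blast
    have "s \<in> ball t \<delta>" "t \<in> ball t \<delta>" using st(2) \<delta>(1) by (auto simp: dist_real_def)
    then have "s \<in> ball x (r x)" "t \<in> ball x (r x)" using subsetD[OF x] by simp_all
    then have "d (f s) (f x) < e/6" "d (f t) (f x) < e/6"
      using r(2)[of s x] r(2)[of t x] by (auto simp: dist_real_def abs_minus_commute)
    then show ?thesis using tri[of s t x] sym[of x t] by simp
  qed
  show ?thesis
  proof (rule that[of "\<delta>"])
    show "\<delta> > 0" by fact
    fix tau assume tau: "\<bar>tau\<bar> < \<delta>"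
    show "tau \<in> translation_set d f e"
      unfolding translation_set_def
    proof (intro CollectI allI)
      fix t
      obtain \<rho> where \<rho>: "\<rho> \<in> {-t..-t+l}" "\<rho> \<in> translation_set d f (e/3)"
        using l(2)[of "-t"] by blast
      have 1: "d (f (t + tau + \<rho>)) (f (t + tau)) < e/3" "d (f (t + \<rho>)) (f t) < e/3"
        using \<rho>(2) unfolding translation_set_def by blast+
      have 2: "d (f (t + tau + \<rho>)) (f (t + \<rho>)) < e/3"
        using tau \<rho>(1) l(1) by (intro close) auto
      show "d (f (t + tau)) (f t) < e"
        using 1 2 tri[of "t + tau" t "t + tau + \<rho>"] tri[of "t + tau + \<rho>" t "t + \<rho>"]
          sym[of "t + tau" "t + tau + \<rho>"] by linarith
    qed
  qed
qed

text \<open>Pigeonhole: pick near-periods of both functions in each \<open>[n l, n l + l]\<close>; the differences of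
  those indices \<open>n\<close> for which the two picks are offset by nearly the same amount give common ones.\<close>

lemma relatively_dense_common_translations:
  assumes pm1: "pseudometric_along d1 f1" and ap1: "almost_periodic d1 f1"
    and pm2: "pseudometric_along d2 f2" and ap2: "almost_periodic d2 f2"
    and e1: "e1 > 0" and e2: "e2 > 0"
  shows "relatively_dense (translation_set d1 f1 e1 \<inter> translation_set d2 f2 e2)"
proof -
  \<comment> \<open>\<open>e1/4\<close> because a difference of two picks has error
    \<open>e1/2\<close>; the other half pays for the offset between the picks for \<open>f1\<close>
    and those for \<open>f2\<close>.\<close>
  obtain l1 where l1: "l1 > 0" "\<And>c. {c..c + l1} \<inter> translation_set d1 f1 (e1/4) \<noteq> {}"
    using ap1 e1 unfolding almost_periodic_def relatively_dense_def by (meson divide_pos_pos zero_less_numeral)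
  obtain l2 where l2: "l2 > 0" "\<And>c. {c..c + l2} \<inter> translation_set d2 f2 (e2/2) \<noteq> {}"
    using ap2 e2 unfolding almost_periodic_def relatively_dense_def by (meson divide_pos_pos zero_less_numeral)
  define l where "l = max l1 l2"
  have l: "l > 0" using l1(1) by (simp add: l_def)
  have "\<exists>x. x \<in> {real_of_int n * l..real_of_int n * l + l} \<and> x \<in> translation_set d1 f1 (e1/4)" for n
    using l1(2)[of "real_of_int n * l"] by (force simp: l_def)
  then obtain \<tau> where \<tau>: "\<And>n. \<tau> n \<in> {real_of_int n * l..real_of_int n * l + l}"
    "\<And>n. \<tau> n \<in> translation_set d1 f1 (e1/4)" by metis
  have "\<exists>x. x \<in> {real_of_int n * l..real_of_int n * l + l} \<and> x \<in> translation_set d2 f2 (e2/2)" for n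
    using l2(2)[of "real_of_int n * l"] by (force simp: l_def)
  then obtain \<rho> where \<rho>: "\<And>n. \<rho> n \<in> {real_of_int n * l..real_of_int n * l + l}"
    "\<And>n. \<rho> n \<in> translation_set d2 f2 (e2/2)" by metis
  obtain \<delta> where \<delta>: "\<delta> > 0" "\<And>tau. \<bar>tau\<bar> < \<delta> \<Longrightarrow> tau \<in> translation_set d1 f1 (e1/2)"
    using almost_periodic_uniformly_continuous[OF pm1 ap1, of "e1/2"] e1 by auto
  define b where "b n = \<lfloor>(\<tau> n - \<rho> n) / \<delta>\<rfloor>" for n
  have bucket: "\<bar>(\<tau> n - \<rho> n) - (\<tau> m - \<rho> m)\<bar> < \<delta>" if "b n = b m" for n m
  proof -
    have "\<bar>(\<tau> n - \<rho> n) / \<delta> - (\<tau> m - \<rho> m) / \<delta>\<bar> < 1"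
      using that unfolding b_def by linarith
    then have "\<bar>((\<tau> n - \<rho> n) - (\<tau> m - \<rho> m)) / \<delta>\<bar> < 1" by (simp add: diff_divide_distrib)
    then show ?thesis using \<delta>(1) by (simp add: abs_divide)
  qed
  have "b n \<in> {\<lfloor>- l / \<delta>\<rfloor>..\<lfloor>l / \<delta>\<rfloor>}" for n
  proof -
    have "- l \<le> \<tau> n - \<rho> n" "\<tau> n - \<rho> n \<le> l"
      using \<tau>(1)[of n] \<rho>(1)[of n] by auto
    then have "- l / \<delta> \<le> (\<tau> n - \<rho> n) / \<delta>" "(\<tau> n - \<rho> n) / \<delta> \<le> l / \<delta>"
      using \<delta>(1) by (intro divide_right_mono; simp)+
    then show ?thesis unfolding b_def atLeastAtMost_iff by (intro conjI floor_mono)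
  qed
  then have "finite (range b)" by (intro finite_subset[OF _ finite_atLeastAtMost_int]) blast
  \<comment> \<open>\<open>r k\<close> is a fixed index in bucket \<open>k\<close>; as there are
    finitely many buckets, these indices are bounded by some \<open>K\<close>.\<close>
  define r where "r k = (SOME n. b n = k)" for k
  have r: "b (r (b n)) = b n" for n unfolding r_def by (rule someI) simp
  define K where "K = Max ((\<lambda>k. \<bar>r k\<bar>) ` range b)"
  have K: "\<bar>r (b n)\<bar> \<le> K" for n
    unfolding K_def using \<open>finite (range b)\<close> by (intro Max_ge) auto
  have "0 \<le> K" using K[of 0] by simp
  have "\<exists>x\<in>{c..c + (2 * real_of_int K + 3) * l}. x \<in> translation_set d1 f1 e1 \<inter> translation_set d2 f2 e2" for c
  proof -
    \<comment> \<open>The shift by \<open>K + 1\<close> makes \<open>n - m - 1 \<ge> c / l\<close>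
      for every representative with \<open>\<bar>m\<bar> \<le> K\<close>. In the other direction,
      rounding up adds at most 1, which gives the length \<open>(2 * K + 3) * l\<close>.\<close>
    define n where "n = \<lceil>c / l\<rceil> + K + 1"
    define m where "m = r (b n)"
    have bm: "b n = b m" and mK: "\<bar>m\<bar> \<le> K" using r K by (auto simp: m_def)
    have s2: "\<rho> n - \<rho> m \<in> translation_set d2 f2 e2"
      using translation_set_diff[OF pm2 \<rho>(2)[of n] \<rho>(2)[of m]] by simp
    have "\<tau> n - \<tau> m \<in> translation_set d1 f1 (e1/2)"
      using translation_set_diff[OF pm1 \<tau>(2)[of n] \<tau>(2)[of m]] by simp
    from translation_set_diff[OF pm1 this \<delta>(2)[OF bucket[OF bm]]]
    have s1: "\<rho> n - \<rho> m \<in> translation_set d1 f1 e1" by (simp add: algebra_simps)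
    have lo: "real_of_int (n - m - 1) * l \<le> \<rho> n - \<rho> m" and hi: "\<rho> n - \<rho> m \<le> real_of_int (n - m + 1) * l"
      using \<rho>(1)[of n] \<rho>(1)[of m] by (auto simp: algebra_simps)
    have "c / l \<le> real_of_int (n - m - 1)" using mK unfolding n_def by linarith
    then have "c \<le> real_of_int (n - m - 1) * l" using l by (simp add: field_simps)
    moreover have "real_of_int (n - m + 1) \<le> c / l + (2 * real_of_int K + 3)"
      using mK unfolding n_def by linarith
    then have "real_of_int (n - m + 1) * l \<le> (c / l + (2 * real_of_int K + 3)) * l"
      using l by (intro mult_right_mono) auto
    then have "real_of_int (n - m + 1) * l \<le> c + (2 * real_of_int K + 3) * l"
      using l by (simp add: algebra_simps)
    ultimately show ?thesis using lo hi s1 s2 by (intro bexI[of _ "\<rho> n - \<rho> m"]) auto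
  qed
  then show ?thesis
    unfolding relatively_dense_def using l \<open>0 \<le> K\<close>
    by (intro exI[of _ "(2 * real_of_int K + 3) * l"] conjI) (auto intro!: mult_pos_pos)
qed

section \<open>Almost periodic functions as a closed subspace of the bounded continuous ones\<close>

lemma AP_I:
  assumes "continuous_on UNIV f" "\<And>t. f t \<in> Z"
    "\<And>e. e > 0 \<Longrightarrow> relatively_dense (translation_set dist f e)"
  shows "Bcontfun f \<in> AP Z" "apply_bcontfun (Bcontfun f) = f"
proof -
  have ap: "almost_periodic dist f" using assms by (simp add: almost_periodic_dist_iff)
  show *: "apply_bcontfun (Bcontfun f) = f"
    by (rule Bcontfun_inverse[OF almost_periodic_imp_bcontfun[OF ap]])
  show "Bcontfun f \<in> AP Z" unfolding AP_def using ap assms(2) by (auto simp: *)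
qed

lemma AP_D:
  assumes "\<phi> \<in> AP Z"
  shows "apply_bcontfun \<phi> t \<in> Z" "almost_periodic dist (apply_bcontfun \<phi>)"
    "e > 0 \<Longrightarrow> relatively_dense (translation_set dist (apply_bcontfun \<phi>) e)"
  using assms unfolding AP_def by (auto simp: almost_periodic_dist_iff)

lemma AP_mono: "Z \<subseteq> Z' \<Longrightarrow> AP Z \<subseteq> AP Z'"
  unfolding AP_def by auto

lemma AP_iff:
  "\<phi> \<in> AP Z \<longleftrightarrow> (\<forall>t. apply_bcontfun \<phi> t \<in> Z) \<and>
     (\<forall>e>0. relatively_dense (translation_set dist (apply_bcontfun \<phi>) e))"
  unfolding AP_def by (auto simp: almost_periodic_dist_iff)

lemma AP_uniformly_continuous:
  assumes "\<phi> \<in> AP Z" "e > 0"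
  obtains \<delta> where "\<delta> > 0" "\<And>s t. \<bar>s - t\<bar> < \<delta> \<Longrightarrow> dist (apply_bcontfun \<phi> s) (apply_bcontfun \<phi> t) < e"
proof -
  obtain \<delta> where \<delta>: "\<delta> > 0" "\<And>tau. \<bar>tau\<bar> < \<delta> \<Longrightarrow> tau \<in> translation_set dist (apply_bcontfun \<phi>) e"
    using almost_periodic_uniformly_continuous[OF pseudometric_along_dist AP_D(2)[OF assms(1)] assms(2)] by blast
  have "dist (apply_bcontfun \<phi> s) (apply_bcontfun \<phi> t) < e" if "\<bar>s - t\<bar> < \<delta>" for s t
  proof -
    have "dist (apply_bcontfun \<phi> (t + (s - t))) (apply_bcontfun \<phi> t) < e"
      using \<delta>(2)[OF that] unfolding translation_set_def by blast
    then show ?thesis by simp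
  qed
  with \<delta>(1) show ?thesis using that by blast
qed

lemma AP_compose:
  assumes h: "bounded_linear h" and \<phi>: "\<phi> \<in> AP UNIV" and Z: "\<And>x. h x \<in> Z"
  shows "Bcontfun (\<lambda>t. h (apply_bcontfun \<phi> t)) \<in> AP Z"
    "apply_bcontfun (Bcontfun (\<lambda>t. h (apply_bcontfun \<phi> t))) = (\<lambda>t. h (apply_bcontfun \<phi> t))"
proof -
  obtain K where K: "K > 0" "\<And>x. norm (h x) \<le> norm x * K"
    using bounded_linear.pos_bounded[OF h] by blast
  have rd: "relatively_dense (translation_set dist (\<lambda>t. h (apply_bcontfun \<phi> t)) e)" if "e > 0" for e
  proof (rule relatively_dense_mono[OF AP_D(3)[OF \<phi>, of "e / K"]])
    show "0 < e / K" using that K(1) by simp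
    have "dist (h x) (h y) < e" if "dist x y < e / K" for x y
      using K(2)[of "x - y"] that K(1)
      by (simp add: dist_norm bounded_linear.linear[OF h] linear_diff field_simps)
    then show "translation_set dist (apply_bcontfun \<phi>) (e / K) \<subseteq> translation_set dist (\<lambda>t. h (apply_bcontfun \<phi> t)) e"
      unfolding translation_set_def by blast
  qed
  have c: "continuous_on UNIV (\<lambda>t. h (apply_bcontfun \<phi> t))"
    by (intro bounded_linear.continuous_on[OF h] continuous_on_apply_bcontfun)
  show "Bcontfun (\<lambda>t. h (apply_bcontfun \<phi> t)) \<in> AP Z"
    "apply_bcontfun (Bcontfun (\<lambda>t. h (apply_bcontfun \<phi> t))) = (\<lambda>t. h (apply_bcontfun \<phi> t))"
    using AP_I[OF c Z rd] by auto
qed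

lemma subspace_AP:
  fixes Z :: "'a::real_normed_vector set"
  assumes "subspace Z"
  shows "subspace (AP Z)"
proof (rule subspaceI)
  have "relatively_dense UNIV" unfolding relatively_dense_def by (intro exI[of _ 1]) auto
  then show "0 \<in> AP Z"
    unfolding AP_iff using subspace_0[OF assms]
    by (auto simp: translation_set_def)
next
  fix \<phi> \<psi> assume \<phi>: "\<phi> \<in> AP Z" and \<psi>: "\<psi> \<in> AP Z"
  show "\<phi> + \<psi> \<in> AP Z" unfolding AP_iff
  proof (intro conjI allI impI)
    show "apply_bcontfun (\<phi> + \<psi>) t \<in> Z" for t
      using subspace_add[OF assms AP_D(1)[OF \<phi>] AP_D(1)[OF \<psi>]] by simp
    fix e :: real assume e: "e > 0"
    have "dist (a + b) (c + d) < e" if "dist a c < e/2" "dist b d < e/2" for a b c d :: 'a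
      using dist_triangle_add[of a b c d] that by linarith
    then show "relatively_dense (translation_set dist (apply_bcontfun (\<phi> + \<psi>)) e)"
      using e by (intro relatively_dense_mono[OF relatively_dense_common_translations[OF
          pseudometric_along_dist AP_D(2)[OF \<phi>] pseudometric_along_dist AP_D(2)[OF \<psi>], of "e/2" "e/2"]])
        (auto simp: translation_set_def)
  qed
next
  fix c \<phi> assume \<phi>: "\<phi> \<in> AP Z"
  have "dist (c *\<^sub>R x) (c *\<^sub>R y) < e" if "dist x y < e / (\<bar>c\<bar> + 1)" for x y :: 'a and e
  proof -
    have "dist (c *\<^sub>R x) (c *\<^sub>R y) \<le> (\<bar>c\<bar> + 1) * dist x y"
      by (simp add: dist_norm algebra_simps flip: scaleR_diff_right)
    also have "\<dots> < (\<bar>c\<bar> + 1) * (e / (\<bar>c\<bar> + 1))" using that by (intro mult_strict_left_mono) auto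
    finally show ?thesis by simp
  qed
  then have "relatively_dense (translation_set dist (apply_bcontfun (c *\<^sub>R \<phi>)) e)" if "e > 0" for e
    using that by (intro relatively_dense_mono[OF AP_D(3)[OF \<phi>, of "e / (\<bar>c\<bar> + 1)"]])
      (auto simp: translation_set_def)
  then show "c *\<^sub>R \<phi> \<in> AP Z"
    unfolding AP_iff using subspace_scale[OF assms AP_D(1)[OF \<phi>]] by simp
qed

lemma closed_AP:
  fixes Z :: "'a::metric_space set"
  assumes "closed Z"
  shows "closed (AP Z)"
  unfolding closed_sequential_limits
proof (intro allI impI, elim conjE)
  fix x :: "nat \<Rightarrow> real \<Rightarrow>\<^sub>C 'a" and \<phi> assume x: "\<forall>n. x n \<in> AP Z" and lim: "x \<longlonglongrightarrow> \<phi>"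
  show "\<phi> \<in> AP Z" unfolding AP_iff
  proof (intro conjI allI impI)
    fix t
    have "(\<lambda>n. apply_bcontfun (x n) t) \<longlonglongrightarrow> apply_bcontfun \<phi> t"
    proof (rule tendstoI)
      fix e :: real assume "e > 0"
      with lim have "\<forall>\<^sub>F n in sequentially. dist (x n) \<phi> < e" by (rule tendstoD)
      then show "\<forall>\<^sub>F n in sequentially. dist (apply_bcontfun (x n) t) (apply_bcontfun \<phi> t) < e"
        by eventually_elim (rule dist_fun_lt_imp_dist_val_lt)
    qed
    then show "apply_bcontfun \<phi> t \<in> Z"
      using closed_sequentially[OF assms, of "\<lambda>n. apply_bcontfun (x n) t"] AP_D(1)[OF x[rule_format]] by simp
  next
    fix e :: real assume e: "e > 0"
    obtain n where n: "dist (x n) \<phi> < e/3"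
      using tendstoD[OF lim, of "e/3"] e by (auto simp: eventually_sequentially)
    have near: "dist (apply_bcontfun (x n) t) (apply_bcontfun \<phi> t) < e/3" for t
      using n by (rule dist_fun_lt_imp_dist_val_lt)
    have "dist (apply_bcontfun \<phi> (t + tau)) (apply_bcontfun \<phi> t) < e"
      if "dist (apply_bcontfun (x n) (t + tau)) (apply_bcontfun (x n) t) < e/3" for t tau
      using near[of t] near[of "t + tau"] that
        dist_triangle[of "apply_bcontfun \<phi> (t + tau)" "apply_bcontfun \<phi> t" "apply_bcontfun (x n) (t + tau)"]
        dist_triangle[of "apply_bcontfun (x n) (t + tau)" "apply_bcontfun \<phi> t" "apply_bcontfun (x n) t"]
      by (simp add: dist_commute)
    then show "relatively_dense (translation_set dist (apply_bcontfun \<phi>) e)"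
      using e x by (intro relatively_dense_mono[OF AP_D(3)[of "x n" Z "e/3"]])
        (auto simp: translation_set_def)
  qed
qed

text \<open>A near-period shift brings every value close to one on a compact interval, so the range
  is totally bounded. This is what upgrades convergence at single vectors to convergence uniform in
  \<open>t\<close>.\<close>

lemma AP_finite_net:
  assumes \<phi>: "\<phi> \<in> AP Z" and e: "e > 0"
  obtains F where "finite F" "F \<subseteq> Z" "\<And>t. \<exists>x\<in>F. dist (apply_bcontfun \<phi> t) x < e"
proof -
  obtain l where l: "l > 0" "\<And>c. {c..c + l} \<inter> translation_set dist (apply_bcontfun \<phi>) (e/2) \<noteq> {}"
    using AP_D(3)[OF \<phi>, of "e/2"] e unfolding relatively_dense_def by auto
  have "compact (apply_bcontfun \<phi> ` {0..l})"
    by (intro compact_continuous_image continuous_on_apply_bcontfun compact_Icc)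
  then obtain F where F: "finite F" "F \<subseteq> apply_bcontfun \<phi> ` {0..l}"
    "apply_bcontfun \<phi> ` {0..l} \<subseteq> (\<Union>x\<in>F. ball x (e/2))"
  proof (rule compactE_image[of _ "apply_bcontfun \<phi> ` {0..l}" "\<lambda>x. ball x (e/2)"])
    show "apply_bcontfun \<phi> ` {0..l} \<subseteq> (\<Union>c\<in>apply_bcontfun \<phi> ` {0..l}. ball c (e/2))"
      using e by force
  qed (use that in auto)
  have "\<exists>x\<in>F. dist (apply_bcontfun \<phi> t) x < e" for t
  proof -
    obtain \<tau> where \<tau>: "\<tau> \<in> {-t..-t + l}" "\<tau> \<in> translation_set dist (apply_bcontfun \<phi>) (e/2)"
      using l(2)[of "-t"] by blast
    then have "apply_bcontfun \<phi> (t + \<tau>) \<in> apply_bcontfun \<phi> ` {0..l}" by auto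
    then obtain x where x: "x \<in> F" "dist x (apply_bcontfun \<phi> (t + \<tau>)) < e/2" using F(3) by fastforce
    have "dist (apply_bcontfun \<phi> (t + \<tau>)) (apply_bcontfun \<phi> t) < e/2"
      using \<tau>(2) unfolding translation_set_def by blast
    then have "dist (apply_bcontfun \<phi> t) x < e"
      using x(2) dist_triangle[of "apply_bcontfun \<phi> t" x "apply_bcontfun \<phi> (t + \<tau>)"]
      by (simp add: dist_commute)
    with x(1) show ?thesis by blast
  qed
  moreover have "F \<subseteq> Z" using F(2) AP_D(1)[OF \<phi>] by blast
  ultimately show ?thesis using that F(1) by blast
qed

text \<open>The Steklov mean: it turns a continuous function into a continuously differentiable one
  and commutes with translations, so that almost periodicity survives.\<close>

definition forward_average :: "real \<Rightarrow> (real \<Rightarrow> 'a::banach) \<Rightarrow> real \<Rightarrow> 'a" where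
  "forward_average \<delta> f t = integral {t..t + \<delta>} f /\<^sub>R \<delta>"

lemma forward_average_has_vector_derivative:
  fixes f :: "real \<Rightarrow> 'a::banach"
  assumes "\<delta> > 0" "continuous_on {a..b} f" "a < t" "t + \<delta> < b"
  shows "(forward_average \<delta> f has_vector_derivative (f (t + \<delta>) - f t) /\<^sub>R \<delta>) (at t)"
proof -
  define P where "P u = integral {a..u} f" for u
  have dP: "(P has_vector_derivative f u) (at u)" if "a < u" "u < b" for u
    using integral_has_vector_derivative[OF assms(2), of u] that
    by (simp add: P_def[abs_def] at_within_Icc_at)
  have "((\<lambda>u. u + \<delta>) has_vector_derivative 1) (at t)"
    by (auto intro!: derivative_eq_intros)
  then have "((\<lambda>u. P (u + \<delta>)) has_vector_derivative f (t + \<delta>)) (at t)"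
    using vector_diff_chain_at[of "\<lambda>u. u + \<delta>" 1 t P "f (t + \<delta>)"] dP[of "t + \<delta>"] assms
    by (simp add: o_def)
  then have "((\<lambda>u. (P (u + \<delta>) - P u) /\<^sub>R \<delta>) has_vector_derivative (f (t + \<delta>) - f t) /\<^sub>R \<delta>) (at t)"
    using dP[of t] assms by (auto intro!: derivative_eq_intros)
  moreover have "\<forall>\<^sub>F u in nhds t. (P (u + \<delta>) - P u) /\<^sub>R \<delta> = forward_average \<delta> f u"
  proof -
    have "\<forall>\<^sub>F u in nhds t. u \<in> {a<..<b - \<delta>}" using assms by (intro eventually_nhds_in_open) auto
    then show ?thesis
    proof eventually_elim
      case (elim u)
      have "P u + integral {u..u + \<delta>} f = P (u + \<delta>)"
        unfolding P_def using elim assms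
        by (intro Henstock_Kurzweil_Integration.integral_combine integrable_continuous_real
            continuous_on_subset[OF assms(2)]) auto
      then have "P (u + \<delta>) - P u = integral {u..u + \<delta>} f" by (simp only: diff_eq_eq add.commute[of _ "P u"])
      then show ?case by (simp only: forward_average_def)
    qed
  qed
  ultimately show ?thesis
    using has_vector_derivative_cong_ev[where S = UNIV and x = t and
        f = "\<lambda>u. (P (u + \<delta>) - P u) /\<^sub>R \<delta>" and g = "forward_average \<delta> f"]
    eventually_nhds_x_imp_x[of "\<lambda>u. (P (u + \<delta>) - P u) /\<^sub>R \<delta> = forward_average \<delta> f u" t]
    by (auto elim: eventually_mono)
qed

text \<open>Means stay in closed balls. With \<open>y = f t\<close> this measures the quality of the
  approximation, with \<open>y = 0\<close> it bounds the mean itself.\<close>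

lemma forward_average_near:
  fixes f :: "real \<Rightarrow> 'a::banach"
  assumes "\<delta> > 0" "continuous_on {t..t + \<delta>} f" "\<And>s. s \<in> {t..t + \<delta>} \<Longrightarrow> norm (f s - y) \<le> e"
  shows "norm (forward_average \<delta> f t - y) \<le> e"
proof -
  have 1: "integral {t..t + \<delta>} (\<lambda>s. f s - y) = integral {t..t + \<delta>} f - \<delta> *\<^sub>R y"
    using assms by (subst integral_diff) (auto intro: integrable_continuous_real)
  have "norm (integral {t..t + \<delta>} (\<lambda>s. f s - y)) \<le> e * (t + \<delta> - t)"
    using assms by (intro integral_bound) (auto intro!: continuous_intros)
  then have "norm (integral {t..t + \<delta>} f - \<delta> *\<^sub>R y) / \<delta> \<le> e"
    unfolding 1 using assms(1) by (simp add: pos_divide_le_eq)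
  moreover have "forward_average \<delta> f t - y = (integral {t..t + \<delta>} f - \<delta> *\<^sub>R y) /\<^sub>R \<delta>"
    using assms(1) by (simp add: forward_average_def scaleR_diff_right)
  ultimately show ?thesis using assms(1) by (simp add: divide_inverse mult.commute)
qed

lemma AP_forward_average:
  fixes \<phi> :: "real \<Rightarrow>\<^sub>C 'a::banach"
  assumes \<phi>: "\<phi> \<in> AP UNIV" and \<delta>: "\<delta> > 0"
  shows "Bcontfun (forward_average \<delta> (apply_bcontfun \<phi>)) \<in> AP UNIV"
    "apply_bcontfun (Bcontfun (forward_average \<delta> (apply_bcontfun \<phi>))) = forward_average \<delta> (apply_bcontfun \<phi>)"
proof -
  let ?f = "apply_bcontfun \<phi>"
  have c: "continuous_on UNIV (forward_average \<delta> ?f)"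
  proof (rule continuous_at_imp_continuous_on, rule ballI)
    fix t
    show "isCont (forward_average \<delta> ?f) t"
      using forward_average_has_vector_derivative[OF \<delta>, of "t - 1" "t + \<delta> + 1" ?f t]
      by (auto intro: has_vector_derivative_continuous)
  qed
  have rd: "relatively_dense (translation_set dist (forward_average \<delta> ?f) e)" if "e > 0" for e
  \<comment> \<open>Half of \<open>e\<close>, since the estimate of the mean is a weak inequality
    while near-periods ask for a strict one.\<close>
  proof (rule relatively_dense_mono[OF AP_D(3)[OF \<phi>, of "e/2"]])
    show "e/2 > 0" using that by simp
    show "translation_set dist ?f (e/2) \<subseteq> translation_set dist (forward_average \<delta> ?f) e"
    proof
      fix \<tau> assume \<tau>: "\<tau> \<in> translation_set dist ?f (e/2)"
      have "dist (forward_average \<delta> ?f (t + \<tau>)) (forward_average \<delta> ?f t) < e" for t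
      proof -
        have "integral {t + \<tau>..t + \<tau> + \<delta>} ?f = integral {t..t + \<delta>} (\<lambda>s. ?f (s + \<tau>))"
          using integral_shift_Icc_real[of t "t + \<delta>" ?f \<tau>] by (simp add: o_def algebra_simps)
        then have "forward_average \<delta> ?f (t + \<tau>) - forward_average \<delta> ?f t =
            forward_average \<delta> (\<lambda>s. ?f (s + \<tau>) - ?f s) t"
          by (simp add: forward_average_def scaleR_diff_right integral_diff
              integrable_continuous_real continuous_on_compose2[OF continuous_on_apply_bcontfun[of UNIV]]
              continuous_intros)
        moreover have "norm (forward_average \<delta> (\<lambda>s. ?f (s + \<tau>) - ?f s) t - 0) \<le> e/2"
          using \<tau> unfolding translation_set_def
          by (intro forward_average_near \<delta> continuous_intros
              continuous_on_compose2[OF continuous_on_apply_bcontfun[of UNIV]])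
            (auto simp: dist_norm less_imp_le)
        ultimately show ?thesis using that by (simp add: dist_norm)
      qed
      then show "\<tau> \<in> translation_set dist (forward_average \<delta> ?f) e"
        unfolding translation_set_def by blast
    qed
  qed
  show "Bcontfun (forward_average \<delta> ?f) \<in> AP UNIV"
    "apply_bcontfun (Bcontfun (forward_average \<delta> ?f)) = forward_average \<delta> ?f"
    using AP_I[OF c UNIV_I rd] by auto
qed

section \<open>Semigroups on a closed subspace\<close>

text \<open>The carrier is a set because the intended space \<open>AP X0\<close> is not a type;
  nothing is demanded of \<open>T\<close> off \<open>Z\<close> or for negative times.\<close>

locale c0_semigroup_on =
  fixes Z :: "'b::banach set" and T :: "real \<Rightarrow> 'b \<Rightarrow> 'b"
  assumes subspace_Z: "subspace Z" and closed_Z: "closed Z"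
    and T_Z: "\<And>r x. 0 \<le> r \<Longrightarrow> x \<in> Z \<Longrightarrow> T r x \<in> Z"
    and T_linear: "\<And>r. 0 \<le> r \<Longrightarrow> linear_on_subspace Z (T r)"
    and T_0: "\<And>x. x \<in> Z \<Longrightarrow> T 0 x = x"
    and T_add: "\<And>r s x. 0 \<le> r \<Longrightarrow> 0 \<le> s \<Longrightarrow> x \<in> Z \<Longrightarrow> T (r + s) x = T r (T s x)"
    and T_exp_bounded: "\<exists>M w. \<forall>r\<ge>0. \<forall>x\<in>Z. norm (T r x) \<le> M * exp (w * r) * norm x"
    and T_at_0: "\<And>x. x \<in> Z \<Longrightarrow> ((\<lambda>h. T h x) \<longlongrightarrow> x) (at_right 0)"
begin

definition growth :: "real \<Rightarrow> real \<Rightarrow> bool" where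
  "growth M w \<longleftrightarrow> 0 \<le> M \<and> (\<forall>r\<ge>0. \<forall>x\<in>Z. norm (T r x) \<le> M * exp (w * r) * norm x)"

definition laplace :: "real \<Rightarrow> 'b \<Rightarrow> 'b" where
  "laplace lam x = integral {0..} (\<lambda>r. exp (- lam * r) *\<^sub>R T r x)"

lemma growthD: "growth M w \<Longrightarrow> 0 \<le> r \<Longrightarrow> x \<in> Z \<Longrightarrow> norm (T r x) \<le> M * exp (w * r) * norm x"
  and growth_nonneg: "growth M w \<Longrightarrow> 0 \<le> M"
  by (auto simp: growth_def)

lemma T_bounded_linear: assumes r: "0 \<le> r" shows "bounded_linear_on Z (T r)"
proof -
  obtain M w where "\<forall>r\<ge>0. \<forall>x\<in>Z. norm (T r x) \<le> M * exp (w * r) * norm x"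
    using T_exp_bounded by blast
  then have "\<forall>x\<in>Z. norm (T r x) \<le> norm x * (M * exp (w * r))" using r by (simp add: mult.commute)
  with T_linear[OF r] show ?thesis unfolding bounded_linear_on_def by blast
qed

text \<open>\<open>T r - T s\<close> is \<open>T s\<close> applied to \<open>T (r - s) - I\<close>,
  with \<open>s\<close> the smaller time. As \<open>T\<close> is bounded locally uniformly,
  continuity from the right at 0 gives continuity from both sides everywhere.\<close>

lemma T_continuous:
  assumes x: "x \<in> Z"
  shows "continuous_on {0..} (\<lambda>r. T r x)"
proof -
  obtain M w where Mw: "\<And>r x. 0 \<le> r \<Longrightarrow> x \<in> Z \<Longrightarrow> norm (T r x) \<le> M * exp (w * r) * norm x"
    using T_exp_bounded by blast
  have step: "norm (T r x - T s x) \<le> \<bar>M\<bar> * exp (\<bar>w\<bar> * c) * norm (T (r - s) x - x)"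
    if "0 \<le> s" "s \<le> r" "s \<le> c" for r s c
  proof -
    have z: "T (r - s) x - x \<in> Z" using that by (intro subspace_diff[OF subspace_Z] T_Z x) auto
    have "T r x - T s x = T s (T (r - s) x - x)"
      using that T_add[of s "r - s" x] x
      by (simp add: linear_on_subspaceD(4)[OF T_linear] T_Z)
    also have "norm \<dots> \<le> M * exp (w * s) * norm (T (r - s) x - x)" using that by (intro Mw z)
    also have "\<dots> \<le> \<bar>M\<bar> * exp (\<bar>w\<bar> * c) * norm (T (r - s) x - x)"
    proof (intro mult_right_mono norm_ge_zero mult_mono)
      have "w * s \<le> \<bar>w\<bar> * s" using that by (intro mult_right_mono) auto
      also have "\<dots> \<le> \<bar>w\<bar> * c" using that by (intro mult_left_mono) auto
      finally show "exp (w * s) \<le> exp (\<bar>w\<bar> * c)" by simp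
    qed auto
    finally show ?thesis .
  qed
  show ?thesis
    unfolding continuous_on_iff
  proof (intro ballI allI impI)
    fix t e :: real assume t: "t \<in> {0..}" and e: "e > 0"
    define C where "C = \<bar>M\<bar> * exp (\<bar>w\<bar> * t) + 1"
    have C: "C > 0" unfolding C_def by (auto intro!: add_nonneg_pos)
    have "\<forall>\<^sub>F h in at_right 0. dist (T h x) x < e / C"
      using C e by (intro tendstoD[OF T_at_0[OF x]]) auto
    then obtain d where d: "d > 0" "\<And>h. 0 < h \<Longrightarrow> h < d \<Longrightarrow> dist (T h x) x < e / C"
      unfolding eventually_at_right[OF zero_less_one] by auto
    have "dist (T r x) (T t x) < e" if r: "r \<in> {0..}" "dist r t < d" for r
    proof (cases "r = t")
      case False
      define h where "h = \<bar>r - t\<bar>"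
      have h: "0 < h" "h < d" using False r by (auto simp: h_def dist_real_def)
      have "dist (T r x) (T t x) \<le> \<bar>M\<bar> * exp (\<bar>w\<bar> * t) * norm (T h x - x)"
        using step[of t r t] step[of r t t] r t
        by (cases "t \<le> r") (auto simp: h_def dist_norm norm_minus_commute)
      also have "\<dots> \<le> C * norm (T h x - x)" unfolding C_def by (intro mult_right_mono) auto
      also have "\<dots> < C * (e / C)"
        using d(2)[OF h] C by (intro mult_strict_left_mono) (auto simp: dist_norm)
      finally show ?thesis using C by simp
    qed (use e in auto)
    with d(1) show "\<exists>d>0. \<forall>x'\<in>{0..}. dist x' t < d \<longrightarrow> dist (T x' x) (T t x) < e" by blast
  qed
qed

context
  fixes M w lam assumes growth: "growth M w" and lam: "w < lam"
begin

lemma laplace_integrand: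
  assumes x: "x \<in> Z"
  shows "continuous_on {0..} (\<lambda>r. exp (- lam * r) *\<^sub>R T r x)"
    "0 \<le> r \<Longrightarrow> norm (exp (- lam * r) *\<^sub>R T r x) \<le> M * norm x * exp (- (lam - w) * r)"
    "0 \<le> r \<Longrightarrow> exp (- lam * r) *\<^sub>R T r x \<in> Z"
proof -
  show "continuous_on {0..} (\<lambda>r. exp (- lam * r) *\<^sub>R T r x)"
    by (intro continuous_intros T_continuous x)
  show "exp (- lam * r) *\<^sub>R T r x \<in> Z" if "0 \<le> r"
    by (intro subspace_scale[OF subspace_Z] T_Z x that)
  show "norm (exp (- lam * r) *\<^sub>R T r x) \<le> M * norm x * exp (- (lam - w) * r)" if "0 \<le> r"
  proof -
    have "norm (exp (- lam * r) *\<^sub>R T r x) \<le> exp (- lam * r) * (M * exp (w * r) * norm x)"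
      using growthD[OF growth that x] by simp
    also have "\<dots> = M * norm x * (exp (- lam * r) * exp (w * r))" by simp
    also have "exp (- lam * r) * exp (w * r) = exp (- (lam - w) * r)"
      by (simp add: algebra_simps flip: exp_add)
    finally show ?thesis .
  qed
qed

lemma laplace_has_integral: "x \<in> Z \<Longrightarrow> ((\<lambda>r. exp (- lam * r) *\<^sub>R T r x) has_integral laplace lam x) {0..}"
  and laplace_limit:
    "x \<in> Z \<Longrightarrow> ((\<lambda>N. integral {0..N} (\<lambda>r. exp (- lam * r) *\<^sub>R T r x)) \<longlongrightarrow> laplace lam x) at_top"
  and laplace_bound: "x \<in> Z \<Longrightarrow> norm (laplace lam x) \<le> M / (lam - w) * norm x"
  using exp_decay_integrals[OF laplace_integrand(1,2), of x] lam by (auto simp: laplace_def)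

lemma laplace_Z:
  assumes x: "x \<in> Z" shows "laplace lam x \<in> Z"
proof (rule Lim_in_closed_set[OF closed_Z _ _ laplace_limit[OF x]])
  show "\<forall>\<^sub>F N in at_top. integral {0..N} (\<lambda>r. exp (- lam * r) *\<^sub>R T r x) \<in> Z"
    using laplace_integrand(1,3)[OF x]
    by (intro always_eventually allI integral_in_closed_subspace subspace_Z closed_Z)
      (auto intro: continuous_on_subset)
qed simp

lemma laplace_linear: "linear_on_subspace Z (laplace lam)"
  unfolding linear_on_subspace_def
proof (intro conjI ballI allI subspace_Z)
  fix x y c assume x: "x \<in> Z" and y: "y \<in> Z"
  have "((\<lambda>r. exp (- lam * r) *\<^sub>R T r (x + y)) has_integral (laplace lam x + laplace lam y)) {0..}"
    using has_integral_add[OF laplace_has_integral[OF x] laplace_has_integral[OF y]]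
    by (rule has_integral_eq[rotated])
      (simp add: linear_on_subspaceD(2)[OF T_linear] x y scaleR_add_right)
  then show "laplace lam (x + y) = laplace lam x + laplace lam y"
    unfolding laplace_def by (rule integral_unique)
next
  fix x c assume x: "x \<in> Z"
  have "((\<lambda>r. exp (- lam * r) *\<^sub>R T r (c *\<^sub>R x)) has_integral (c *\<^sub>R laplace lam x)) {0..}"
    using has_integral_cmul[OF laplace_has_integral[OF x], of c]
    by (rule has_integral_eq[rotated]) (simp add: linear_on_subspaceD(3)[OF T_linear] x)
  then show "laplace lam (c *\<^sub>R x) = c *\<^sub>R laplace lam x"
    unfolding laplace_def by (rule integral_unique)
qed

lemma laplace_bounded_linear: "bounded_linear_on Z (laplace lam)"
  unfolding bounded_linear_on_def using laplace_linear laplace_bound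
  by (auto simp: mult.commute intro!: exI[of _ "M / (lam - w)"])

text \<open>\<open>T q\<close> is taken through the integrals over compact intervals first; its
  boundedness on \<open>Z\<close> then carries it through the limit.\<close>

lemma T_laplace_limit:
  assumes x: "x \<in> Z" and q: "0 \<le> q"
  shows "((\<lambda>N. integral {0..N} (\<lambda>r. exp (- lam * r) *\<^sub>R T (q + r) x)) \<longlongrightarrow> T q (laplace lam x)) at_top"
proof -
  have Z: "integral {0..N} (\<lambda>r. exp (- lam * r) *\<^sub>R T r x) \<in> Z" for N
    using laplace_integrand(1,3)[OF x]
    by (intro integral_in_closed_subspace subspace_Z closed_Z) (auto intro: continuous_on_subset)
  have eq: "integral {0..N} (\<lambda>r. exp (- lam * r) *\<^sub>R T (q + r) x) =
      T q (integral {0..N} (\<lambda>r. exp (- lam * r) *\<^sub>R T r x))" for N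
  proof -
    have "integral {0..N} (\<lambda>r. exp (- lam * r) *\<^sub>R T (q + r) x) =
        integral {0..N} (\<lambda>r. T q (exp (- lam * r) *\<^sub>R T r x))"
      using q x by (intro integral_cong) (simp add: T_add T_Z linear_on_subspaceD(3)[OF T_linear])
    also have "\<dots> = T q (integral {0..N} (\<lambda>r. exp (- lam * r) *\<^sub>R T r x))"
      using laplace_integrand(1,3)[OF x] q
      by (intro integral_bounded_linear_on[OF _ closed_Z] T_bounded_linear)
        (auto intro: continuous_on_subset)
    finally show ?thesis .
  qed
  show ?thesis
    unfolding eq
    by (rule bounded_linear_on_tendsto[OF T_bounded_linear[OF q] laplace_Z[OF x]
        always_eventually[OF allI[OF Z]] laplace_limit[OF x]])
qed

lemma laplace_T_commute:
  assumes x: "x \<in> Z" and q: "0 \<le> q"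
  shows "laplace lam (T q x) = T q (laplace lam x)"
proof -
  have "integral {0..N} (\<lambda>r. exp (- lam * r) *\<^sub>R T (q + r) x) =
      integral {0..N} (\<lambda>r. exp (- lam * r) *\<^sub>R T r (T q x))" for N
    using q x by (intro integral_cong) (simp add: T_add add.commute[of q])
  then show ?thesis
    using tendsto_unique[OF _ laplace_limit[OF T_Z[OF q x]]] T_laplace_limit[OF x q] by simp
qed

text \<open>Split the Laplace integral at \<open>q\<close> and use
  \<open>T (q + r) = T q (T r)\<close> on the rest. Both the generator and the comparison with
  truncated integrals are read off from this identity.\<close>

lemma laplace_shift:
  assumes x: "x \<in> Z" and q: "0 \<le> q"
  shows "laplace lam x = exp (- lam * q) *\<^sub>R T q (laplace lam x) + integral {0..q} (\<lambda>r. exp (- lam * r) *\<^sub>R T r x)"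
proof -
  let ?f = "\<lambda>r. exp (- lam * r) *\<^sub>R T r x"
  have split: "integral {0..N + q} ?f = exp (- lam * q) *\<^sub>R integral {0..N} (\<lambda>r. exp (- lam * r) *\<^sub>R T (q + r) x) +
      integral {0..q} ?f" if "0 \<le> N" for N
  proof -
    have "integral {0..q} ?f + integral {q..N + q} ?f = integral {0..N + q} ?f"
      using laplace_integrand(1)[OF x] that q
      by (intro Henstock_Kurzweil_Integration.integral_combine integrable_continuous_real)
        (auto intro: continuous_on_subset)
    moreover have "integral {q..N + q} ?f = integral {0..N} (\<lambda>r. ?f (q + r))"
      using integral_shift_Icc_real[of 0 N ?f q] by (simp add: o_def)
    moreover have "(\<lambda>r. ?f (q + r)) = (\<lambda>r. exp (- lam * q) *\<^sub>R (exp (- lam * r) *\<^sub>R T (q + r) x))"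
      by (auto simp: fun_eq_iff algebra_simps simp flip: exp_add)
    ultimately show ?thesis
      by (simp only: integral_cmul add.commute[of "integral {0..q} ?f"])
  qed
  have "((\<lambda>N. exp (- lam * q) *\<^sub>R integral {0..N} (\<lambda>r. exp (- lam * r) *\<^sub>R T (q + r) x) +
      integral {0..q} ?f) \<longlongrightarrow> exp (- lam * q) *\<^sub>R T q (laplace lam x) + integral {0..q} ?f) at_top"
    by (intro tendsto_intros T_laplace_limit x q)
  moreover have "((\<lambda>N. integral {0..N + q} ?f) \<longlongrightarrow> laplace lam x) at_top"
    using filterlim_compose[OF laplace_limit[OF x] filterlim_tendsto_add_at_top[OF tendsto_const[of q] filterlim_ident]]
    by (simp add: add.commute)
  then have "((\<lambda>N. exp (- lam * q) *\<^sub>R integral {0..N} (\<lambda>r. exp (- lam * r) *\<^sub>R T (q + r) x) +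
      integral {0..q} ?f) \<longlongrightarrow> laplace lam x) at_top"
    by (rule Lim_transform_eventually) (rule eventually_mono[OF eventually_ge_at_top[of 0] split])
  ultimately show ?thesis by (intro tendsto_unique[of at_top]) auto
qed

text \<open>The induction estimates \<open>T q\<close> of the iterate for all \<open>q\<close> at
  once. The constant \<open>M\<close> comes in at \<open>n = 0\<close> only; each further Laplace
  integral merely integrates an exponential, so \<open>M\<close> is not raised to a power.\<close>

lemma laplace_power_bound:
  assumes x: "x \<in> Z"
  shows "(laplace lam ^^ n) x \<in> Z \<and>
    (\<forall>q\<ge>0. norm (T q ((laplace lam ^^ n) x)) \<le> M * norm x / (lam - w) ^ n * exp (w * q))"
proof (induction n)
  case 0
  then show ?case using x growthD[OF growth _ x] by (simp add: ac_simps)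
next
  case (Suc n)
  let ?y = "(laplace lam ^^ n) x"
  have y: "?y \<in> Z" and b: "\<And>q. q \<ge> 0 \<Longrightarrow> norm (T q ?y) \<le> M * norm x / (lam - w) ^ n * exp (w * q)"
    using Suc by auto
  have "norm (T q (laplace lam ?y)) \<le> M * norm x / (lam - w) ^ Suc n * exp (w * q)" if q: "q \<ge> 0" for q
  proof -
    define C where "C = M * norm x / (lam - w) ^ n * exp (w * q)"
    have bd: "norm (exp (- lam * r) *\<^sub>R T r (T q ?y)) \<le> C * exp (- (lam - w) * r)" if "r \<ge> 0" for r
    proof -
      have "norm (exp (- lam * r) *\<^sub>R T r (T q ?y)) \<le> exp (- lam * r) * (M * norm x / (lam - w) ^ n * exp (w * (r + q)))"
        using mult_left_mono[OF b[of "r + q"], of "exp (- lam * r)"] that q y by (simp add: T_add)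
      also have "\<dots> = C * exp (- (lam - w) * r)"
        by (simp add: C_def algebra_simps exp_add exp_diff exp_minus divide_simps)
      finally show ?thesis .
    qed
    have "norm (laplace lam (T q ?y)) \<le> C / (lam - w)"
      unfolding laplace_def[of lam "T q ?y"] using lam
      by (intro exp_decay_integrals(3)[OF laplace_integrand(1) bd] T_Z q y) auto
    then show ?thesis by (simp add: laplace_T_commute[OF y q] C_def field_simps)
  qed
  then show ?case using laplace_Z[OF y] by simp
qed

text \<open>Multiply \<open>laplace_shift\<close> by \<open>exp (lam * h)\<close> and divide by
  \<open>h\<close>: one term tends to the derivative of the exponential at 0, the other is a mean of
  the integrand near 0, where it equals \<open>x\<close>.\<close>

lemma laplace_generator:
  assumes x: "x \<in> Z"
  shows "((\<lambda>h. (T h (laplace lam x) - laplace lam x) /\<^sub>R h) \<longlongrightarrow> lam *\<^sub>R laplace lam x - x) (at_right 0)"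
proof -
  let ?f = "\<lambda>r. exp (- lam * r) *\<^sub>R T r x" and ?y = "laplace lam x"
  have eq: "T h ?y - ?y = (exp (lam * h) - 1) *\<^sub>R ?y - exp (lam * h) *\<^sub>R integral {0..h} ?f" if "h \<ge> 0" for h
  proof -
    have "exp (lam * h) *\<^sub>R ?y = exp (lam * h) *\<^sub>R (exp (- lam * h) *\<^sub>R T h ?y + integral {0..h} ?f)"
      using laplace_shift[OF x that] by simp
    also have "\<dots> = T h ?y + exp (lam * h) *\<^sub>R integral {0..h} ?f"
      by (simp add: scaleR_add_right flip: exp_add)
    finally show ?thesis by (simp add: algebra_simps)
  qed
  have "((\<lambda>h. exp (lam * h)) has_real_derivative lam) (at 0)"
    by (auto intro!: derivative_eq_intros)
  then have 1: "((\<lambda>h. (exp (lam * h) - 1) / h) \<longlongrightarrow> lam) (at_right 0)"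
    by (auto simp: has_field_derivative_iff intro: tendsto_within_subset)
  have 2: "((\<lambda>h. integral {0..h} ?f /\<^sub>R h) \<longlongrightarrow> x) (at_right 0)"
  proof (rule tendstoI)
    fix e :: real assume e: "e > 0"
    have "?f 0 = x" using x by (simp add: T_0)
    then obtain d where d: "d > 0" "\<And>r. r \<ge> 0 \<Longrightarrow> r < d \<Longrightarrow> dist (?f r) x < e/2"
      using laplace_integrand(1)[OF x, unfolded continuous_on_iff, rule_format, of 0 "e/2"] e by auto
    have "\<forall>\<^sub>F h in at_right 0. h \<in> {0<..<d}"
      using d(1) by (rule eventually_at_right_real)
    then show "\<forall>\<^sub>F h in at_right 0. dist (integral {0..h} ?f /\<^sub>R h) x < e"
    proof eventually_elim
      case (elim h)
      have "norm (forward_average h ?f 0 - x) \<le> e/2"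
        using elim d(2) laplace_integrand(1)[OF x]
        by (intro forward_average_near) (auto simp: dist_norm less_imp_le intro: continuous_on_subset)
      then show ?case using e by (simp add: forward_average_def dist_norm)
    qed
  qed
  have 3: "((\<lambda>h. exp (lam * h)) \<longlongrightarrow> 1) (at_right 0)"
    by (rule tendsto_eq_intros | simp)+
  have "((\<lambda>h. ((exp (lam * h) - 1) / h) *\<^sub>R ?y - exp (lam * h) *\<^sub>R (integral {0..h} ?f /\<^sub>R h)) \<longlongrightarrow>
      lam *\<^sub>R ?y - 1 *\<^sub>R x) (at_right 0)"
    by (intro tendsto_intros 1 2 3)
  then have lim: "((\<lambda>h. ((exp (lam * h) - 1) / h) *\<^sub>R ?y - exp (lam * h) *\<^sub>R (integral {0..h} ?f /\<^sub>R h)) \<longlongrightarrow>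
      lam *\<^sub>R ?y - x) (at_right 0)" by simp
  have ev: "\<forall>\<^sub>F h in at_right 0. ((exp (lam * h) - 1) / h) *\<^sub>R ?y - exp (lam * h) *\<^sub>R (integral {0..h} ?f /\<^sub>R h) =
      (T h ?y - ?y) /\<^sub>R h"
    using eventually_at_right_less[of "0::real"]
    by eventually_elim (simp add: eq scaleR_diff_right divide_inverse mult.commute)
  show ?thesis by (rule Lim_transform_eventually[OF lim ev])
qed

text \<open>\<open>laplace lam\<close> commutes with the difference quotients of \<open>T\<close>,
  so \<open>laplace lam y\<close> is the limit of those at \<open>laplace lam x\<close>, already
  known from \<open>laplace_generator\<close>.\<close>

lemma laplace_of_generator:
  assumes x: "x \<in> Z" and y: "y \<in> Z" and lim: "((\<lambda>h. (T h x - x) /\<^sub>R h) \<longlongrightarrow> y) (at_right 0)"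
  shows "laplace lam (lam *\<^sub>R x - y) = x"
proof -
  note lin = laplace_linear
  have ev: "\<forall>\<^sub>F h in at_right 0. (T h x - x) /\<^sub>R h \<in> Z"
    using eventually_at_right_less[of "0::real"]
    by eventually_elim (intro subspace_scale[OF subspace_Z] subspace_diff[OF subspace_Z] T_Z x less_imp_le)
  have eq: "\<forall>\<^sub>F h in at_right 0. laplace lam ((T h x - x) /\<^sub>R h) = (T h (laplace lam x) - laplace lam x) /\<^sub>R h"
    using eventually_at_right_less[of "0::real"]
  proof eventually_elim
    case (elim h)
    then show ?case
      using x T_Z[of h x]
      by (simp add: linear_on_subspaceD(3,4)[OF lin] laplace_T_commute subspace_diff[OF subspace_Z])
  qed
  have "((\<lambda>h. (T h (laplace lam x) - laplace lam x) /\<^sub>R h) \<longlongrightarrow> laplace lam y) (at_right 0)"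
    by (rule Lim_transform_eventually[OF bounded_linear_on_tendsto[OF laplace_bounded_linear y ev lim] eq])
  from tendsto_unique[OF _ this laplace_generator[OF x]]
  have "laplace lam y = lam *\<^sub>R laplace lam x - x" by simp
  then show ?thesis
    using x y by (simp add: linear_on_subspaceD(3,4)[OF lin] subspace_scale[OF subspace_Z])
qed

lemma generator_dom_eq: "generator_dom Z T = laplace lam ` Z"
proof
  show "laplace lam ` Z \<subseteq> generator_dom Z T"
  proof (rule image_subsetI)
    fix x assume x: "x \<in> Z"
    have "lam *\<^sub>R laplace lam x - x \<in> Z"
      by (intro subspace_diff[OF subspace_Z] subspace_scale[OF subspace_Z] laplace_Z x)
    then show "laplace lam x \<in> generator_dom Z T"
      unfolding generator_dom_def using laplace_generator[OF x] laplace_Z[OF x] by blast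
  qed
  show "generator_dom Z T \<subseteq> laplace lam ` Z"
  proof
    fix x assume "x \<in> generator_dom Z T"
    then obtain y where *: "x \<in> Z" "y \<in> Z" "((\<lambda>h. (T h x - x) /\<^sub>R h) \<longlongrightarrow> y) (at_right 0)"
      by (auto simp: generator_dom_def)
    then show "x \<in> laplace lam ` Z"
      using laplace_of_generator[OF *]
      by (auto intro!: image_eqI[of _ _ "lam *\<^sub>R x - y"] subspace_diff[OF subspace_Z] subspace_scale[OF subspace_Z])
  qed
qed

lemma generator_laplace: "x \<in> Z \<Longrightarrow> generator T (laplace lam x) = lam *\<^sub>R laplace lam x - x"
  unfolding generator_def by (intro tendsto_Lim laplace_generator) auto

end

text \<open>Apply \<open>laplace_of_generator\<close> for \<open>lam\<close> to
  \<open>laplace mu x\<close>, whose difference quotients converge by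
  \<open>laplace_generator\<close> for \<open>mu\<close>.\<close>

lemma laplace_resolvent_identity:
  assumes "growth M w" "w < lam" "w < mu" and x: "x \<in> Z"
  shows "laplace lam x - laplace mu x = (mu - lam) *\<^sub>R laplace lam (laplace mu x)"
proof -
  let ?u = "laplace mu x"
  have u: "?u \<in> Z" using laplace_Z[OF assms(1,3) x] .
  have y: "mu *\<^sub>R ?u - x \<in> Z"
    by (intro subspace_diff[OF subspace_Z] subspace_scale[OF subspace_Z] u x)
  note lin = laplace_linear[OF assms(1,2)]
  have "laplace lam (lam *\<^sub>R ?u - (mu *\<^sub>R ?u - x)) = ?u"
    by (rule laplace_of_generator[OF assms(1,2) u y laplace_generator[OF assms(1,3) x]])
  then have "lam *\<^sub>R laplace lam ?u - (mu *\<^sub>R laplace lam ?u - laplace lam x) = ?u"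
    using u x y by (simp add: linear_on_subspaceD(3,4)[OF lin] subspace_scale[OF subspace_Z])
  then show ?thesis by (simp add: algebra_simps)
qed

end

context c0_semigroup_on
begin

text \<open>With \<open>d = laplace lam x\<close> and the truncated integral \<open>p\<close>,
  \<open>laplace_shift\<close> reads \<open>d = exp (- lam q) T q d + p\<close>. Iteration gives a
  Neumann series with ratio \<open>exp (- (lam - w) q) < 1\<close>, so an estimate over one short
  time interval controls the whole Laplace integral.\<close>

lemma laplace_le_truncated:
  assumes growth: "growth M w" and lam: "w < lam" and q: "0 < q" and x: "x \<in> Z"
  shows "norm (laplace lam x) \<le>
    M / (1 - exp (- (lam - w) * q)) * norm (integral {0..q} (\<lambda>r. exp (- lam * r) *\<^sub>R T r x))"
proof -
  let ?d = "laplace lam x"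
  define p where "p = integral {0..q} (\<lambda>r. exp (- lam * r) *\<^sub>R T r x)"
  define y where "y = exp (- (lam - w) * q)"
  have y: "0 < y" "y < 1" using mult_pos_pos[of "lam - w" q] lam q by (auto simp: y_def algebra_simps)
  have d: "?d \<in> Z" using laplace_Z[OF growth lam x] .
  have shift: "?d = exp (- lam * q) *\<^sub>R T q ?d + p"
    unfolding p_def using laplace_shift[OF growth lam x] q by simp
  have "p = ?d - exp (- lam * q) *\<^sub>R T q ?d" using shift by (simp add: algebra_simps)
  then have pZ: "p \<in> Z"
    using d q by (auto intro!: subspace_diff[OF subspace_Z] subspace_scale[OF subspace_Z] T_Z)
  have M: "0 \<le> M" using growth_nonneg[OF growth] .
  have damp: "exp (- lam * r) * norm (T r z) \<le> M * exp (- (lam - w) * r) * norm z" if "0 \<le> r" "z \<in> Z" for r z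
    using laplace_integrand(2)[OF growth lam that(2,1)] by (simp add: mult_ac)
  have pow: "exp (- (lam - w) * (real n * q)) = y ^ n" for n
    by (simp add: y_def exp_of_nat_mult[symmetric] mult_ac)
  \<comment> \<open>The remainder keeps \<open>T\<close> at the full time \<open>n q\<close>, so
    that each term costs the factor \<open>M\<close> once; iterating the norm bound of
    \<open>T q\<close> would produce powers of \<open>M\<close>.\<close>
  have step: "norm ?d \<le> exp (- lam * (real n * q)) * norm (T (real n * q) ?d) + M * norm p * (\<Sum>j<n. y ^ j)" for n
  proof (induction n)
    case 0
    show ?case using d by (simp add: T_0)
  next
    case (Suc n)
    let ?s = "real n * q"
    have s: "0 \<le> ?s" using q by simp
    have "T ?s ?d = T ?s (exp (- lam * q) *\<^sub>R T q ?d + p)" using shift by simp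
    also have "\<dots> = exp (- lam * q) *\<^sub>R T (?s + q) ?d + T ?s p"
      using d q s pZ
      by (simp add: linear_on_subspaceD(2,3)[OF T_linear] T_Z subspace_scale[OF subspace_Z] T_add)
    finally have "norm (T ?s ?d) \<le> exp (- lam * q) * norm (T (?s + q) ?d) + norm (T ?s p)"
      by (metis abs_exp_cancel norm_scaleR norm_triangle_ineq)
    then have "exp (- lam * ?s) * norm (T ?s ?d) \<le>
        exp (- lam * ?s) * (exp (- lam * q) * norm (T (?s + q) ?d) + norm (T ?s p))"
      by (intro mult_left_mono) auto
    also have "\<dots> = exp (- lam * (?s + q)) * norm (T (?s + q) ?d) + exp (- lam * ?s) * norm (T ?s p)"
      by (simp add: algebra_simps exp_add exp_diff exp_minus divide_simps)
    also have "exp (- lam * ?s) * norm (T ?s p) \<le> M * y ^ n * norm p"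
      using damp[OF s pZ] by (simp only: pow)
    finally have "exp (- lam * ?s) * norm (T ?s ?d) \<le>
        exp (- lam * (?s + q)) * norm (T (?s + q) ?d) + M * y ^ n * norm p" by simp
    moreover have "?s + q = real (Suc n) * q" by (simp add: algebra_simps)
    ultimately show ?case using Suc by (simp add: algebra_simps)
  qed
  have "norm ?d \<le> M * y ^ n * norm ?d + M * norm p / (1 - y)" for n
  proof -
    have "(\<Sum>j<n. y ^ j) \<le> 1 / (1 - y)"
      using y by (simp add: sum_gp_strict divide_right_mono)
    then have "M * norm p * (\<Sum>j<n. y ^ j) \<le> M * norm p * (1 / (1 - y))"
      using M by (intro mult_left_mono) auto
    moreover have "exp (- lam * (real n * q)) * norm (T (real n * q) ?d) \<le> M * y ^ n * norm ?d"
      using damp[of "real n * q" ?d] q d by (simp only: pow) simp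
    ultimately show ?thesis using step[of n] by simp
  qed
  moreover have "(\<lambda>n. M * y ^ n * norm ?d + M * norm p / (1 - y)) \<longlonglongrightarrow> M * 0 * norm ?d + M * norm p / (1 - y)"
    using y by (intro tendsto_intros LIMSEQ_power_zero) auto
  ultimately have "norm ?d \<le> M * 0 * norm ?d + M * norm p / (1 - y)"
    by (intro tendsto_lowerbound[of _ _ sequentially]) auto
  then show ?thesis by (simp add: p_def y_def)
qed

end

section \<open>Pseudo-resolvents\<close>

text \<open>The resolvent identity makes the range of \<open>L lam\<close>, and the operator
  \<open>lam\<close> minus the inverse of \<open>L lam\<close>, independent of \<open>lam\<close>.
  Injectivity makes that inverse single-valued, so a fixed \<open>lam0\<close> serves to define
  \<open>B\<close>.\<close>

lemma pseudo_resolvent_operator: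
  fixes L :: "real \<Rightarrow> 'b::real_normed_vector \<Rightarrow> 'b"
  assumes ne: "lam0 \<in> S"
    and bl: "\<And>lam. lam \<in> S \<Longrightarrow> bounded_linear_on Y (L lam)"
    and LY: "\<And>lam x. lam \<in> S \<Longrightarrow> x \<in> Y \<Longrightarrow> L lam x \<in> Y"
    and id: "\<And>lam mu x. lam \<in> S \<Longrightarrow> mu \<in> S \<Longrightarrow> x \<in> Y \<Longrightarrow>
      L lam x - L mu x = (mu - lam) *\<^sub>R L lam (L mu x)"
    and inj: "\<And>lam x. lam \<in> S \<Longrightarrow> x \<in> Y \<Longrightarrow> L lam x = 0 \<Longrightarrow> x = 0"
  obtains D B where "linear_operator Y D B" "S \<subseteq> resolvent_set Y D B"
    "\<And>lam x. lam \<in> S \<Longrightarrow> x \<in> Y \<Longrightarrow> resolvent D B lam x = L lam x"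
    "\<And>lam. lam \<in> S \<Longrightarrow> D = L lam ` Y"
    "\<And>lam x. lam \<in> S \<Longrightarrow> x \<in> Y \<Longrightarrow> B (L lam x) = lam *\<^sub>R L lam x - x"
proof -
  have lin: "linear_on_subspace Y (L lam)" if "lam \<in> S" for lam
    using bl[OF that] by (simp add: bounded_linear_on_def)
  have sub: "subspace Y" using linear_on_subspaceD(1)[OF lin[OF ne]] .
  note Lc = linear_on_subspaceD(2,3,4)[OF lin]
  have inj_on: "inj_on (L lam) Y" if "lam \<in> S" for lam
  proof (rule inj_onI)
    fix x y assume "x \<in> Y" "y \<in> Y" "L lam x = L lam y"
    then show "x = y" using inj[OF that subspace_diff[OF sub]] Lc(3)[OF that, of x y] by simp
  qed
  define D where "D = L lam0 ` Y"
  define B where "B u = lam0 *\<^sub>R u - inv_into Y (L lam0) u" for u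
  \<comment> \<open>The identity, solved for \<open>L lam x\<close> as a value of
    \<open>L mu\<close>. It yields both the inclusion of ranges and the preimage under
    \<open>L lam0\<close>.\<close>
  have rep: "L lam x = L mu (x + (mu - lam) *\<^sub>R L lam x)"
    if "lam \<in> S" "mu \<in> S" "x \<in> Y" for lam mu x
    using id[OF that(2,1,3)] that LY
    by (simp add: Lc subspace_scale[OF sub]) (simp add: algebra_simps)
  have in_Y: "x + c *\<^sub>R L lam x \<in> Y" if "lam \<in> S" "x \<in> Y" for lam x c
    using that LY by (intro subspace_add[OF sub] subspace_scale[OF sub]) auto
  have "L lam ` Y \<subseteq> L mu ` Y" if "lam \<in> S" "mu \<in> S" for lam mu
    using rep[OF that] in_Y[OF that(1)] by (intro image_subsetI) (metis image_eqI)
  then have D: "D = L lam ` Y" if "lam \<in> S" for lam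
    unfolding D_def using ne that by blast
  have BL: "B (L lam x) = lam *\<^sub>R L lam x - x" if "lam \<in> S" "x \<in> Y" for lam x
  proof -
    have "inv_into Y (L lam0) (L lam x) = x + (lam0 - lam) *\<^sub>R L lam x"
      using rep[OF that(1) ne that(2)] in_Y[OF that]
      by (metis inv_into_f_eq inj_on[OF ne])
    then show ?thesis unfolding B_def by (simp add: algebra_simps)
  qed
  have LD: "L lam x \<in> D" if "lam \<in> S" "x \<in> Y" for lam x using D that by blast
  have DB: "u \<in> D \<Longrightarrow> lam *\<^sub>R u - B u \<in> Y \<and> L lam (lam *\<^sub>R u - B u) = u" if "lam \<in> S" for lam u
    using D[OF that] BL[OF that] by auto
  have bij: "bij_betw (\<lambda>u. lam *\<^sub>R u - B u) D Y" if "lam \<in> S" for lam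
    by (rule bij_betw_byWitness[where f' = "L lam"])
      (use DB[OF that] LD[OF that] BL[OF that] in auto)
  have res: "resolvent D B lam x = L lam x" if "lam \<in> S" "x \<in> Y" for lam x
    unfolding resolvent_def
    by (rule inv_into_f_eq) (use bij[OF that(1)] LD[OF that] BL[OF that] in \<open>auto simp: bij_betw_def\<close>)
  have "bounded_linear_on Y (resolvent D B lam)" if "lam \<in> S" for lam
    using bl[OF that] sub res[OF that]
    by (simp add: bounded_linear_on_def linear_on_subspace_def subspace_add subspace_scale)
  then have "S \<subseteq> resolvent_set Y D B" unfolding resolvent_set_def using bij by blast
  moreover have "linear_operator Y D B"
    unfolding linear_operator_def linear_on_subspace_def
  proof (intro conjI ballI allI sub)
    show "D \<subseteq> Y" using LY[OF ne] by (auto simp: D_def)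
    show "B ` D \<subseteq> Y" using BL[OF ne] LY[OF ne]
      by (auto simp: D_def intro!: subspace_diff[OF sub] subspace_scale[OF sub])
    show "subspace D"
    proof (rule subspaceI)
      show "0 \<in> D" using LD[OF ne subspace_0[OF sub]] linear_on_subspaceD(5)[OF lin[OF ne]] by simp
      show "x + y \<in> D" if "x \<in> D" "y \<in> D" for x y
        using that unfolding D_def by (auto simp: Lc(1)[OF ne, symmetric] intro!: imageI subspace_add[OF sub])
      show "c *\<^sub>R x \<in> D" if "x \<in> D" for c x
        using that unfolding D_def by (auto simp: Lc(2)[OF ne, symmetric] intro!: imageI subspace_scale[OF sub])
    qed
    show "B (x + y) = B x + B y" if xy: "x \<in> D" "y \<in> D" for x y
    proof -
      obtain a b where ab: "a \<in> Y" "x = L lam0 a" "b \<in> Y" "y = L lam0 b" using xy D_def by blast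
      then have "B (x + y) = B (L lam0 (a + b))" by (simp add: Lc(1)[OF ne])
      also have "\<dots> = B x + B y"
        unfolding BL[OF ne subspace_add[OF sub ab(1,3)]] ab(2,4) BL[OF ne ab(1)] BL[OF ne ab(3)]
        by (simp add: Lc(1)[OF ne ab(1,3)] algebra_simps)
      finally show ?thesis .
    qed
    show "B (c *\<^sub>R x) = c *\<^sub>R B x" if x: "x \<in> D" for c x
    proof -
      obtain a where a: "a \<in> Y" "x = L lam0 a" using x D_def by blast
      then have "B (c *\<^sub>R x) = B (L lam0 (c *\<^sub>R a))" by (simp add: Lc(2)[OF ne])
      also have "\<dots> = c *\<^sub>R B x"
        unfolding BL[OF ne subspace_scale[OF sub a(1)]] a(2) BL[OF ne a(1)]
        by (simp add: Lc(2)[OF ne a(1)] scaleR_diff_right)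
      finally show ?thesis .
    qed
  qed
  ultimately show ?thesis using that D BL res by blast
qed

section \<open>Resolvents of Hille-Yosida operators\<close>

locale hille_yosida_operator =
  fixes D :: "'a::banach set" and A :: "'a \<Rightarrow> 'a" and M w :: real
  assumes HY: "hille_yosida UNIV D A M w"
begin

abbreviation R :: "real \<Rightarrow> 'a \<Rightarrow> 'a" where "R \<equiv> resolvent D A"

lemma M_ge_1: "1 \<le> M" and A_linear: "linear_on_subspace D A"
  and bij: "w < lam \<Longrightarrow> bij_betw (\<lambda>x. lam *\<^sub>R x - A x) D UNIV"
  and R_bounded_on: "w < lam \<Longrightarrow> bounded_linear_on UNIV (R lam)"
  using HY by (auto simp: hille_yosida_def linear_operator_def resolvent_set_def)

lemma subspace_D: "subspace D"
  using linear_on_subspaceD(1)[OF A_linear] .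

lemma R_bounded_linear: assumes "w < lam" shows "bounded_linear (R lam)"
proof -
  obtain K where "K > 0" "\<And>x. norm (R lam x) \<le> K * norm x"
    using bounded_linear_on_pos_bound[OF R_bounded_on[OF assms]] by auto
  then show ?thesis
    using R_bounded_on[OF assms] unfolding bounded_linear_on_def linear_on_subspace_def
    by (intro bounded_linear_intro[of _ K]) (auto simp: mult.commute)
qed

lemma R_add: "w < lam \<Longrightarrow> R lam (x + y) = R lam x + R lam y"
  and R_diff: "w < lam \<Longrightarrow> R lam (x - y) = R lam x - R lam y"
  and R_scaleR: "w < lam \<Longrightarrow> R lam (c *\<^sub>R x) = c *\<^sub>R R lam x"
  using R_bounded_linear[of lam]
  by (simp_all add: bounded_linear.linear linear_add linear_diff linear_scale)

lemma R_D: assumes "w < lam" shows "R lam x \<in> D" "lam *\<^sub>R R lam x - A (R lam x) = x"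
proof -
  have x: "x \<in> (\<lambda>x. lam *\<^sub>R x - A x) ` D" using bij[OF assms] by (simp add: bij_betw_def)
  show "R lam x \<in> D" unfolding resolvent_def by (rule inv_into_into[OF x])
  show "lam *\<^sub>R R lam x - A (R lam x) = x" unfolding resolvent_def using f_inv_into_f[OF x] .
qed

lemma R_left_inverse: "w < lam \<Longrightarrow> u \<in> D \<Longrightarrow> R lam (lam *\<^sub>R u - A u) = u"
  unfolding resolvent_def using bij[of lam] inv_into_f_f[of "\<lambda>x. lam *\<^sub>R x - A x" D u]
  by (simp add: bij_betw_def)

lemma R_inj: "w < lam \<Longrightarrow> R lam x = 0 \<Longrightarrow> x = 0"
  using R_D(2)[of lam x] linear_on_subspaceD(5)[OF A_linear] by simp

lemma R_identity:
  assumes "w < lam" "w < mu"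
  shows "R lam x - R mu x = (mu - lam) *\<^sub>R R lam (R mu x)"
proof -
  have "R mu x = R lam (lam *\<^sub>R R mu x - A (R mu x))"
    by (rule R_left_inverse[symmetric]) (use assms R_D in auto)
  also have "lam *\<^sub>R R mu x - A (R mu x) = x + (lam - mu) *\<^sub>R R mu x"
    using R_D(2)[OF assms(2), of x] by (simp add: algebra_simps)
  also have "R lam \<dots> = R lam x + (lam - mu) *\<^sub>R R lam (R mu x)"
    using assms(1) by (simp add: R_add R_scaleR)
  finally show ?thesis by (simp add: algebra_simps)
qed

text \<open>Exchange the roles of \<open>lam\<close> and \<open>mu\<close> in the resolvent
  identity; the factor \<open>mu - lam\<close> can be cancelled only for distinct arguments.\<close>

lemma R_commute: assumes "w < lam" "w < mu" shows "R lam (R mu x) = R mu (R lam x)"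
proof (cases "lam = mu")
  case False
  have "(mu - lam) *\<^sub>R R lam (R mu x) = (mu - lam) *\<^sub>R R mu (R lam x)"
  proof -
    have "(mu - lam) *\<^sub>R R mu (R lam x) = - ((lam - mu) *\<^sub>R R mu (R lam x))"
      by (simp add: scaleR_left_diff_distrib)
    then show ?thesis
      unfolding R_identity[OF assms, of x, symmetric] R_identity[OF assms(2,1), of x, symmetric] by simp
  qed
  with False show ?thesis by simp
qed simp

lemma R_power_bounded: assumes "w < lam" shows "bounded_linear (R lam ^^ n)"
proof (induction n)
  case 0
  then show ?case by (simp add: id_def bounded_linear_ident)
next
  case (Suc n)
  then show ?case
    using bounded_linear_compose[OF R_bounded_linear[OF assms] Suc] by (simp add: o_def)
qed

lemma R_power_bound:
  assumes "w < lam"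
  shows "norm ((R lam ^^ n) x) \<le> M / (lam - w) ^ n * norm x"
\<comment> \<open>\<open>hille_yosida\<close> speaks of \<open>n \<ge> 1\<close> only; for
  \<open>n = 0\<close> the bound holds because \<open>M \<ge> 1\<close>.\<close>
proof (cases "n = 0")
  case True
  then show ?thesis using M_ge_1 mult_right_mono[of 1 M "norm x"] by simp
next
  case False
  have "linear_on_subspace UNIV (R lam ^^ n)"
    using bounded_linear.linear[OF R_power_bounded[OF assms]]
    by (simp add: linear_on_subspace_def linear_add linear_scale)
  then have "bounded_linear_on UNIV (R lam ^^ n)"
    using bounded_linear.bounded[OF R_power_bounded[OF assms, of n]] by (simp add: bounded_linear_on_def)
  then have "norm ((R lam ^^ n) x) \<le> onorm_on UNIV (R lam ^^ n) * norm x"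
    by (rule onorm_on_bound) simp
  also have "\<dots> \<le> M / (lam - w) ^ n * norm x"
    using HY assms False unfolding hille_yosida_def by (intro mult_right_mono) auto
  finally show ?thesis .
qed

lemma R_bound: "w < lam \<Longrightarrow> norm (R lam x) \<le> M / (lam - w) * norm x"
  using R_power_bound[of lam 1 x] by simp

text \<open>The difference equals \<open>R mu\<close> applied to \<open>kap R kap x - x\<close>,
  which is \<open>A (R kap x)\<close>. One factor \<open>R kap\<close> thus buys the rate
  \<open>1 / (mu - w)\<close> for every \<open>x\<close>, also where the Yosida approximations do
  not converge.\<close>

lemma R_approx:
  assumes "w < kap" "w < mu"
  shows "norm (mu *\<^sub>R R mu (R kap x) - R kap x) \<le> M / (mu - w) * ((\<bar>kap\<bar> * (M / (kap - w)) + 1) * norm x)"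
proof -
  have "mu *\<^sub>R R mu (R kap x) - R kap x = R mu (kap *\<^sub>R R kap x - x)"
    using R_identity[OF assms(2,1), of x] assms by (simp add: R_diff R_scaleR algebra_simps)
  also have "norm \<dots> \<le> M / (mu - w) * norm (kap *\<^sub>R R kap x - x)" by (rule R_bound) fact
  also have "\<dots> \<le> M / (mu - w) * ((\<bar>kap\<bar> * (M / (kap - w)) + 1) * norm x)"
  proof (rule mult_left_mono)
    have "norm (kap *\<^sub>R R kap x - x) \<le> \<bar>kap\<bar> * norm (R kap x) + norm x"
      by (metis norm_scaleR norm_triangle_ineq4)
    also have "\<dots> \<le> \<bar>kap\<bar> * (M / (kap - w) * norm x) + norm x"
      by (intro add_right_mono mult_left_mono R_bound assms) auto
    finally show "norm (kap *\<^sub>R R kap x - x) \<le> (\<bar>kap\<bar> * (M / (kap - w)) + 1) * norm x"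
      by (simp add: algebra_simps)
  qed (use M_ge_1 assms in simp)
  finally show ?thesis .
qed

lemma D_eq_range: "w < kap \<Longrightarrow> D = range (R kap)"
  using R_left_inverse R_D by (metis equalityI image_subset_iff rangeI subsetI)

lemma yosida_tendsto_on_D:
  assumes "x \<in> D"
  shows "((\<lambda>mu. mu *\<^sub>R R mu x) \<longlongrightarrow> x) at_top"
proof -
  define kap where "kap = w + 1"
  have kap: "w < kap" by (simp add: kap_def)
  obtain y where y: "x = R kap y" using assms D_eq_range[OF kap] by blast
  define C where "C = M * ((\<bar>kap\<bar> * (M / (kap - w)) + 1) * norm y)"
  have "((\<lambda>mu. C / (mu - w)) \<longlongrightarrow> 0) at_top"
    using filterlim_tendsto_add_at_top[OF tendsto_const[of "-w"] filterlim_ident]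
    by (intro real_tendsto_divide_at_top[OF tendsto_const]) simp
  moreover have "\<forall>\<^sub>F mu in at_top. norm (mu *\<^sub>R R mu x - x) \<le> C / (mu - w)"
    using eventually_gt_at_top[of w] by eventually_elim (use R_approx[OF kap] in \<open>simp add: y C_def\<close>)
  ultimately have "((\<lambda>mu. mu *\<^sub>R R mu x - x) \<longlongrightarrow> 0) at_top"
    by (rule Lim_null_comparison[rotated])
  then show ?thesis by (simp add: LIM_zero_iff)
qed

lemma yosida_bound:
  assumes "2 * \<bar>w\<bar> + 1 \<le> mu"
  shows "norm (mu *\<^sub>R R mu x) \<le> 2 * M * norm x"
proof -
  \<comment> \<open>The threshold \<open>2 * \<bar>w\<bar> + 1\<close> is made for
    \<open>mu \<le> 2 * (mu - w)\<close>, hence a factor 2 that is uniform in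
    \<open>mu\<close>.\<close>
  have mu: "w < mu" "0 \<le> mu" "mu \<le> 2 * (mu - w)" using assms by auto
  have "norm (mu *\<^sub>R R mu x) \<le> mu * (M / (mu - w) * norm x)"
    using mult_left_mono[OF R_bound[OF mu(1), of x] mu(2)] mu(2) by simp
  also have "\<dots> = mu / (mu - w) * (M * norm x)" by simp
  also have "\<dots> \<le> 2 * (M * norm x)"
    using mu M_ge_1 by (intro mult_right_mono) (auto simp: field_simps)
  finally show ?thesis by simp
qed

subsection \<open>An a priori estimate for mild solutions\<close>

text \<open>\<open>(1/h) R (1/h)\<close> is \<open>(I - h A)\<^sup>-\<^sup>1\<close>, one step of the implicit Euler scheme.\<close>

lemma euler_power_bound:
  assumes "0 < h" "h * max w 0 < 1"
  shows "norm (((\<lambda>x. R (1/h) x /\<^sub>R h) ^^ n) x) \<le> M * (1 / (1 - h * max w 0)) ^ n * norm x"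
proof -
  have "h * w \<le> h * max w 0" using assms(1) by (intro mult_left_mono) auto
  then have hw: "h * w < 1" using assms(2) by linarith
  then have lam: "w < 1/h" using assms(1) by (simp add: field_simps)
  have "((\<lambda>x. R (1/h) x /\<^sub>R h) ^^ n) x = (R (1/h) ^^ n) x /\<^sub>R h ^ n" for x
    by (induction n) (auto simp: R_scaleR[OF lam])
  then have "norm (((\<lambda>x. R (1/h) x /\<^sub>R h) ^^ n) x) = norm ((R (1/h) ^^ n) x) / h ^ n"
    using assms(1) by (simp add: divide_inverse mult.commute)
  also have "\<dots> \<le> M / (1/h - w) ^ n * norm x / h ^ n"
    using assms(1) by (intro divide_right_mono R_power_bound lam) auto
  also have "\<dots> = M * (1 / (h * (1/h - w))) ^ n * norm x"
    by (simp add: power_mult_distrib power_divide)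
  also have "h * (1/h - w) = 1 - h * w" using assms(1) by (simp add: algebra_simps)
  also have "M * (1 / (1 - h * w)) ^ n * norm x \<le> M * (1 / (1 - h * max w 0)) ^ n * norm x"
  proof (intro mult_right_mono mult_left_mono power_mono divide_left_mono)
    show "0 < (1 - h * w) * (1 - h * max w 0)" using hw assms(2) by (intro mult_pos_pos) auto
  qed (use hw M_ge_1 \<open>h * w \<le> h * max w 0\<close> in auto)
  finally show ?thesis .
qed

text \<open>Let \<open>Q\<close> be one Euler step. Unrolled, \<open>z n\<close> is a power of
  \<open>Q\<close> at \<open>z 0\<close> plus \<open>h\<close> times a sum of powers of
  \<open>Q\<close> at the \<open>c k\<close>. The extra exponent \<open>j\<close> carries this form
  through the induction, so the power bound is used once per term and \<open>M\<close> does not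
  accumulate.\<close>

lemma euler_scheme_bound:
  assumes h: "0 < h" "h * max w 0 < 1" and F: "\<And>n. n < N \<Longrightarrow> norm (c n) \<le> F"
    and z: "\<And>n. n < N \<Longrightarrow> z (Suc n) = R (1/h) (z n + h *\<^sub>R c n) /\<^sub>R h"
  shows "n \<le> N \<Longrightarrow> norm (((\<lambda>x. R (1/h) x /\<^sub>R h) ^^ j) (z n)) \<le>
    M * (1 / (1 - h * max w 0)) ^ (j + n) * (norm (z 0) + real n * h * F)"
proof (induction n arbitrary: j)
  case 0
  then show ?case using euler_power_bound[OF h] by simp
next
  case (Suc n)
  define Q where "Q = (\<lambda>x. R (1/h) x /\<^sub>R h)"
  define \<rho> where "\<rho> = 1 / (1 - h * max w 0)"
  \<comment> \<open>Thanks to \<open>max w 0\<close> the growth factor of a step is at least 1, so a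
    larger exponent may be used for every term.\<close>
  have \<rho>: "1 \<le> \<rho>" using h by (simp add: \<rho>_def)
  have "h * w \<le> h * max w 0" using h(1) by (intro mult_left_mono) auto
  then have "h * w < 1" using h(2) by linarith
  then have lam: "w < 1/h" using h(1) by (simp add: field_simps)
  have "bounded_linear Q" unfolding Q_def
    by (intro bounded_linear_scaleR_right[THEN bounded_linear_compose] R_bounded_linear lam)
  have lin: "linear (Q ^^ k)" for k
  proof (induction k)
    case 0
    show ?case by (simp add: id_def linear_id[unfolded id_def])
  next
    case (Suc k)
    show ?case
      using linear_compose[OF Suc bounded_linear.linear[OF \<open>bounded_linear Q\<close>]] by (simp add: o_def)
  qed
  have "(Q ^^ j) (z (Suc n)) = (Q ^^ Suc j) (z n + h *\<^sub>R c n)"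
    using z[of n] Suc.prems by (simp add: funpow_swap1 Q_def[THEN fun_cong])
  also have "\<dots> = (Q ^^ Suc j) (z n) + h *\<^sub>R (Q ^^ Suc j) (c n)"
    by (simp only: linear_add[OF lin] linear_scale[OF lin])
  also have "norm \<dots> \<le> norm ((Q ^^ Suc j) (z n)) + h * norm ((Q ^^ Suc j) (c n))"
    using norm_triangle_ineq[of "(Q ^^ Suc j) (z n)" "h *\<^sub>R (Q ^^ Suc j) (c n)"] h(1) by simp
  also have "\<dots> \<le> M * \<rho> ^ (Suc j + n) * (norm (z 0) + real n * h * F) + h * (M * \<rho> ^ Suc j * F)"
  proof (intro add_mono mult_left_mono)
    show "norm ((Q ^^ Suc j) (z n)) \<le> M * \<rho> ^ (Suc j + n) * (norm (z 0) + real n * h * F)"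
      using Suc.IH[of "Suc j"] Suc.prems unfolding Q_def \<rho>_def by simp
    have "norm ((Q ^^ Suc j) (c n)) \<le> M * \<rho> ^ Suc j * norm (c n)"
      unfolding Q_def \<rho>_def by (rule euler_power_bound[OF h])
    also have "\<dots> \<le> M * \<rho> ^ Suc j * F" using F Suc.prems M_ge_1 \<rho> by (intro mult_left_mono) auto
    finally show "norm ((Q ^^ Suc j) (c n)) \<le> M * \<rho> ^ Suc j * F" .
  qed (use h in auto)
  also have "\<dots> \<le> M * \<rho> ^ (Suc j + n) * (norm (z 0) + real n * h * F) + h * (M * \<rho> ^ (Suc j + n) * F)"
  proof -
    have "0 \<le> F" using order_trans[OF norm_ge_zero F[of n]] Suc.prems by simp
    then show ?thesis
      using M_ge_1 \<rho> h by (intro add_left_mono mult_left_mono mult_right_mono power_increasing) auto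
  qed
  also have "\<dots> = M * \<rho> ^ (j + Suc n) * (norm (z 0) + real (Suc n) * h * F)"
    by (simp add: algebra_simps)
  finally show ?case unfolding Q_def \<rho>_def .
qed

text \<open>The equation says that \<open>z\<close> is a continuously differentiable solution of
  \<open>z' = A z + f\<close>. Its values on a grid solve the implicit Euler scheme up to the
  consistency error of difference quotients, which vanishes uniformly as the grid is
  refined.\<close>

lemma strict_solution_bound:
  assumes ab: "a \<le> b" and kap: "w < kap"
    and eq: "\<And>t. t \<in> {a..b} \<Longrightarrow> z t = R kap (kap *\<^sub>R z t - z' t + f t)"
    and dz: "\<And>t. t \<in> {a..b} \<Longrightarrow> (z has_vector_derivative z' t) (at t within {a..b})"
    and z': "continuous_on {a..b} z'" and F: "\<And>t. t \<in> {a..b} \<Longrightarrow> norm (f t) \<le> F"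
  shows "norm (z b) \<le> M * exp (max w 0 * (b - a)) * (norm (z a) + (b - a) * F)"
proof (cases "a = b")
  case True
  then show ?thesis using M_ge_1 mult_right_mono[of 1 M "norm (z a)"] by simp
next
  case False
  with ab have ab': "a < b" by simp
  define p where "p = max w 0"
  have F0: "0 \<le> F" using order_trans[OF norm_ge_zero F[of a]] ab by simp
  \<comment> \<open>The equation does not depend on the choice of \<open>kap\<close>; the Euler
    scheme with step \<open>h\<close> needs it for \<open>1/h\<close>.\<close>
  have eq': "z t = R lam (lam *\<^sub>R z t - z' t + f t)" if "t \<in> {a..b}" "w < lam" for t lam
  proof -
    define q where "q = kap *\<^sub>R z t - z' t + f t"
    have zq: "z t = R kap q" using eq[OF that(1)] by (simp add: q_def)
    have "lam *\<^sub>R z t - z' t + f t = (lam - kap) *\<^sub>R R kap q + q"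
      by (simp add: q_def[symmetric] zq[symmetric] algebra_simps) (simp add: q_def algebra_simps)
    then have "R lam (lam *\<^sub>R z t - z' t + f t) = (lam - kap) *\<^sub>R R lam (R kap q) + R lam q"
      using that by (simp add: R_add R_scaleR)
    also have "\<dots> = R kap q" using R_identity[OF that(2) kap, of q] by (simp add: algebra_simps)
    finally show ?thesis using zq by simp
  qed
  have bound: "norm (z b) \<le> M * exp (p * (b - a)) * (norm (z a) + (b - a) * (F + e))" if e: "e > 0" for e
  proof -
    obtain d where d: "d > 0" "\<And>s t. s \<in> {a..b} \<Longrightarrow> t \<in> {a..b} \<Longrightarrow> dist s t < d \<Longrightarrow> dist (z' s) (z' t) < e"
      using compact_uniformly_continuous[OF z' compact_Icc] e unfolding uniformly_continuous_on_def by metis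
    have step: "norm (z b) \<le> M * (1 / (1 - (b - a) / real N * p)) ^ N * (norm (z a) + (b - a) * (F + e))"
      if N: "N > 0" "(b - a) / real N < d" "(b - a) / real N * p < 1" for N
    proof -
      define h where "h = (b - a) / real N"
      have h: "0 < h" "h * max w 0 < 1" "h < d" "real N * h = b - a"
        using N ab' by (auto simp: h_def p_def)
      define t where "t n = a + real n * h" for n
      \<comment> \<open>The forcing plus the consistency error of the backward difference quotient,
        so that the grid values obey the scheme exactly.\<close>
      define c where "c n = (z (t (Suc n)) - z (t n)) /\<^sub>R h - z' (t (Suc n)) + f (t (Suc n))" for n
      have t: "t n \<in> {a..b}" if "n \<le> N" for n
      proof -
        have "real n * h \<le> real N * h" using that h(1) by (intro mult_right_mono) auto
        then show ?thesis using h by (auto simp: t_def)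
      qed
      have tS: "t (Suc n) = t n + h" for n by (simp add: t_def algebra_simps)
      have "h * w \<le> h * max w 0" using h(1) by (intro mult_left_mono) auto
      then have "h * w < 1" using h(2) by linarith
      then have lam: "w < 1/h" using h(1) by (simp add: field_simps)
      have zn: "z (t (Suc n)) = R (1/h) (z (t n) + h *\<^sub>R c n) /\<^sub>R h" if "n < N" for n
      proof -
        have "z (t n) + h *\<^sub>R c n = h *\<^sub>R ((1/h) *\<^sub>R z (t (Suc n)) - z' (t (Suc n)) + f (t (Suc n)))"
          using h(1) by (simp add: c_def algebra_simps)
        then have "R (1/h) (z (t n) + h *\<^sub>R c n) = h *\<^sub>R z (t (Suc n))"
          using eq'[OF t[of "Suc n"] lam] that by (simp add: R_scaleR[OF lam])
        then show ?thesis using h(1) by simp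
      qed
      have cn: "norm (c n) \<le> F + e" if "n < N" for n
      proof -
        have sub: "{t n..t (Suc n)} \<subseteq> {a..b}" using t[of n] t[of "Suc n"] that by auto
        have "norm (z (t (Suc n)) - z (t n) - (t (Suc n) - t n) *\<^sub>R z' (t (Suc n))) \<le> norm (t (Suc n) - t n) * e"
        proof (rule vector_differentiable_bound_linearization[of "{t n..t (Suc n)}"])
          show "(z has_vector_derivative z' s) (at s within {t n..t (Suc n)})" if "s \<in> {t n..t (Suc n)}" for s
            using dz[of s] sub that by (blast intro: has_vector_derivative_within_subset)
          show "closed_segment (t n) (t (Suc n)) \<subseteq> {t n..t (Suc n)}"
            using h(1) by (simp add: closed_segment_eq_real_ivl tS)
          show "norm (z' s - z' (t (Suc n))) \<le> e" if "s \<in> {t n..t (Suc n)}" for s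
            using d(2)[of s "t (Suc n)"] sub that h t[of "Suc n"] \<open>n < N\<close>
            by (auto simp: dist_norm tS subset_eq intro!: less_imp_le)
          show "t (Suc n) \<in> {t n..t (Suc n)}" using h(1) by (simp add: tS)
        qed
        then have "norm (z (t (Suc n)) - z (t n) - h *\<^sub>R z' (t (Suc n))) / h \<le> e"
          using h(1) by (simp add: tS pos_divide_le_eq mult.commute)
        moreover have "(z (t (Suc n)) - z (t n)) /\<^sub>R h - z' (t (Suc n)) =
            (z (t (Suc n)) - z (t n) - h *\<^sub>R z' (t (Suc n))) /\<^sub>R h"
          using h(1) by (simp add: scaleR_diff_right)
        ultimately have "norm ((z (t (Suc n)) - z (t n)) /\<^sub>R h - z' (t (Suc n))) \<le> e"
          using h(1) by (simp add: divide_inverse mult.commute)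
        moreover have "norm (f (t (Suc n))) \<le> F" using F t[of "Suc n"] that by auto
        ultimately show ?thesis unfolding c_def by (intro norm_triangle_le) simp
      qed
      have "norm (z (t N)) \<le> M * (1 / (1 - h * max w 0)) ^ N * (norm (z (t 0)) + real N * h * (F + e))"
        using euler_scheme_bound[where z = "\<lambda>n. z (t n)" and n = N and j = 0 and c = c and F = "F + e"
            and N = N and h = h] h(1,2) cn zn by simp
      moreover have "t N = b" "t 0 = a" using h(4) by (auto simp: t_def)
      ultimately show ?thesis using h(4) by (simp add: h_def p_def)
    qed
    have "(\<lambda>N. (b - a) / real N) \<longlonglongrightarrow> 0" by (rule lim_const_over_n)
    then have ev1: "\<forall>\<^sub>F N in sequentially. (b - a) / real N < d"
      using d(1) by (auto simp: order_tendsto_iff)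
    have "(\<lambda>N. (b - a) / real N * p) \<longlonglongrightarrow> 0 * p" by (intro tendsto_intros lim_const_over_n)
    then have ev2: "\<forall>\<^sub>F N in sequentially. (b - a) / real N * p < 1" by (auto simp: order_tendsto_iff)
    \<comment> \<open>The accumulated growth factors are the inverses of these powers, hence
      converge to \<open>exp (p * (b - a))\<close>.\<close>
    have "(\<lambda>N. (1 + (- p * (b - a)) / real N) ^ N) \<longlonglongrightarrow> exp (- p * (b - a))"
      by (rule tendsto_exp_limit_sequentially)
    then have "(\<lambda>N. M * (inverse ((1 + (- p * (b - a)) / real N) ^ N)) * (norm (z a) + (b - a) * (F + e))) \<longlonglongrightarrow>
        M * inverse (exp (- p * (b - a))) * (norm (z a) + (b - a) * (F + e))"
      by (intro tendsto_intros) auto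
    moreover have "\<forall>\<^sub>F N in sequentially. norm (z b) \<le>
        M * (inverse ((1 + (- p * (b - a)) / real N) ^ N)) * (norm (z a) + (b - a) * (F + e))"
      using ev1 ev2 eventually_gt_at_top[of 0]
    proof eventually_elim
      case (elim N)
      have "(1 / (1 - (b - a) / real N * p)) ^ N = inverse ((1 + (- p * (b - a)) / real N) ^ N)"
        by (simp add: power_one_over inverse_eq_divide mult.commute)
      then show ?case using step[OF elim(3,1,2)] by simp
    qed
    ultimately have "norm (z b) \<le> M * inverse (exp (- p * (b - a))) * (norm (z a) + (b - a) * (F + e))"
      by (rule tendsto_lowerbound) simp
    then show ?thesis by (simp add: exp_minus)
  qed
  have "((\<lambda>e. M * exp (p * (b - a)) * (norm (z a) + (b - a) * (F + e))) \<longlongrightarrow>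
      M * exp (p * (b - a)) * (norm (z a) + (b - a) * (F + 0))) (at_right 0)"
    by (intro tendsto_intros)
  moreover have "\<forall>\<^sub>F e in at_right 0. norm (z b) \<le> M * exp (p * (b - a)) * (norm (z a) + (b - a) * (F + e))"
    using eventually_at_right_less[of "0::real"] by eventually_elim (rule bound)
  ultimately have "norm (z b) \<le> M * exp (p * (b - a)) * (norm (z a) + (b - a) * (F + 0))"
    by (rule tendsto_lowerbound) simp
  then show ?thesis by (simp add: p_def)
qed

text \<open>The equation is the integrated form of \<open>y' = A y + f\<close>, with \<open>A\<close> replaced by its resolvent.\<close>

definition mild_on :: "real \<Rightarrow> real \<Rightarrow> real \<Rightarrow> (real \<Rightarrow> 'a) \<Rightarrow> (real \<Rightarrow> 'a) \<Rightarrow> bool" where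
  "mild_on kap a b y f \<longleftrightarrow> continuous_on {a..b} y \<and> continuous_on {a..b} f \<and>
     (\<forall>t\<in>{a..b}. integral {a..t} y = R kap (kap *\<^sub>R integral {a..t} y + y a - y t + integral {a..t} f))"

text \<open>The integrated equation at \<open>t + \<delta>\<close> minus the one at
  \<open>t\<close>, divided by \<open>\<delta>\<close>, shows that the forward average of
  \<open>y\<close> is a strict solution whose forcing is the average of \<open>f\<close>. Its
  estimate on \<open>{a..b - \<delta>}\<close> becomes the claim as \<open>\<delta>\<close> tends to
  0.\<close>

lemma mild_bound:
  assumes ab: "a \<le> b" and kap: "w < kap" and y: "mild_on kap a b y f"
    and F: "\<And>t. t \<in> {a..b} \<Longrightarrow> norm (f t) \<le> F"
  shows "norm (y b) \<le> M * exp (max w 0 * (b - a)) * (norm (y a) + (b - a) * F)"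
proof (cases "a = b")
  case True
  then show ?thesis using M_ge_1 mult_right_mono[of 1 M "norm (y a)"] by simp
next
  case False
  with ab have ab': "a < b" by simp
  have cy: "continuous_on {a..b} y" and cf: "continuous_on {a..b} f"
    and eq: "\<And>t. t \<in> {a..b} \<Longrightarrow> integral {a..t} y = R kap (kap *\<^sub>R integral {a..t} y + y a - y t + integral {a..t} f)"
    using y by (auto simp: mild_on_def)
  have F0: "0 \<le> F" using order_trans[OF norm_ge_zero F[of a]] ab by simp
  have split: "integral {a..t + \<delta>} g - integral {a..t} g = integral {t..t + \<delta>} g"
    if "continuous_on {a..b} g" "a \<le> t" "t + \<delta> \<le> b" "0 < \<delta>" for g :: "real \<Rightarrow> 'a" and t \<delta>
    using Henstock_Kurzweil_Integration.integral_combine[of a t "t + \<delta>" g]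
      integrable_continuous_real[OF continuous_on_subset[OF that(1), of "{a..t + \<delta>}"]] that
    by (auto simp: algebra_simps)
  have avg: "norm (forward_average \<delta> y (b - \<delta>)) \<le>
      M * exp (max w 0 * (b - a)) * (norm (forward_average \<delta> y a) + (b - a) * F)"
    if \<delta>: "0 < \<delta>" "\<delta> < b - a" for \<delta>
  proof -
    let ?z = "forward_average \<delta> y" and ?f = "forward_average \<delta> f"
    have "norm (?z (b - \<delta>)) \<le> M * exp (max w 0 * (b - \<delta> - a)) * (norm (?z a) + (b - \<delta> - a) * F)"
    proof (rule strict_solution_bound[where z' = "\<lambda>t. (y (t + \<delta>) - y t) /\<^sub>R \<delta>" and f = ?f])
      show "a \<le> b - \<delta>" using \<delta> by simp
      show "w < kap" by fact
      fix t assume t: "t \<in> {a..b - \<delta>}"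
      have 1: "integral {t..t + \<delta>} y = R kap (kap *\<^sub>R integral {t..t + \<delta>} y + y t - y (t + \<delta>) + integral {t..t + \<delta>} f)"
      proof -
        have "integral {t..t + \<delta>} y = integral {a..t + \<delta>} y - integral {a..t} y"
          using split[OF cy] t \<delta> by simp
        also have "\<dots> = R kap ((kap *\<^sub>R integral {a..t + \<delta>} y + y a - y (t + \<delta>) + integral {a..t + \<delta>} f) -
            (kap *\<^sub>R integral {a..t} y + y a - y t + integral {a..t} f))"
        proof -
          have tt: "t + \<delta> \<in> {a..b}" "t \<in> {a..b}" using t \<delta> by auto
          show ?thesis unfolding R_diff[OF kap] eq[OF tt(1), symmetric] eq[OF tt(2), symmetric] ..
        qed
        also have "(kap *\<^sub>R integral {a..t + \<delta>} y + y a - y (t + \<delta>) + integral {a..t + \<delta>} f) -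
            (kap *\<^sub>R integral {a..t} y + y a - y t + integral {a..t} f) =
            kap *\<^sub>R (integral {a..t + \<delta>} y - integral {a..t} y) + y t - y (t + \<delta>) +
            (integral {a..t + \<delta>} f - integral {a..t} f)"
          by (simp add: algebra_simps)
        finally show ?thesis using split[OF cy, of t \<delta>] split[OF cf, of t \<delta>] t \<delta> by simp
      qed
      have "?z t = R kap ((kap *\<^sub>R integral {t..t + \<delta>} y + y t - y (t + \<delta>) + integral {t..t + \<delta>} f) /\<^sub>R \<delta>)"
        unfolding forward_average_def R_scaleR[OF kap] using 1 by simp
      also have "(kap *\<^sub>R integral {t..t + \<delta>} y + y t - y (t + \<delta>) + integral {t..t + \<delta>} f) /\<^sub>R \<delta> =
          kap *\<^sub>R ?z t - (y (t + \<delta>) - y t) /\<^sub>R \<delta> + ?f t"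
        by (simp add: forward_average_def algebra_simps)
      finally show "?z t = R kap (kap *\<^sub>R ?z t - (y (t + \<delta>) - y t) /\<^sub>R \<delta> + ?f t)" .
      have "norm (?f t - 0) \<le> F"
        using t \<delta> F by (intro forward_average_near continuous_on_subset[OF cf]) auto
      then show "norm (?f t) \<le> F" by simp
      define P where "P u = integral {a..u} y" for u
      have dP: "(P has_vector_derivative y u) (at u within {a..b})" if "u \<in> {a..b}" for u
        unfolding P_def by (rule integral_has_vector_derivative[OF cy that])
      have "((P \<circ> (\<lambda>u. u + \<delta>)) has_vector_derivative 1 *\<^sub>R y (t + \<delta>)) (at t within {a..b - \<delta>})"
      proof (rule vector_diff_chain_within)
        show "((\<lambda>u. u + \<delta>) has_vector_derivative 1) (at t within {a..b - \<delta>})"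
          by (auto intro!: derivative_eq_intros)
        show "(P has_vector_derivative y (t + \<delta>)) (at (t + \<delta>) within (\<lambda>u. u + \<delta>) ` {a..b - \<delta>})"
          using dP[of "t + \<delta>"] t \<delta> by (auto intro: has_vector_derivative_within_subset)
      qed
      then have "((\<lambda>u. P (u + \<delta>)) has_vector_derivative y (t + \<delta>)) (at t within {a..b - \<delta>})"
        by (simp add: o_def)
      moreover have "(P has_vector_derivative y t) (at t within {a..b - \<delta>})"
        using dP[of t] t \<delta> by (auto intro: has_vector_derivative_within_subset)
      ultimately have "((\<lambda>u. (P (u + \<delta>) - P u) /\<^sub>R \<delta>) has_vector_derivative (y (t + \<delta>) - y t) /\<^sub>R \<delta>)
          (at t within {a..b - \<delta>})"
        by (auto intro!: derivative_eq_intros)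
      then show "(?z has_vector_derivative (y (t + \<delta>) - y t) /\<^sub>R \<delta>) (at t within {a..b - \<delta>})"
      proof (rule has_vector_derivative_transform[rotated 2])
        show "?z u = (P (u + \<delta>) - P u) /\<^sub>R \<delta>" if "u \<in> {a..b - \<delta>}" for u
          using split[OF cy, of u \<delta>] that \<delta> by (simp add: forward_average_def P_def)
      qed (rule t)
    next
      show "continuous_on {a..b - \<delta>} (\<lambda>t. (y (t + \<delta>) - y t) /\<^sub>R \<delta>)"
        using \<delta> by (intro continuous_intros continuous_on_compose2[OF cy] continuous_on_subset[OF cy]) auto
    qed
    also have "\<dots> \<le> M * exp (max w 0 * (b - a)) * (norm (?z a) + (b - a) * F)"
      using M_ge_1 \<delta> F0
      by (intro mult_mono add_mono mult_left_mono) (auto intro!: mult_left_mono mult_right_mono add_nonneg_nonneg)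
    finally show ?thesis .
  qed
  have near: "norm (y b) \<le> M * exp (max w 0 * (b - a)) * (norm (y a) + e + (b - a) * F) + e" if e: "e > 0" for e
  proof -
    obtain d where d: "d > 0" "\<And>s t. s \<in> {a..b} \<Longrightarrow> t \<in> {a..b} \<Longrightarrow> dist s t < d \<Longrightarrow> dist (y s) (y t) < e"
      using compact_uniformly_continuous[OF cy compact_Icc] e unfolding uniformly_continuous_on_def by metis
    \<comment> \<open>Below \<open>b - a\<close>, so that the shortened interval is nonempty, and
      below \<open>d\<close>, so that both averages are within \<open>e\<close> of the endpoint
      values.\<close>
    define \<delta> where "\<delta> = min (d / 2) ((b - a) / 2)"
    have \<delta>: "0 < \<delta>" "\<delta> < b - a" "\<delta> < d" using d(1) ab' by (auto simp: \<delta>_def min_def)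
    have 1: "norm (forward_average \<delta> y (b - \<delta>) - y b) \<le> e"
      using \<delta> d(2)[of _ b]
      by (intro forward_average_near continuous_on_subset[OF cy]) (auto simp: dist_norm intro!: less_imp_le)
    have 2: "norm (forward_average \<delta> y a - y a) \<le> e"
      using \<delta> d(2)[of _ a]
      by (intro forward_average_near continuous_on_subset[OF cy]) (auto simp: dist_norm intro!: less_imp_le)
    have "norm (y b) \<le> norm (forward_average \<delta> y (b - \<delta>)) + e"
      using 1 norm_triangle_sub[of "y b" "forward_average \<delta> y (b - \<delta>)"] by (simp add: norm_minus_commute)
    moreover have "M * exp (max w 0 * (b - a)) * (norm (forward_average \<delta> y a) + (b - a) * F) \<le>
        M * exp (max w 0 * (b - a)) * (norm (y a) + e + (b - a) * F)"
      using 2 norm_triangle_sub[of "forward_average \<delta> y a" "y a"] M_ge_1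
      by (intro mult_left_mono add_right_mono) auto
    ultimately show ?thesis using avg[OF \<delta>(1,2)] by linarith
  qed
  have "((\<lambda>e. M * exp (max w 0 * (b - a)) * (norm (y a) + e + (b - a) * F) + e) \<longlongrightarrow>
      M * exp (max w 0 * (b - a)) * (norm (y a) + 0 + (b - a) * F) + 0) (at_right 0)"
    by (intro tendsto_intros)
  moreover have "\<forall>\<^sub>F e in at_right 0. norm (y b) \<le> M * exp (max w 0 * (b - a)) * (norm (y a) + e + (b - a) * F) + e"
    using eventually_at_right_less[of "0::real"] by eventually_elim (rule near)
  ultimately have "norm (y b) \<le> M * exp (max w 0 * (b - a)) * (norm (y a) + 0 + (b - a) * F) + 0"
    by (rule tendsto_lowerbound) simp
  then show ?thesis by simp
qed

end

section \<open>The evolution family\<close>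

locale evolution_problem = hille_yosida_operator D A M w
  for D :: "'a::banach set" and A :: "'a \<Rightarrow> 'a" and M w :: real +
  fixes V :: "real \<Rightarrow> 'a \<Rightarrow> 'a" and \<Gamma> :: "real \<Rightarrow> real \<Rightarrow> 'a \<Rightarrow> 'a"
  assumes V_bounded: "\<And>t. bounded_linear_on (closure D) (V t)"
    and V_ap: "almost_periodic (opdist (closure D)) V"
    and Gamma: "solution_family D A V \<Gamma>"
    and Gamma_ap: "\<And>eps nu. eps > 0 \<Longrightarrow> nu > 0 \<Longrightarrow>
         \<exists>eta>0. \<exists>delta<0. \<forall>t s. \<forall>tau\<in>translation_set (opdist (closure D)) V eta.
           t \<ge> s \<longrightarrow> t - s \<ge> nu \<longrightarrow>
           onorm_on (closure D) (\<lambda>x. \<Gamma> (t + tau) (s + tau) x - \<Gamma> t s x) \<le> eps * exp (delta * (t - s))"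
begin

abbreviation X0 :: "'a set" where "X0 \<equiv> closure D"

lemma subspace_X0: "subspace X0"
proof (rule subspaceI)
  show "0 \<in> X0" using subspace_0[OF subspace_D] closure_subset by blast
next
  fix x y assume "x \<in> X0" "y \<in> X0"
  then obtain u v where uv: "\<forall>n. u n \<in> D" "u \<longlonglongrightarrow> x" "\<forall>n. v n \<in> D" "v \<longlonglongrightarrow> y"
    unfolding closure_sequential by blast
  have "(\<lambda>n. u n + v n) \<longlonglongrightarrow> x + y" using uv by (intro tendsto_add)
  moreover have "\<forall>n. u n + v n \<in> D" using uv subspace_add[OF subspace_D] by blast
  ultimately show "x + y \<in> X0" unfolding closure_sequential by (intro exI conjI)
next
  fix c x assume "x \<in> X0"
  then obtain u where u: "\<forall>n. u n \<in> D" "u \<longlonglongrightarrow> x" unfolding closure_sequential by blast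
  have "(\<lambda>n. c *\<^sub>R u n) \<longlonglongrightarrow> c *\<^sub>R x" using u by (intro tendsto_intros)
  moreover have "\<forall>n. c *\<^sub>R u n \<in> D" using u subspace_scale[OF subspace_D] by blast
  ultimately show "c *\<^sub>R x \<in> X0" unfolding closure_sequential by (intro exI conjI)
qed

lemmas X0_closed = subspace_diff[OF subspace_X0] subspace_add[OF subspace_X0] subspace_scale[OF subspace_X0]

lemma R_X0: "w < lam \<Longrightarrow> R lam x \<in> X0"
  using R_D(1) closure_subset by blast

lemma V_pseudometric: "pseudometric_along (opdist X0) V"
  by (rule pseudometric_along_opdist[OF V_bounded])

text \<open>By the reverse triangle inequality the operator norms of \<open>V t\<close> form a real
  almost periodic function, and such functions are bounded.\<close>

lemma V_uniformly_bounded: obtains v where "0 < v" "\<And>t x. x \<in> X0 \<Longrightarrow> norm (V t x) \<le> v * norm x"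
proof -
  define N where "N t = onorm_on X0 (V t)" for t
  have N: "\<bar>N s - N t\<bar> \<le> opdist X0 (V s) (V t)" for s t
  proof -
    have "N s \<le> N t + opdist X0 (V s) (V t)" for s t
      unfolding N_def
    proof (rule onorm_on_le)
      show "X0 \<noteq> {}" using subspace_0[OF subspace_X0] by (metis empty_iff)
      show "0 \<le> onorm_on X0 (V t) + opdist X0 (V s) (V t)"
        unfolding opdist_def by (intro add_nonneg_nonneg onorm_on_nonneg bounded_linear_on_diff V_bounded)
      fix x assume x: "x \<in> X0"
      show "norm (V s x) \<le> (onorm_on X0 (V t) + opdist X0 (V s) (V t)) * norm x"
        using onorm_on_bound[OF V_bounded x, of t] opdist_bound[OF V_bounded V_bounded x, of s t]
          norm_triangle_sub[of "V s x" "V t x"] by (simp add: algebra_simps)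
    qed
    from this[of s t] this[of t s] show ?thesis
      using V_pseudometric by (auto simp: pseudometric_along_def abs_le_iff)
  qed
  have "almost_periodic dist N"
    unfolding almost_periodic_def
  proof (intro conjI allI impI)
    fix t
    have "((\<lambda>s. opdist X0 (V s) (V t)) \<longlongrightarrow> 0) (at t)" using V_ap by (simp add: almost_periodic_def)
    then show "((\<lambda>s. dist (N s) (N t)) \<longlongrightarrow> 0) (at t)"
      by (rule tendsto_sandwich[rotated 2, OF tendsto_const]) (auto simp: dist_real_def N)
  next
    fix e :: real assume "e > 0"
    then have "relatively_dense (translation_set (opdist X0) V e)" using V_ap by (simp add: almost_periodic_def)
    then show "relatively_dense (translation_set dist N e)"
      by (rule relatively_dense_mono)
        (auto simp: translation_set_def dist_real_def intro: le_less_trans[OF N])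
  qed
  then have "bounded (range N)"
    using almost_periodic_imp_bcontfun by (auto simp: bcontfun_def)
  then obtain v where v: "\<And>t. norm (N t) \<le> v" by (auto simp: bounded_iff)
  have "norm (V t x) \<le> (\<bar>v\<bar> + 1) * norm x" if "x \<in> X0" for t x
  proof -
    have "norm (V t x) \<le> N t * norm x" unfolding N_def by (rule onorm_on_bound[OF V_bounded that])
    also have "\<dots> \<le> (\<bar>v\<bar> + 1) * norm x" using v[of t] by (intro mult_right_mono) auto
    finally show ?thesis .
  qed
  then show ?thesis using that[of "\<bar>v\<bar> + 1"] by auto
qed

text \<open>Split the increment into a change of the vector, handled by the uniform bound, and a
  change of time, handled by continuity in \<open>opdist\<close>.\<close>

lemma V_continuous:
  assumes x: "continuous_on S x" "\<And>p. p \<in> S \<Longrightarrow> x p \<in> X0" and t: "continuous_on S t"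
  shows "continuous_on S (\<lambda>p. V (t p) (x p))"
  unfolding continuous_on_def
proof
  fix q assume q: "q \<in> S"
  obtain v where v: "0 < v" "\<And>t x. x \<in> X0 \<Longrightarrow> norm (V t x) \<le> v * norm x"
    using V_uniformly_bounded by blast
  have "((\<lambda>p. opdist X0 (V (t p)) (V (t q))) \<longlongrightarrow> 0) (at q within S)"
  proof (rule tendstoI)
    fix e :: real assume "e > 0"
    then obtain \<delta> where \<delta>: "\<delta> > 0" "\<And>tau. \<bar>tau\<bar> < \<delta> \<Longrightarrow> tau \<in> translation_set (opdist X0) V e"
      using almost_periodic_uniformly_continuous[OF V_pseudometric V_ap] by blast
    have "\<forall>\<^sub>F p in at q within S. dist (t p) (t q) < \<delta>"
      using t q \<delta>(1) unfolding continuous_on_def by (intro tendstoD) auto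
    then show "\<forall>\<^sub>F p in at q within S. dist (opdist X0 (V (t p)) (V (t q))) 0 < e"
    proof eventually_elim
      case (elim p)
      have "t p - t q \<in> translation_set (opdist X0) V e"
        using \<delta>(2) elim by (simp add: dist_real_def)
      then have "opdist X0 (V (t q + (t p - t q))) (V (t q)) < e" unfolding translation_set_def by blast
      moreover have "0 \<le> opdist X0 (V (t p)) (V (t q))"
        unfolding opdist_def by (intro onorm_on_nonneg bounded_linear_on_diff V_bounded)
      ultimately show ?case by simp
    qed
  qed
  moreover have "((\<lambda>p. norm (x p - x q)) \<longlongrightarrow> 0) (at q within S)"
    using x(1) q by (intro tendsto_norm_zero LIM_zero) (simp add: continuous_on_def)
  ultimately have "((\<lambda>p. v * norm (x p - x q) + opdist X0 (V (t p)) (V (t q)) * norm (x q)) \<longlongrightarrow>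
      v * 0 + 0 * norm (x q)) (at q within S)"
    by (intro tendsto_intros)
  then have lim: "((\<lambda>p. v * norm (x p - x q) + opdist X0 (V (t p)) (V (t q)) * norm (x q)) \<longlongrightarrow> 0) (at q within S)"
    by simp
  have "\<forall>\<^sub>F p in at q within S. p \<in> S" by (simp add: eventually_at_filter)
  then have "\<forall>\<^sub>F p in at q within S. norm (V (t p) (x p) - V (t q) (x q)) \<le>
      v * norm (x p - x q) + opdist X0 (V (t p)) (V (t q)) * norm (x q)"
  proof eventually_elim
    case (elim p)
    have lin: "linear_on_subspace X0 (V s)" for s using V_bounded by (simp add: bounded_linear_on_def)
    have "V (t p) (x p) - V (t q) (x q) = V (t p) (x p - x q) + (V (t p) (x q) - V (t q) (x q))"
      using x(2) elim q by (simp add: linear_on_subspaceD(4)[OF lin])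
    also have "norm \<dots> \<le> norm (V (t p) (x p - x q)) + norm (V (t p) (x q) - V (t q) (x q))"
      by (rule norm_triangle_ineq)
    also have "\<dots> \<le> v * norm (x p - x q) + opdist X0 (V (t p)) (V (t q)) * norm (x q)"
      using x(2) elim q by (intro add_mono v opdist_bound V_bounded X0_closed) auto
    finally show ?case .
  qed
  then have "((\<lambda>p. V (t p) (x p) - V (t q) (x q)) \<longlongrightarrow> 0) (at q within S)"
    by (rule Lim_null_comparison[OF _ lim])
  then show "((\<lambda>p. V (t p) (x p)) \<longlongrightarrow> V (t q) (x q)) (at q within S)"
    by (simp add: LIM_zero_iff)
qed

lemma
  assumes "s \<le> t"
  shows Gamma_bounded: "bounded_linear_on X0 (\<Gamma> t s)"
    and Gamma_X0: "x \<in> X0 \<Longrightarrow> \<Gamma> t s x \<in> X0"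
    and Gamma_linear: "linear_on_subspace X0 (\<Gamma> t s)"
  using Gamma assms unfolding solution_family_def exp_bounded_evolution_family_def bounded_linear_on_def
  by blast+

lemma Gamma_same: "x \<in> X0 \<Longrightarrow> \<Gamma> t t x = x"
  and Gamma_cocycle: "s \<le> r \<Longrightarrow> r \<le> t \<Longrightarrow> x \<in> X0 \<Longrightarrow> \<Gamma> t r (\<Gamma> r s x) = \<Gamma> t s x"
  and Gamma_strongly_continuous: "x \<in> X0 \<Longrightarrow> continuous_on {(t, s). s \<le> t} (\<lambda>(t, s). \<Gamma> t s x)"
  using Gamma unfolding solution_family_def exp_bounded_evolution_family_def by blast+

lemma exp_boundD:
  assumes "exp_bound X0 \<Gamma> M' w'" "s \<le> t" "x \<in> X0"
  shows "norm (\<Gamma> t s x) \<le> M' * exp (w' * (t - s)) * norm x"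
proof -
  have "norm (\<Gamma> t s x) \<le> onorm_on X0 (\<Gamma> t s) * norm x"
    by (rule onorm_on_bound[OF Gamma_bounded[OF assms(2)] assms(3)])
  also have "\<dots> \<le> M' * exp (w' * (t - s)) * norm x"
    using assms(1,2) unfolding exp_bound_def by (intro mult_right_mono) auto
  finally show ?thesis .
qed

lemma exp_bound_exists: obtains M' w' where "1 \<le> M'" "exp_bound X0 \<Gamma> M' w'"
proof -
  have "\<exists>M'\<ge>1. \<exists>w'. exp_bound X0 \<Gamma> M' w'"
    using Gamma unfolding solution_family_def exp_bounded_evolution_family_def by (elim conjE)
  then show ?thesis using that by auto
qed

text \<open>Strong continuity handles a fixed vector; the exponential bound makes the dependence on
  the vector locally uniform in both times.\<close>

lemma Gamma_continuous:
  assumes t: "continuous_on S t" and s: "continuous_on S s" and x: "continuous_on S x"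
    and st: "\<And>p. p \<in> S \<Longrightarrow> s p \<le> t p" and xX: "\<And>p. p \<in> S \<Longrightarrow> x p \<in> X0"
  shows "continuous_on S (\<lambda>p. \<Gamma> (t p) (s p) (x p))"
  unfolding continuous_on_def
proof
  fix q assume q: "q \<in> S"
  obtain M' w' where Mw: "1 \<le> M'" "exp_bound X0 \<Gamma> M' w'" by (rule exp_bound_exists)
  have "continuous_on S (\<lambda>p. \<Gamma> (t p) (s p) (x q))"
    using continuous_on_compose2[OF Gamma_strongly_continuous[OF xX[OF q]], of S "\<lambda>p. (t p, s p)"] st
    by (auto intro!: continuous_on_Pair t s)
  then have 1: "((\<lambda>p. norm (\<Gamma> (t p) (s p) (x q) - \<Gamma> (t q) (s q) (x q))) \<longlongrightarrow> 0) (at q within S)"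
    using q by (intro tendsto_norm_zero LIM_zero) (simp add: continuous_on_def)
  have 2: "((\<lambda>p. norm (x p - x q)) \<longlongrightarrow> 0) (at q within S)"
    using x q by (intro tendsto_norm_zero LIM_zero) (simp add: continuous_on_def)
  have 3: "((\<lambda>p. M' * exp (w' * (t p - s p))) \<longlongrightarrow> M' * exp (w' * (t q - s q))) (at q within S)"
    using t s q by (intro tendsto_intros) (simp_all add: continuous_on_def)
  have "((\<lambda>p. M' * exp (w' * (t p - s p)) * norm (x p - x q) + norm (\<Gamma> (t p) (s p) (x q) - \<Gamma> (t q) (s q) (x q))) \<longlongrightarrow>
      M' * exp (w' * (t q - s q)) * 0 + 0) (at q within S)"
    by (intro tendsto_add tendsto_mult 1 2 3)
  then have lim: "((\<lambda>p. M' * exp (w' * (t p - s p)) * norm (x p - x q) + norm (\<Gamma> (t p) (s p) (x q) - \<Gamma> (t q) (s q) (x q))) \<longlongrightarrow>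
      0) (at q within S)" by simp
  have "\<forall>\<^sub>F p in at q within S. p \<in> S" by (simp add: eventually_at_filter)
  then have "\<forall>\<^sub>F p in at q within S. norm (\<Gamma> (t p) (s p) (x p) - \<Gamma> (t q) (s q) (x q)) \<le>
      M' * exp (w' * (t p - s p)) * norm (x p - x q) + norm (\<Gamma> (t p) (s p) (x q) - \<Gamma> (t q) (s q) (x q))"
  proof eventually_elim
    case (elim p)
    have "\<Gamma> (t p) (s p) (x p) - \<Gamma> (t q) (s q) (x q) =
        \<Gamma> (t p) (s p) (x p - x q) + (\<Gamma> (t p) (s p) (x q) - \<Gamma> (t q) (s q) (x q))"
      by (simp add: linear_on_subspaceD(4)[OF Gamma_linear[OF st[OF elim]] xX[OF elim] xX[OF q]])
    also have "norm \<dots> \<le> norm (\<Gamma> (t p) (s p) (x p - x q)) + norm (\<Gamma> (t p) (s p) (x q) - \<Gamma> (t q) (s q) (x q))"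
      by (rule norm_triangle_ineq)
    also have "\<dots> \<le> M' * exp (w' * (t p - s p)) * norm (x p - x q) + norm (\<Gamma> (t p) (s p) (x q) - \<Gamma> (t q) (s q) (x q))"
      using exp_boundD[OF Mw(2) st[OF elim] X0_closed(1)[OF xX[OF elim] xX[OF q]]] by simp
    finally show ?case .
  qed
  then have "((\<lambda>p. \<Gamma> (t p) (s p) (x p) - \<Gamma> (t q) (s q) (x q)) \<longlongrightarrow> 0) (at q within S)"
    by (rule Lim_null_comparison[OF _ lim])
  then show "((\<lambda>p. \<Gamma> (t p) (s p) (x p)) \<longlongrightarrow> \<Gamma> (t q) (s q) (x q)) (at q within S)"
    by (simp add: LIM_zero_iff)
qed

text \<open>The mild equation rewritten with \<open>R_left_inverse\<close>. Apart from
  \<open>V\<close> only the bounded operator \<open>R kap\<close> remains, so the equation can be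
  integrated over the starting time.\<close>

lemma Gamma_mild:
  assumes kap: "w < kap" and st: "s \<le> t" and x: "x \<in> X0"
  shows "integral {s..t} (\<lambda>r. \<Gamma> r s x) = R kap (kap *\<^sub>R integral {s..t} (\<lambda>r. \<Gamma> r s x) + x - \<Gamma> t s x -
    integral {s..t} (\<lambda>r. V r (\<Gamma> r s x)))"
proof -
  let ?I = "integral {s..t} (\<lambda>r. \<Gamma> r s x)" and ?J = "integral {s..t} (\<lambda>r. V r (\<Gamma> r s x))"
  have I: "?I \<in> D" and eq: "\<Gamma> t s x = x + A ?I - ?J"
    using Gamma x st unfolding solution_family_def mild_solution_def by blast+
  have "?I = R kap (kap *\<^sub>R ?I - A ?I)" by (rule R_left_inverse[OF kap I, symmetric])
  also have "kap *\<^sub>R ?I - A ?I = kap *\<^sub>R ?I + x - \<Gamma> t s x - ?J" using eq by simp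
  finally show ?thesis .
qed

section \<open>The inhomogeneous equation and its Duhamel integrals\<close>

definition duhamel :: "real \<Rightarrow> (real \<Rightarrow> 'a) \<Rightarrow> real \<Rightarrow> 'a" where
  "duhamel a g t = integral {a..t} (\<lambda>s. \<Gamma> t s (g s))"

context
  fixes g :: "real \<Rightarrow> 'a" assumes g: "continuous_on UNIV g" and gX: "\<And>s. g s \<in> X0"
begin

lemma Gamma_g_continuous: "continuous_on {(r, s). s \<le> r} (\<lambda>(r, s). \<Gamma> r s (g s))"
  unfolding case_prod_beta
  by (intro Gamma_continuous continuous_intros continuous_on_compose2[OF g]) (auto simp: gX)

lemma V_Gamma_g_continuous: "continuous_on {(r, s). s \<le> r} (\<lambda>(r, s). V r (\<Gamma> r s (g s)))"
proof -
  have "(\<lambda>(r, s). \<Gamma> r s (g s)) p \<in> X0" if "p \<in> {(r, s). s \<le> r}" for p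
    using that by (auto intro!: Gamma_X0 gX)
  from V_continuous[OF Gamma_g_continuous this continuous_on_fst[OF continuous_on_id]]
  show ?thesis by (simp add: case_prod_beta)
qed

lemma Gamma_g_continuous1: "continuous_on {a..t} (\<lambda>s. \<Gamma> t s (g s))"
  by (intro Gamma_continuous continuous_intros continuous_on_subset[OF g]) (auto simp: gX)

lemma duhamel_continuous: "continuous_on {a..b} (duhamel a g)"
proof (cases "a \<le> b")
  case True
  show ?thesis
    using continuous_on_triangle_integral[OF Gamma_g_continuous True] by (simp add: duhamel_def[abs_def])
qed simp

lemma duhamel_X0: "duhamel a g t \<in> X0"
  unfolding duhamel_def
  by (intro integral_in_closed_subspace Gamma_g_continuous1 subspace_X0 closed_closure Gamma_X0 gX) auto

text \<open>Write \<open>Gamma_mild\<close> with starting time \<open>s\<close> and vector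
  \<open>g s\<close>, integrate over \<open>s\<close>, and exchange the order of integration on the
  triangle; \<open>R kap\<close> and \<open>V r\<close> pass through the integrals by
  boundedness.\<close>

lemma duhamel_mild:
  assumes kap: "w < kap" and at: "a \<le> t"
  shows "integral {a..t} (duhamel a g) = R kap (kap *\<^sub>R integral {a..t} (duhamel a g) - duhamel a g t -
    integral {a..t} (\<lambda>r. V r (duhamel a g r)) + integral {a..t} g)"
proof -
  let ?F = "\<lambda>s. integral {s..t} (\<lambda>r. \<Gamma> r s (g s))" and ?G = "\<lambda>s. integral {s..t} (\<lambda>r. V r (\<Gamma> r s (g s)))"
  have F: "integral {a..t} ?F = integral {a..t} (duhamel a g)"
    using integral_triangle_swap[OF Gamma_g_continuous at] by (simp add: duhamel_def[abs_def])
  have G: "integral {a..t} ?G = integral {a..t} (\<lambda>r. V r (duhamel a g r))"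
  proof -
    have "integral {a..t} ?G = integral {a..t} (\<lambda>r. integral {a..r} (\<lambda>s. V r (\<Gamma> r s (g s))))"
      by (rule integral_triangle_swap[OF V_Gamma_g_continuous at])
    also have "\<dots> = integral {a..t} (\<lambda>r. V r (duhamel a g r))"
      unfolding duhamel_def
      by (intro integral_cong integral_bounded_linear_on[OF Gamma_g_continuous1 closed_closure V_bounded] Gamma_X0 gX) auto
    finally show ?thesis .
  qed
  have cF: "continuous_on {a..t} ?F" by (rule continuous_on_triangle_integral2[OF Gamma_g_continuous at])
  have cG: "continuous_on {a..t} ?G" by (rule continuous_on_triangle_integral2[OF V_Gamma_g_continuous at])
  have cg: "continuous_on {a..t} g" by (rule continuous_on_subset[OF g]) simp
  let ?h = "\<lambda>s. kap *\<^sub>R ?F s + g s - \<Gamma> t s (g s) - ?G s"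
  have ch: "continuous_on {a..t} ?h" by (intro continuous_intros cF cG cg Gamma_g_continuous1)
  have "integral {a..t} ?F = integral {a..t} (R kap \<circ> ?h)"
    using Gamma_mild[OF kap _ gX] by (intro integral_cong) auto
  also have "\<dots> = R kap (integral {a..t} ?h)"
    by (rule integral_linear[OF integrable_continuous_real[OF ch] R_bounded_linear[OF kap]])
  also have "integral {a..t} ?h = kap *\<^sub>R integral {a..t} ?F + integral {a..t} g - duhamel a g t - integral {a..t} ?G"
    unfolding duhamel_def
    by (simp add: integral_diff integral_add integrable_continuous_real continuous_intros cF cG cg Gamma_g_continuous1)
  finally show ?thesis unfolding F G by (simp add: algebra_simps)
qed

end

text \<open>Uniformity in the starting time \<open>s\<close> is what makes the evolution semigroup strongly continuous.\<close>

lemma Gamma_near_identity: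
  assumes x: "x \<in> D"
  obtains C where "\<And>s h. 0 \<le> h \<Longrightarrow> h \<le> 1 \<Longrightarrow> norm (\<Gamma> (s + h) s x - x) \<le> C * h"
proof -
  define kap where "kap = w + 1"
  have kap: "w < kap" by (simp add: kap_def)
  have xX: "x \<in> X0" using x closure_subset by blast
  obtain v where v: "0 < v" "\<And>t x. x \<in> X0 \<Longrightarrow> norm (V t x) \<le> v * norm x"
    using V_uniformly_bounded by blast
  obtain M' w' where Mw: "1 \<le> M'" "exp_bound X0 \<Gamma> M' w'" by (rule exp_bound_exists)
  define F where "F = norm (A x) + v * (M' * exp \<bar>w'\<bar> * norm x)"
  have F0: "0 \<le> F" using v(1) Mw(1) by (auto simp: F_def)
  have "norm (\<Gamma> (s + h) s x - x) \<le> M * exp (max w 0) * F * h" if h: "0 \<le> h" "h \<le> 1" for s h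
  proof -
    \<comment> \<open>Subtracting the constant \<open>x\<close> from the orbit moves
      \<open>A x\<close> into the forcing and leaves initial value 0, so \<open>mild_bound\<close>
      is proportional to \<open>h\<close>, with a constant independent of \<open>s\<close>.\<close>
    let ?y = "\<lambda>t. \<Gamma> t s x - x" and ?f = "\<lambda>t. A x - V t (\<Gamma> t s x)"
    have cG: "continuous_on {s..t} (\<lambda>r. \<Gamma> r s x)" for t
      by (intro Gamma_continuous continuous_intros) (auto simp: xX)
    have cV: "continuous_on {s..t} (\<lambda>r. V r (\<Gamma> r s x))" for t
      by (intro V_continuous cG continuous_intros Gamma_X0 xX) auto
    have "mild_on kap s (s + h) ?y ?f"
      unfolding mild_on_def
    proof (intro conjI ballI continuous_intros cG cV)
      fix t assume t: "t \<in> {s..s + h}"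
      have Iy: "integral {s..t} ?y = integral {s..t} (\<lambda>r. \<Gamma> r s x) - (t - s) *\<^sub>R x"
        using t by (simp add: integral_diff integrable_continuous_real cG)
      have If: "integral {s..t} ?f = (t - s) *\<^sub>R A x - integral {s..t} (\<lambda>r. V r (\<Gamma> r s x))"
        using t by (simp add: integral_diff integrable_continuous_real cV)
      have "kap *\<^sub>R integral {s..t} ?y + ?y s - ?y t + integral {s..t} ?f =
          (kap *\<^sub>R integral {s..t} (\<lambda>r. \<Gamma> r s x) + x - \<Gamma> t s x - integral {s..t} (\<lambda>r. V r (\<Gamma> r s x))) -
          (t - s) *\<^sub>R (kap *\<^sub>R x - A x)"
        unfolding Iy If by (simp add: Gamma_same[OF xX] algebra_simps)
      also have "R kap \<dots> = integral {s..t} (\<lambda>r. \<Gamma> r s x) - (t - s) *\<^sub>R x"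
        using Gamma_mild[OF kap _ xX, of s t] t
        by (simp add: R_diff[OF kap] R_scaleR[OF kap] R_left_inverse[OF kap x, unfolded R_diff[OF kap] R_scaleR[OF kap]])
      finally show "integral {s..t} ?y = R kap (kap *\<^sub>R integral {s..t} ?y + ?y s - ?y t + integral {s..t} ?f)"
        using Iy by simp
    qed
    moreover have "norm (?f t) \<le> F" if t: "t \<in> {s..s + h}" for t
    proof -
      have "norm (\<Gamma> t s x) \<le> M' * exp (w' * (t - s)) * norm x"
        using t by (intro exp_boundD[OF Mw(2)] xX) auto
      also have "\<dots> \<le> M' * exp \<bar>w'\<bar> * norm x"
      proof (intro mult_right_mono mult_left_mono)
        have "w' * (t - s) \<le> \<bar>w'\<bar> * (t - s)" using t by (intro mult_right_mono) auto
        also have "\<dots> \<le> \<bar>w'\<bar> * 1" using t h by (intro mult_left_mono) auto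
        finally show "exp (w' * (t - s)) \<le> exp \<bar>w'\<bar>" by simp
      qed (use Mw(1) in auto)
      finally have G: "norm (\<Gamma> t s x) \<le> M' * exp \<bar>w'\<bar> * norm x" .
      have "norm (V t (\<Gamma> t s x)) \<le> v * norm (\<Gamma> t s x)" using t by (intro v Gamma_X0 xX) auto
      also have "\<dots> \<le> v * (M' * exp \<bar>w'\<bar> * norm x)" using G v(1) by (intro mult_left_mono) auto
      finally show ?thesis unfolding F_def by (intro order_trans[OF norm_triangle_ineq4] add_left_mono)
    qed
    ultimately have "norm (?y (s + h)) \<le> M * exp (max w 0 * (s + h - s)) * (norm (?y s) + (s + h - s) * F)"
      using h by (intro mild_bound[OF _ kap]) auto
    also have "\<dots> = M * exp (max w 0 * h) * (h * F)" by (simp add: Gamma_same[OF xX])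
    also have "\<dots> \<le> M * exp (max w 0) * (h * F)"
    proof -
      have "max w 0 * h \<le> max w 0 * 1" using h by (intro mult_left_mono) auto
      then show ?thesis using M_ge_1 h F0 by (intro mult_right_mono mult_left_mono) auto
    qed
    finally show ?thesis by (simp add: mult_ac)
  qed
  then show ?thesis using that by blast
qed

text \<open>The comparison function \<open>y = W - R(\<kappa>) g\<close> solves \<open>y' = A y + f\<close> with an \<open>f\<close> that no longer contains
  \<open>g\<close> itself but only \<open>R(\<kappa>) g\<close> and \<open>R(\<kappa>) g'\<close>, which are small.\<close>

lemma duhamel_yosida_difference:
  "\<exists>T0>0. \<exists>C\<ge>0. \<forall>a b \<phi> \<phi>' K mu nu. a \<le> b \<longrightarrow> b - a \<le> T0 \<longrightarrow>
    (\<forall>t. (\<phi> has_vector_derivative \<phi>' t) (at t)) \<longrightarrow> continuous_on UNIV \<phi>' \<longrightarrow>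
    (\<forall>t\<in>{a..b}. norm (\<phi> t) \<le> K \<and> norm (\<phi>' t) \<le> K) \<longrightarrow> w < mu \<longrightarrow> w < nu \<longrightarrow>
    norm (duhamel a (\<lambda>s. mu *\<^sub>R R mu (\<phi> s) - nu *\<^sub>R R nu (\<phi> s)) b) \<le> C * (1 / (mu - w) + 1 / (nu - w)) * K"
proof -
  define kap where "kap = w + 1"
  have kap: "w < kap" by (simp add: kap_def)
  obtain v where v: "0 < v" "\<And>t x. x \<in> X0 \<Longrightarrow> norm (V t x) \<le> v * norm x"
    using V_uniformly_bounded by blast
  define M1 where "M1 = M * exp (max w 0)"
  have M1: "0 < M1" using M_ge_1 by (simp add: M1_def)
  \<comment> \<open>This length makes the contribution of \<open>V W\<close> at most half of the
    maximum of \<open>W\<close>, and the cap 1 bounds the exponential. It does not depend on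
    \<open>a\<close>, as the later supremum over all \<open>t\<close> requires.\<close>
  define T0 where "T0 = min 1 (1 / (2 * M1 * v))"
  have T0: "0 < T0" "T0 \<le> 1" "M1 * T0 * v \<le> 1/2"
  proof -
    show "0 < T0" "T0 \<le> 1" using M1 v(1) by (auto simp: T0_def)
    have "T0 * (M1 * v) \<le> 1 / (2 * M1 * v) * (M1 * v)" using M1 v(1) by (intro mult_right_mono) (auto simp: T0_def)
    then show "M1 * T0 * v \<le> 1/2" using M1 v(1) by (simp add: mult_ac)
  qed
  \<comment> \<open>The numerator in \<open>R_approx\<close>; \<open>E\<close> below then bounds
    \<open>R kap\<close> composed with the difference of two Yosida approximations.\<close>
  define c1 where "c1 = M * (\<bar>kap\<bar> * (M / (kap - w)) + 1)"
  have c1: "0 \<le> c1" using M_ge_1 kap by (auto simp: c1_def)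
  define C where "C = 2 * (1 + M1 * (\<bar>kap\<bar> + 2)) * c1"
  show ?thesis
  proof (rule exI[of _ T0], rule conjI[OF T0(1)], rule exI[of _ C], intro conjI allI impI)
    show "0 \<le> C" using M1 c1 by (auto simp: C_def)
    fix a b :: real and \<phi> \<phi>' :: "real \<Rightarrow> 'a" and K mu nu :: real
    assume ab: "a \<le> b" "b - a \<le> T0" and d: "\<forall>t. (\<phi> has_vector_derivative \<phi>' t) (at t)"
      and c\<phi>': "continuous_on UNIV \<phi>'" and "\<forall>t\<in>{a..b}. norm (\<phi> t) \<le> K \<and> norm (\<phi>' t) \<le> K"
      and mu: "w < mu" and nu: "w < nu"
    then have K: "\<And>t. t \<in> {a..b} \<Longrightarrow> norm (\<phi> t) \<le> K" "\<And>t. t \<in> {a..b} \<Longrightarrow> norm (\<phi>' t) \<le> K" by auto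
    note d\<phi> = d[rule_format]
    have c\<phi>: "continuous_on UNIV \<phi>"
      by (rule continuous_at_imp_continuous_on) (use has_vector_derivative_continuous[OF d\<phi>] in simp)
    define J where "J = (\<lambda>x. mu *\<^sub>R R mu x - nu *\<^sub>R R nu x)"
    have blJ: "bounded_linear J"
      unfolding J_def by (intro bounded_linear_sub bounded_linear_scaleR_right[THEN bounded_linear_compose] R_bounded_linear mu nu)
    define g where "g = (\<lambda>s. J (\<phi> s))"
    have g: "continuous_on UNIV g" unfolding g_def by (intro bounded_linear.continuous_on[OF blJ] c\<phi>)
    have gX: "g s \<in> X0" for s unfolding g_def J_def by (intro X0_closed R_X0 mu nu)
    define k where "k = (\<lambda>s. R kap (g s))"
    define k' where "k' = (\<lambda>s. R kap (J (\<phi>' s)))"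
    define E where "E = c1 * (1 / (mu - w) + 1 / (nu - w))"
    have E0: "0 \<le> E" unfolding E_def using c1 mu nu by (intro mult_nonneg_nonneg) auto
    have K0: "0 \<le> K" using order_trans[OF norm_ge_zero K(1)[of a]] ab by simp
    have RJ: "norm (R kap (J x)) \<le> E * norm x" for x
    proof -
      \<comment> \<open>\<open>R kap\<close> commutes with \<open>R mu\<close> and
        \<open>R nu\<close>; adding and subtracting \<open>R kap x\<close> leaves two terms of the
        form in \<open>R_approx\<close>.\<close>
      have "R kap (J x) = (mu *\<^sub>R R mu (R kap x) - R kap x) - (nu *\<^sub>R R nu (R kap x) - R kap x)"
        unfolding J_def by (simp add: R_diff[OF kap] R_scaleR[OF kap] R_commute[OF kap mu] R_commute[OF kap nu])
      also have "norm \<dots> \<le> M / (mu - w) * ((\<bar>kap\<bar> * (M / (kap - w)) + 1) * norm x) +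
          M / (nu - w) * ((\<bar>kap\<bar> * (M / (kap - w)) + 1) * norm x)"
        by (intro order_trans[OF norm_triangle_ineq4] add_mono R_approx kap mu nu)
      also have "\<dots> = E * norm x" by (simp add: E_def c1_def algebra_simps)
      finally show ?thesis .
    qed
    have kb: "norm (k t) \<le> E * K" "norm (k' t) \<le> E * K" if "t \<in> {a..b}" for t
      using order_trans[OF RJ mult_left_mono[OF K(1)[OF that] E0]] order_trans[OF RJ mult_left_mono[OF K(2)[OF that] E0]]
      by (simp_all add: k_def k'_def g_def)
    let ?W = "duhamel a g"
    \<comment> \<open>Since \<open>A k = kap k - g\<close>, this is the forcing in the equation of
      \<open>W - k\<close>: the two occurrences of \<open>g\<close> cancel.\<close>
    define f where "f t = kap *\<^sub>R k t - k' t - V t (?W t)" for t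
    have cW: "continuous_on {a..t} ?W" for t by (rule duhamel_continuous[OF g gX])
    have ck: "continuous_on T k" for T
      unfolding k_def by (intro bounded_linear.continuous_on[OF R_bounded_linear[OF kap]] continuous_on_subset[OF g]) simp
    have ck': "continuous_on T k'" for T
      unfolding k'_def
      by (intro bounded_linear.continuous_on[OF R_bounded_linear[OF kap]] bounded_linear.continuous_on[OF blJ]
          continuous_on_subset[OF c\<phi>']) simp
    have cV: "continuous_on {a..t} (\<lambda>r. V r (?W r))" for t
      by (intro V_continuous cW continuous_intros duhamel_X0[OF g gX])
    have W0: "?W a = 0" by (simp add: duhamel_def)
    have dk: "(k has_vector_derivative k' t) (at t within T)" for t T
      unfolding k_def k'_def g_def
      by (intro bounded_linear.has_vector_derivative[OF R_bounded_linear[OF kap]]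
          bounded_linear.has_vector_derivative[OF blJ] has_vector_derivative_at_within[OF d\<phi>])
    have mild: "mild_on kap a c (\<lambda>t. ?W t - k t) f" for c
      unfolding mild_on_def f_def
    proof (intro conjI ballI continuous_intros cW ck ck' cV)
      fix t assume t: "t \<in> {a..c}"
      have Iy: "integral {a..t} (\<lambda>t. ?W t - k t) = integral {a..t} ?W - integral {a..t} k"
        by (intro integral_diff integrable_continuous_real cW ck)
      have Ik': "integral {a..t} k' = k t - k a"
        using t by (intro integral_unique fundamental_theorem_of_calculus dk) auto
      have If: "integral {a..t} (\<lambda>t. kap *\<^sub>R k t - k' t - V t (?W t)) =
          kap *\<^sub>R integral {a..t} k - (k t - k a) - integral {a..t} (\<lambda>t. V t (?W t))"
        unfolding Ik'[symmetric]
        by (simp add: integral_diff integrable_continuous_real continuous_intros cW ck ck' cV)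
      have Ig: "integral {a..t} k = R kap (integral {a..t} g)"
        unfolding k_def
        using integral_linear[OF integrable_continuous_real[OF continuous_on_subset[OF g]] R_bounded_linear[OF kap], of a t]
        by (simp add: o_def)
      have arg: "kap *\<^sub>R integral {a..t} (\<lambda>t. ?W t - k t) + (?W a - k a) - (?W t - k t) +
          integral {a..t} (\<lambda>t. kap *\<^sub>R k t - k' t - V t (?W t)) =
          (kap *\<^sub>R integral {a..t} ?W - ?W t - integral {a..t} (\<lambda>t. V t (?W t)) + integral {a..t} g) - integral {a..t} g"
        unfolding Iy If W0 by (simp add: algebra_simps)
      have val: "R kap ((kap *\<^sub>R integral {a..t} ?W - ?W t - integral {a..t} (\<lambda>t. V t (?W t)) + integral {a..t} g) -
          integral {a..t} g) = integral {a..t} ?W - integral {a..t} k"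
        unfolding R_diff[OF kap, of "_ + _"] Ig using duhamel_mild[OF g gX kap, of a t] t by simp
      show "integral {a..t} (\<lambda>t. ?W t - k t) = R kap (kap *\<^sub>R integral {a..t} (\<lambda>t. ?W t - k t) +
          (?W a - k a) - (?W t - k t) + integral {a..t} (\<lambda>t. kap *\<^sub>R k t - k' t - V t (?W t)))"
        unfolding arg val by (rule Iy)
    qed
    \<comment> \<open>At a maximum point \<open>c\<close> of the norm, \<open>V W\<close> is bounded
      by \<open>v * S\<close> on all of \<open>{a..c}\<close>, and the resulting inequality for
      \<open>S\<close> has only \<open>S / 2\<close> on its right side, which is absorbed.\<close>
    have "\<exists>c\<in>{a..b}. \<forall>t\<in>{a..b}. norm (?W t) \<le> norm (?W c)"
      by (rule continuous_attains_sup[OF compact_Icc _ continuous_on_norm[OF cW]]) (use ab(1) in simp)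
    then obtain c where c: "c \<in> {a..b}" "\<And>t. t \<in> {a..b} \<Longrightarrow> norm (?W t) \<le> norm (?W c)" by blast
    define S where "S = norm (?W c)"
    have S0: "0 \<le> S" by (simp add: S_def)
    define F where "F = \<bar>kap\<bar> * (E * K) + E * K + v * S"
    have F0: "0 \<le> F" using E0 K0 v(1) S0 by (auto simp: F_def)
    have fF: "norm (f t) \<le> F" if t: "t \<in> {a..c}" for t
    proof -
      have t': "t \<in> {a..b}" using t c(1) by auto
      have "norm (V t (?W t)) \<le> v * norm (?W t)" by (intro v duhamel_X0[OF g gX])
      also have "\<dots> \<le> v * S" using c(2)[OF t'] v(1) by (simp add: S_def)
      finally have 1: "norm (V t (?W t)) \<le> v * S" .
      have 2: "norm (kap *\<^sub>R k t) \<le> \<bar>kap\<bar> * (E * K)" using kb(1)[OF t'] by (simp add: mult_left_mono)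
      show ?thesis
        unfolding f_def F_def
        by (intro order_trans[OF norm_triangle_ineq4] add_mono 1 2 kb t')
    qed
    have "norm (?W c - k c) \<le> M * exp (max w 0 * (c - a)) * (norm (?W a - k a) + (c - a) * F)"
      using c(1) by (intro mild_bound[OF _ kap mild fF]) auto
    also have "\<dots> \<le> M1 * (E * K + T0 * F)"
    proof (rule mult_mono)
      have "max w 0 * (c - a) \<le> max w 0 * 1" using c(1) ab T0 by (intro mult_left_mono) auto
      then show "M * exp (max w 0 * (c - a)) \<le> M1" using M_ge_1 by (simp add: M1_def)
      show "norm (?W a - k a) + (c - a) * F \<le> E * K + T0 * F"
        using kb(1)[of a] ab c(1) F0 by (intro add_mono mult_right_mono) (auto simp: W0)
      show "0 \<le> norm (?W a - k a) + (c - a) * F" using c(1) F0 by auto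
    qed (use M1 in simp)
    also have "\<dots> \<le> M1 * (E * K + (\<bar>kap\<bar> * (E * K) + E * K)) + M1 * T0 * v * S"
    proof -
      have "T0 * (\<bar>kap\<bar> * (E * K) + E * K) \<le> 1 * (\<bar>kap\<bar> * (E * K) + E * K)"
        using T0(2) E0 K0 by (intro mult_right_mono) auto
      then have "M1 * (T0 * (\<bar>kap\<bar> * (E * K) + E * K)) \<le> M1 * (\<bar>kap\<bar> * (E * K) + E * K)"
        using M1 by (intro mult_left_mono) auto
      then show ?thesis by (simp add: F_def algebra_simps)
    qed
    also have "\<dots> \<le> M1 * (\<bar>kap\<bar> + 2) * (E * K) + 1/2 * S"
      using mult_right_mono[OF T0(3) S0] by (simp add: algebra_simps)
    finally have "S \<le> E * K + M1 * (\<bar>kap\<bar> + 2) * (E * K) + 1/2 * S"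
      using norm_triangle_sub[of "?W c" "k c"] kb(1)[OF c(1)] unfolding S_def by linarith
    then have "S \<le> 2 * (1 + M1 * (\<bar>kap\<bar> + 2)) * (E * K)" by (simp add: algebra_simps)
    also have "\<dots> = C * (1 / (mu - w) + 1 / (nu - w)) * K" by (simp add: C_def E_def mult_ac)
    finally show "norm (duhamel a (\<lambda>s. mu *\<^sub>R R mu (\<phi> s) - nu *\<^sub>R R nu (\<phi> s)) b) \<le>
        C * (1 / (mu - w) + 1 / (nu - w)) * K"
      using c(2)[of b] ab(1) unfolding S_def g_def J_def by auto
  qed
qed

end

section \<open>The evolution semigroup\<close>

instance bcontfun :: (metric_space, banach) banach ..

lemma bounded_linear_apply_bcontfun:
  "bounded_linear (\<lambda>\<phi> :: 'a::topological_space \<Rightarrow>\<^sub>C 'b::real_normed_vector. apply_bcontfun \<phi> t)"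
  by (rule bounded_linear_intro[of _ 1]) (auto simp: norm_bounded)

context evolution_problem
begin

text \<open>Common near-periods of \<open>V\<close> and \<open>\<phi>\<close> work for the shifted
  orbit: \<open>Gamma_ap\<close> with \<open>nu = r\<close> handles the change of
  \<open>\<Gamma>\<close>, the exponential bound the change of \<open>\<phi>\<close>.\<close>

lemma
  assumes \<phi>: "\<phi> \<in> AP X0" and r: "0 \<le> r"
  shows evolution_semigroup_AP: "evolution_semigroup \<Gamma> r \<phi> \<in> AP X0"
    and evolution_semigroup_apply:
      "apply_bcontfun (evolution_semigroup \<Gamma> r \<phi>) s = \<Gamma> s (s - r) (apply_bcontfun \<phi> (s - r))"
proof -
  let ?f = "\<lambda>s. \<Gamma> s (s - r) (apply_bcontfun \<phi> (s - r))"
  obtain M' w' where Mw: "1 \<le> M'" "exp_bound X0 \<Gamma> M' w'" by (rule exp_bound_exists)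
  have \<phi>X: "apply_bcontfun \<phi> s \<in> X0" for s using AP_D(1)[OF \<phi>] .
  have c: "continuous_on UNIV ?f"
    using r by (intro Gamma_continuous continuous_intros continuous_on_compose2[OF continuous_on_apply_bcontfun[of UNIV]])
      (auto simp: \<phi>X)
  have fX: "?f s \<in> X0" for s using r \<phi>X by (intro Gamma_X0) auto
  have rd: "relatively_dense (translation_set dist ?f e)" if e: "e > 0" for e
  \<comment> \<open>\<open>Gamma_ap\<close> needs a positive time difference; at
    \<open>r = 0\<close> the operator is the identity.\<close>
  proof (cases "r = 0")
    case True
    then have "?f = apply_bcontfun \<phi>" using Gamma_same[OF \<phi>X] by auto
    then show ?thesis using AP_D(3)[OF \<phi> e] by simp
  next
    case False
    with r have r0: "0 < r" by simp
    define B where "B = norm \<phi> + 1"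
    have B: "0 < B" "norm (apply_bcontfun \<phi> s) \<le> B" for s
      using norm_bounded[of \<phi> s] by (auto simp: B_def intro: add_nonneg_pos)
    define e2 where "e2 = e / (2 * (M' * exp (w' * r)))"
    have e2: "0 < e2" "M' * exp (w' * r) * e2 = e / 2"
      using e Mw(1) by (auto simp: e2_def)
    obtain eta delta where eta: "eta > 0" "delta < 0"
      and bd: "\<And>t s tau. tau \<in> translation_set (opdist X0) V eta \<Longrightarrow> t \<ge> s \<Longrightarrow> t - s \<ge> r \<Longrightarrow>
           onorm_on X0 (\<lambda>x. \<Gamma> (t + tau) (s + tau) x - \<Gamma> t s x) \<le> e / (2 * B) * exp (delta * (t - s))"
      using Gamma_ap[of "e / (2 * B)" r] e B(1) r0 by (auto simp del: exp_le_cancel_iff)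
    show ?thesis
    proof (rule relatively_dense_mono[OF relatively_dense_common_translations[OF V_pseudometric V_ap
          pseudometric_along_dist AP_D(2)[OF \<phi>] eta(1) e2(1)]], rule subsetI)
      fix tau assume tau: "tau \<in> translation_set (opdist X0) V eta \<inter> translation_set dist (apply_bcontfun \<phi>) e2"
      have "dist (?f (s + tau)) (?f s) < e" for s
      proof -
        let ?x = "apply_bcontfun \<phi> (s + tau - r)" and ?z = "apply_bcontfun \<phi> (s - r)"
        have sr: "s - r \<le> s" "s - r + tau \<le> s + tau" using r by auto
        have eq: "s + tau - r = s - r + tau" by simp
        have "?f (s + tau) - ?f s = (\<Gamma> (s + tau) (s - r + tau) ?x - \<Gamma> s (s - r) ?x) + \<Gamma> s (s - r) (?x - ?z)"
          using linear_on_subspaceD(4)[OF Gamma_linear[OF sr(1)] \<phi>X \<phi>X] by (simp add: eq)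
        also have "norm \<dots> \<le> norm (\<Gamma> (s + tau) (s - r + tau) ?x - \<Gamma> s (s - r) ?x) + norm (\<Gamma> s (s - r) (?x - ?z))"
          by (rule norm_triangle_ineq)
        also have "\<dots> < e / 2 + e / 2"
        proof (rule add_le_less_mono)
          have "norm (\<Gamma> (s + tau) (s - r + tau) ?x - \<Gamma> s (s - r) ?x) \<le>
              onorm_on X0 (\<lambda>x. \<Gamma> (s + tau) (s - r + tau) x - \<Gamma> s (s - r) x) * norm ?x"
            by (rule onorm_on_bound[OF bounded_linear_on_diff[OF Gamma_bounded[OF sr(2)] Gamma_bounded[OF sr(1)]] \<phi>X])
          also have "\<dots> \<le> (e / (2 * B) * exp (delta * r)) * B"
            using bd[of tau "s - r" s] tau r B(2)
            by (intro mult_mono onorm_on_nonneg bounded_linear_on_diff Gamma_bounded)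
              (auto intro!: mult_nonneg_nonneg simp: e B(1) less_imp_le)
          also have "\<dots> \<le> (e / (2 * B) * 1) * B"
            using eta(2) r B(1) e by (intro mult_right_mono mult_left_mono) (auto simp: mult_le_0_iff)
          also have "\<dots> = e / 2" using B(1) by simp
          finally show "norm (\<Gamma> (s + tau) (s - r + tau) ?x - \<Gamma> s (s - r) ?x) \<le> e / 2" .
          have "dist ?x ?z < e2" using tau unfolding eq translation_set_def by blast
          then have "M' * exp (w' * r) * norm (?x - ?z) < M' * exp (w' * r) * e2"
            using Mw(1) by (intro mult_strict_left_mono) (auto simp: dist_norm)
          moreover have "norm (\<Gamma> s (s - r) (?x - ?z)) \<le> M' * exp (w' * r) * norm (?x - ?z)"
            using exp_boundD[OF Mw(2) sr(1) X0_closed(1)[OF \<phi>X \<phi>X]] by simp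
          ultimately show "norm (\<Gamma> s (s - r) (?x - ?z)) < e / 2" using e2(2) by simp
        qed
        finally show ?thesis by (simp add: dist_norm)
      qed
      then show "tau \<in> translation_set dist ?f e" unfolding translation_set_def by blast
    qed
  qed
  show "evolution_semigroup \<Gamma> r \<phi> \<in> AP X0"
    "apply_bcontfun (evolution_semigroup \<Gamma> r \<phi>) s = \<Gamma> s (s - r) (apply_bcontfun \<phi> (s - r))"
    unfolding evolution_semigroup_def using AP_I[OF c fX rd] by auto
qed

lemma evolution_semigroup_bound:
  assumes "1 \<le> M'" "exp_bound X0 \<Gamma> M' w'" "0 \<le> r" "\<phi> \<in> AP X0"
  shows "norm (evolution_semigroup \<Gamma> r \<phi>) \<le> M' * exp (w' * r) * norm \<phi>"
proof (rule norm_bound)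
  fix s
  have "norm (\<Gamma> s (s - r) (apply_bcontfun \<phi> (s - r))) \<le> M' * exp (w' * (s - (s - r))) * norm (apply_bcontfun \<phi> (s - r))"
    using assms(3) by (intro exp_boundD[OF assms(2)] AP_D(1)[OF assms(4)]) auto
  also have "\<dots> \<le> M' * exp (w' * r) * norm \<phi>"
    using assms(1) norm_bounded by (auto intro!: mult_left_mono)
  finally show "norm (apply_bcontfun (evolution_semigroup \<Gamma> r \<phi>) s) \<le> M' * exp (w' * r) * norm \<phi>"
    by (simp add: evolution_semigroup_apply assms)
qed

text \<open>The points of a net in \<open>X0\<close> are moved into the dense set \<open>D\<close>,
  where \<open>Gamma_near_identity\<close> and \<open>yosida_tendsto_on_D\<close> apply.\<close>

lemma AP_net_in_D:
  assumes "\<phi> \<in> AP X0" "e > 0"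
  obtains F where "finite F" "F \<subseteq> D" "\<And>t. \<exists>x\<in>F. norm (apply_bcontfun \<phi> t - x) < e"
proof -
  obtain G where G: "finite G" "G \<subseteq> X0" "\<And>t. \<exists>x\<in>G. dist (apply_bcontfun \<phi> t) x < e/2"
    using AP_finite_net[OF assms(1), of "e/2"] assms(2) by auto
  have "\<exists>y\<in>D. dist y x < e/2" if "x \<in> X0" for x
    using that assms(2) closure_approachable[of x D] half_gt_zero by blast
  then obtain y where y: "\<And>x. x \<in> X0 \<Longrightarrow> y x \<in> D" "\<And>x. x \<in> X0 \<Longrightarrow> dist (y x) x < e/2" by metis
  have "\<exists>x\<in>y ` G. norm (apply_bcontfun \<phi> t - x) < e" for t
  proof -
    obtain x where x: "x \<in> G" "dist (apply_bcontfun \<phi> t) x < e/2" using G(3) by blast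
    then have "dist (apply_bcontfun \<phi> t) (y x) < e"
      using y(2)[of x] G(2) dist_triangle_half_l[of "apply_bcontfun \<phi> t" x e "y x"] by (auto simp: dist_commute)
    then show ?thesis using x(1) by (auto simp: dist_norm)
  qed
  then show ?thesis using that[of "y ` G"] G y(1) by blast
qed

text \<open>A finite net in \<open>D\<close> reduces the claim to finitely many vectors, for which
  the estimate is uniform in the starting time; uniform continuity of \<open>\<phi>\<close> handles
  the shift of its argument.\<close>

lemma evolution_semigroup_at_0:
  assumes \<phi>: "\<phi> \<in> AP X0"
  shows "((\<lambda>h. evolution_semigroup \<Gamma> h \<phi>) \<longlongrightarrow> \<phi>) (at_right 0)"
proof (rule tendstoI)
  fix e :: real assume e: "e > 0"
  obtain M' w' where Mw: "1 \<le> M'" "exp_bound X0 \<Gamma> M' w'" by (rule exp_bound_exists)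
  have \<phi>X: "apply_bcontfun \<phi> s \<in> X0" for s using AP_D(1)[OF \<phi>] .
  define K where "K = M' * exp \<bar>w'\<bar>"
  have K: "0 < K" using Mw(1) by (simp add: K_def)
  \<comment> \<open>The four errors below add up to \<open>(K + 1) * d + e / 4\<close>, which this
    choice makes \<open>3 * e / 8\<close>.\<close>
  define d where "d = e / (8 * (K + 1))"
  have d: "0 < d" "(K + 1) * d = e / 8" using e K by (auto simp: d_def field_simps)
  obtain F where F: "finite F" "F \<subseteq> D" "\<And>t. \<exists>x\<in>F. norm (apply_bcontfun \<phi> t - x) < d"
    using AP_net_in_D[OF \<phi> d(1)] by blast
  have "\<forall>x\<in>F. \<exists>C. \<forall>s h. 0 \<le> h \<longrightarrow> h \<le> 1 \<longrightarrow> norm (\<Gamma> (s + h) s x - x) \<le> C * h"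
  proof
    fix x assume "x \<in> F"
    then have "x \<in> D" using F(2) by blast
    then obtain C where "\<And>s h. 0 \<le> h \<Longrightarrow> h \<le> 1 \<Longrightarrow> norm (\<Gamma> (s + h) s x - x) \<le> C * h"
      using Gamma_near_identity by blast
    then show "\<exists>C. \<forall>s h. 0 \<le> h \<longrightarrow> h \<le> 1 \<longrightarrow> norm (\<Gamma> (s + h) s x - x) \<le> C * h" by blast
  qed
  then obtain C where C: "\<And>x s h. x \<in> F \<Longrightarrow> 0 \<le> h \<Longrightarrow> h \<le> 1 \<Longrightarrow> norm (\<Gamma> (s + h) s x - x) \<le> C x * h"
    by metis
  obtain \<delta> where \<delta>: "\<delta> > 0" "\<And>s t. \<bar>s - t\<bar> < \<delta> \<Longrightarrow> dist (apply_bcontfun \<phi> s) (apply_bcontfun \<phi> t) < e / 8"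
    using AP_uniformly_continuous[OF \<phi>, of "e/8"] e by auto
  have "\<forall>\<^sub>F h in at_right 0. \<forall>x\<in>F. C x * h < e / 8"
  proof (rule eventually_ball_finite[OF F(1)], rule ballI)
    fix x
    have "((\<lambda>h. C x * h) \<longlongrightarrow> C x * 0) (at_right 0)" by (intro tendsto_intros)
    then show "\<forall>\<^sub>F h in at_right 0. C x * h < e / 8" by (rule order_tendstoD(2)) (use e in simp)
  qed
  moreover have "\<forall>\<^sub>F h in at_right 0. h \<in> {0<..<min \<delta> 1}"
    using \<delta>(1) by (intro eventually_at_right_real) auto
  ultimately show "\<forall>\<^sub>F h in at_right 0. dist (evolution_semigroup \<Gamma> h \<phi>) \<phi> < e"
  proof eventually_elim
    case (elim h)
    then have h: "0 < h" "h < \<delta>" "h < 1" by auto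
    have "norm (apply_bcontfun (evolution_semigroup \<Gamma> h \<phi> - \<phi>) s) \<le> e / 2" for s
    proof -
      let ?y = "apply_bcontfun \<phi> (s - h)"
      obtain x where x: "x \<in> F" "norm (?y - x) < d" using F(3) by blast
      have xX: "x \<in> X0" using x(1) F(2) closure_subset by blast
      have hs: "s - h \<le> s" using h by simp
      have eq: "\<Gamma> s (s - h) ?y - apply_bcontfun \<phi> s =
          \<Gamma> s (s - h) (?y - x) + (\<Gamma> s (s - h) x - x) + ((x - ?y) + (?y - apply_bcontfun \<phi> s))"
        by (simp add: linear_on_subspaceD(4)[OF Gamma_linear[OF hs] \<phi>X xX])
      have 1: "norm (\<Gamma> s (s - h) (?y - x)) \<le> K * d"
      proof -
        have "norm (\<Gamma> s (s - h) (?y - x)) \<le> M' * exp (w' * (s - (s - h))) * norm (?y - x)"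
          by (intro exp_boundD[OF Mw(2) hs] X0_closed \<phi>X xX)
        also have "\<dots> \<le> M' * exp \<bar>w'\<bar> * d"
        proof (intro mult_mono mult_left_mono)
          have "w' * h \<le> \<bar>w'\<bar> * h" using h by (intro mult_right_mono) auto
          also have "\<dots> \<le> \<bar>w'\<bar> * 1" using h by (intro mult_left_mono) auto
          finally show "exp (w' * (s - (s - h))) \<le> exp \<bar>w'\<bar>" by simp
        qed (use Mw(1) x(2) in auto)
        finally show ?thesis by (simp add: K_def)
      qed
      have 2: "norm (\<Gamma> s (s - h) x - x) \<le> e / 8"
        using C[OF x(1), of h "s - h"] h elim x(1) by force
      have 3: "norm ((x - ?y) + (?y - apply_bcontfun \<phi> s)) \<le> d + e / 8"
        using x(2) \<delta>(2)[of "s - h" s] h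
        by (intro norm_triangle_mono) (auto simp: norm_minus_commute dist_norm)
      have "norm (\<Gamma> s (s - h) ?y - apply_bcontfun \<phi> s) \<le> (K * d + e / 8) + (d + e / 8)"
        unfolding eq by (intro norm_triangle_mono 1 2 3)
      also have "\<dots> = (K + 1) * d + e / 4" by (simp add: algebra_simps)
      finally show ?thesis using d(2) e h by (simp add: evolution_semigroup_apply[OF \<phi>])
    qed
    then have "norm (evolution_semigroup \<Gamma> h \<phi> - \<phi>) \<le> e / 2" by (rule norm_bound)
    then show ?case using e by (simp add: dist_norm)
  qed
qed

sublocale S: c0_semigroup_on "AP X0" "evolution_semigroup \<Gamma>"
proof
  show "subspace (AP X0)" by (rule subspace_AP[OF subspace_X0])
  show "closed (AP X0)" by (rule closed_AP) simp
  show "evolution_semigroup \<Gamma> r \<phi> \<in> AP X0" if "0 \<le> r" "\<phi> \<in> AP X0" for r \<phi>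
    using evolution_semigroup_AP that by blast
  show "linear_on_subspace (AP X0) (evolution_semigroup \<Gamma> r)" if r: "0 \<le> r" for r
  proof -
    have rs: "s - r \<le> s" for s using r by simp
    have add: "\<phi> + \<psi> \<in> AP X0" if "\<phi> \<in> AP X0" "\<psi> \<in> AP X0" for \<phi> \<psi>
      using subspace_add[OF subspace_AP[OF subspace_X0] that] .
    have scale: "c *\<^sub>R \<phi> \<in> AP X0" if "\<phi> \<in> AP X0" for \<phi> c
      using subspace_scale[OF subspace_AP[OF subspace_X0] that] .
    show ?thesis
      unfolding linear_on_subspace_def
      by (auto intro!: bcontfun_eqI subspace_AP subspace_X0
          simp: evolution_semigroup_apply r add scale linear_on_subspaceD(2,3)[OF Gamma_linear[OF rs]] AP_D(1))
  qed
  show "evolution_semigroup \<Gamma> 0 \<phi> = \<phi>" if "\<phi> \<in> AP X0" for \<phi>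
    by (rule bcontfun_eqI) (simp add: evolution_semigroup_apply that Gamma_same AP_D(1)[OF that])
  show "evolution_semigroup \<Gamma> (r + s) \<phi> = evolution_semigroup \<Gamma> r (evolution_semigroup \<Gamma> s \<phi>)"
    if "0 \<le> r" "0 \<le> s" "\<phi> \<in> AP X0" for r s \<phi>
  proof (rule bcontfun_eqI)
    fix u
    have "\<Gamma> u (u - r) (\<Gamma> (u - r) (u - r - s) (apply_bcontfun \<phi> (u - r - s))) = \<Gamma> u (u - r - s) (apply_bcontfun \<phi> (u - r - s))"
      using that by (intro Gamma_cocycle AP_D(1)[OF that(3)]) auto
    then show "apply_bcontfun (evolution_semigroup \<Gamma> (r + s) \<phi>) u =
        apply_bcontfun (evolution_semigroup \<Gamma> r (evolution_semigroup \<Gamma> s \<phi>)) u"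
      using that by (simp add: evolution_semigroup_apply evolution_semigroup_AP diff_diff_eq)
  qed
  obtain M' w' where "1 \<le> M'" "exp_bound X0 \<Gamma> M' w'" by (rule exp_bound_exists)
  then show "\<exists>M w. \<forall>r\<ge>0. \<forall>\<phi>\<in>AP X0. norm (evolution_semigroup \<Gamma> r \<phi>) \<le> M * exp (w * r) * norm \<phi>"
    using evolution_semigroup_bound by blast
  show "((\<lambda>h. evolution_semigroup \<Gamma> h \<phi>) \<longlongrightarrow> \<phi>) (at_right 0)" if "\<phi> \<in> AP X0" for \<phi>
    using evolution_semigroup_at_0[OF that] .
qed

lemma S_growth: "1 \<le> M' \<Longrightarrow> exp_bound X0 \<Gamma> M' w' \<Longrightarrow> S.growth M' w'"
  unfolding S.growth_def using evolution_semigroup_bound by auto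

section \<open>Yosida approximation of almost periodic functions by ones with values in
  \<open>X0\<close>\<close>

definition yosida :: "real \<Rightarrow> (real \<Rightarrow>\<^sub>C 'a) \<Rightarrow> (real \<Rightarrow>\<^sub>C 'a)" where
  "yosida mu \<phi> = Bcontfun (\<lambda>s. mu *\<^sub>R R mu (apply_bcontfun \<phi> s))"

lemma
  assumes "w < mu" "\<phi> \<in> AP UNIV"
  shows yosida_AP: "yosida mu \<phi> \<in> AP X0"
    and yosida_apply: "apply_bcontfun (yosida mu \<phi>) s = mu *\<^sub>R R mu (apply_bcontfun \<phi> s)"
  using AP_compose[OF bounded_linear_compose[OF bounded_linear_scaleR_right[of mu] R_bounded_linear[OF assms(1)]]
      assms(2) X0_closed(3)[OF R_X0[OF assms(1)]]]
  by (auto simp: yosida_def)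

lemma AP_UNIV_closed:
  fixes \<phi> \<psi> :: "real \<Rightarrow>\<^sub>C 'a"
  shows "\<phi> \<in> AP UNIV \<Longrightarrow> \<psi> \<in> AP UNIV \<Longrightarrow> \<phi> - \<psi> \<in> AP UNIV"
    "\<phi> \<in> AP UNIV \<Longrightarrow> \<psi> \<in> AP UNIV \<Longrightarrow> \<phi> + \<psi> \<in> AP UNIV"
    "\<phi> \<in> AP UNIV \<Longrightarrow> c *\<^sub>R \<phi> \<in> AP UNIV"
  using subspace_AP[OF subspace_UNIV] by (auto intro: subspace_diff subspace_add subspace_scale)

lemma yosida_linear:
  assumes "w < mu"
  shows "\<phi> \<in> AP UNIV \<Longrightarrow> \<psi> \<in> AP UNIV \<Longrightarrow> yosida mu (\<phi> + \<psi>) = yosida mu \<phi> + yosida mu \<psi>"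
    "\<phi> \<in> AP UNIV \<Longrightarrow> \<psi> \<in> AP UNIV \<Longrightarrow> yosida mu (\<phi> - \<psi>) = yosida mu \<phi> - yosida mu \<psi>"
    "\<phi> \<in> AP UNIV \<Longrightarrow> yosida mu (c *\<^sub>R \<phi>) = c *\<^sub>R yosida mu \<phi>"
  using assms
  by (auto intro!: bcontfun_eqI simp: yosida_apply AP_UNIV_closed R_add R_diff R_scaleR scaleR_add_right scaleR_diff_right)

text \<open>This coefficient tends to \<open>M\<close>, which yields the constant of the power
  bounds; \<open>yosida_norm2\<close> is cruder but uniform in \<open>mu\<close> and serves the
  Cauchy argument.\<close>

lemma yosida_norm:
  assumes "w < mu" "0 \<le> mu" "\<phi> \<in> AP UNIV"
  shows "norm (yosida mu \<phi>) \<le> mu * M / (mu - w) * norm \<phi>"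
proof (rule norm_bound)
  fix s
  have "norm (mu *\<^sub>R R mu (apply_bcontfun \<phi> s)) \<le> mu * (M / (mu - w) * norm (apply_bcontfun \<phi> s))"
    using mult_left_mono[OF R_bound[OF assms(1)] assms(2)] assms(2) by simp
  also have "\<dots> \<le> mu * (M / (mu - w) * norm \<phi>)"
    using assms M_ge_1 by (intro mult_left_mono norm_bounded) auto
  finally show "norm (apply_bcontfun (yosida mu \<phi>) s) \<le> mu * M / (mu - w) * norm \<phi>"
    using assms by (simp add: yosida_apply)
qed

lemma yosida_norm2:
  assumes "2 * \<bar>w\<bar> + 1 \<le> mu" "\<phi> \<in> AP UNIV"
  shows "norm (yosida mu \<phi>) \<le> 2 * M * norm \<phi>"
proof (rule norm_bound)
  fix s
  have "w < mu" using assms by linarith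
  then show "norm (apply_bcontfun (yosida mu \<phi>) s) \<le> 2 * M * norm \<phi>"
    using order_trans[OF yosida_bound[OF assms(1)] mult_left_mono[OF norm_bounded[of \<phi> s], of "2 * M"]]
      M_ge_1 assms(2) by (simp add: yosida_apply)
qed

text \<open>Convergence at the finitely many points of a net in \<open>D\<close>, together with the
  bound \<open>2 * M\<close> uniform in \<open>mu\<close>, gives convergence uniform in the argument
  of \<open>\<phi>\<close>.\<close>

lemma yosida_AP_tendsto:
  assumes \<phi>: "\<phi> \<in> AP X0"
  shows "((\<lambda>mu. yosida mu \<phi>) \<longlongrightarrow> \<phi>) at_top"
proof (rule tendstoI)
  fix e :: real assume e: "e > 0"
  have \<phi>U: "\<phi> \<in> AP UNIV" using \<phi> AP_mono[of X0 UNIV] by blast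
  define d where "d = e / (4 * (2 * M + 1))"
  have d: "d > 0" "(2 * M + 1) * d = e / 4" using e M_ge_1 by (auto simp: d_def field_simps)
  obtain F where F: "finite F" "F \<subseteq> D" "\<And>t. \<exists>x\<in>F. norm (apply_bcontfun \<phi> t - x) < d"
    using AP_net_in_D[OF \<phi> d(1)] by blast
  have "\<forall>\<^sub>F mu in at_top. \<forall>x\<in>F. norm (mu *\<^sub>R R mu x - x) < e / 4"
  proof (rule eventually_ball_finite[OF F(1)], rule ballI)
    fix x assume "x \<in> F"
    then have "x \<in> D" using F(2) by blast
    from tendstoD[OF yosida_tendsto_on_D[OF this], of "e/4"] e
    show "\<forall>\<^sub>F mu in at_top. norm (mu *\<^sub>R R mu x - x) < e / 4" by (simp add: dist_norm)
  qed
  then show "\<forall>\<^sub>F mu in at_top. dist (yosida mu \<phi>) \<phi> < e"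
    using eventually_ge_at_top[of "2 * \<bar>w\<bar> + 1"]
  proof eventually_elim
    case (elim mu)
    have mu: "w < mu" using elim(2) by linarith
    have "norm (apply_bcontfun (yosida mu \<phi> - \<phi>) s) \<le> e / 2" for s
    proof -
      let ?y = "apply_bcontfun \<phi> s"
      obtain x where x: "x \<in> F" "norm (?y - x) < d" using F(3) by blast
      have eq: "mu *\<^sub>R R mu ?y - ?y = mu *\<^sub>R R mu (?y - x) + (mu *\<^sub>R R mu x - x) + (x - ?y)"
        by (simp add: R_diff[OF mu] scaleR_diff_right)
      have 1: "norm (mu *\<^sub>R R mu (?y - x)) \<le> 2 * M * d"
        using yosida_bound[OF elim(2), of "?y - x"] mult_left_mono[of "norm (?y - x)" d "2 * M"] x(2) M_ge_1 by linarith
      have "norm (mu *\<^sub>R R mu ?y - ?y) \<le> (2 * M * d + e / 4) + d"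
        unfolding eq using elim(1) x
        by (intro norm_triangle_mono 1) (auto simp: norm_minus_commute less_imp_le)
      also have "\<dots> = (2 * M + 1) * d + e / 4" by (simp add: algebra_simps)
      finally show ?thesis using d(2) by (simp add: yosida_apply[OF mu \<phi>U])
    qed
    then have "norm (yosida mu \<phi> - \<phi>) \<le> e / 2" by (rule norm_bound)
    then show ?case using e by (simp add: dist_norm)
  qed
qed

text \<open>Substitute \<open>s = t - r\<close>. The weight is normalised to 1 at the starting time
  \<open>t - q\<close>; on the window it is then bounded independently of \<open>t\<close> and can
  be merged into the forcing.\<close>

lemma truncated_laplace_apply:
  assumes \<phi>: "\<phi> \<in> AP X0" and q: "0 \<le> q"
  shows "apply_bcontfun (integral {0..q} (\<lambda>r. exp (- lam * r) *\<^sub>R evolution_semigroup \<Gamma> r \<phi>)) t =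
    exp (- lam * q) *\<^sub>R duhamel (t - q) (\<lambda>s. exp (lam * (s - (t - q))) *\<^sub>R apply_bcontfun \<phi> s) t"
proof -
  have \<phi>X: "apply_bcontfun \<phi> s \<in> X0" for s using AP_D(1)[OF \<phi>] .
  let ?f = "\<lambda>r. exp (- lam * r) *\<^sub>R \<Gamma> t (t - r) (apply_bcontfun \<phi> (t - r))"
  have "continuous_on {0..q} (\<lambda>r. exp (- lam * r) *\<^sub>R evolution_semigroup \<Gamma> r \<phi>)"
    using continuous_on_subset[OF S.T_continuous[OF \<phi>]] by (intro continuous_intros) auto
  from integral_linear[OF integrable_continuous_real[OF this] bounded_linear_apply_bcontfun[of t]]
  have "apply_bcontfun (integral {0..q} (\<lambda>r. exp (- lam * r) *\<^sub>R evolution_semigroup \<Gamma> r \<phi>)) t =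
      integral {0..q} (\<lambda>r. exp (- lam * r) *\<^sub>R apply_bcontfun (evolution_semigroup \<Gamma> r \<phi>) t)"
    by (simp add: o_def)
  also have "\<dots> = integral {0..q} ?f"
    by (intro integral_cong) (simp add: evolution_semigroup_apply[OF \<phi>])
  also have "\<dots> = integral {t - q..t} (\<lambda>s. ?f (t - s))"
  proof -
    have "continuous_on {0..q} ?f"
      by (intro continuous_intros Gamma_continuous continuous_on_compose2[OF continuous_on_apply_bcontfun[of UNIV]])
        (auto simp: \<phi>X)
    then show ?thesis using integral_reflect_shift[of t t "t - q" ?f] by simp
  qed
  also have "\<dots> = integral {t - q..t} (\<lambda>s. exp (- lam * q) *\<^sub>R \<Gamma> t s (exp (lam * (s - (t - q))) *\<^sub>R apply_bcontfun \<phi> s))"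
  proof (rule integral_cong)
    fix s assume s: "s \<in> {t - q..t}"
    have "exp (- lam * (t - s)) = exp (- lam * q) * exp (lam * (s - (t - q)))"
      by (simp add: algebra_simps flip: exp_add)
    then show "?f (t - s) = exp (- lam * q) *\<^sub>R \<Gamma> t s (exp (lam * (s - (t - q))) *\<^sub>R apply_bcontfun \<phi> s)"
      using s linear_on_subspaceD(3)[OF Gamma_linear \<phi>X] by simp
  qed
  finally show ?thesis by (simp add: duhamel_def)
qed

lemma laplace_has_integral_apply:
  assumes Mw: "1 \<le> M'" "exp_bound X0 \<Gamma> M' w'" and lam: "w' < lam" and \<phi>: "\<phi> \<in> AP X0"
  shows "((\<lambda>s. exp (- lam * (t - s)) *\<^sub>R \<Gamma> t s (apply_bcontfun \<phi> s)) has_integral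
    apply_bcontfun (S.laplace lam \<phi>) t) {..t}"
proof -
  note gr = S_growth[OF Mw]
  let ?f = "\<lambda>r. apply_bcontfun (exp (- lam * r) *\<^sub>R evolution_semigroup \<Gamma> r \<phi>) t"
  have c: "continuous_on {0..} ?f"
    using bounded_linear.continuous_on[OF bounded_linear_apply_bcontfun S.laplace_integrand(1)[OF gr lam \<phi>]] .
  have b: "norm (?f r) \<le> M' * norm \<phi> * exp (- (lam - w') * r)" if "0 \<le> r" for r
    using order_trans[OF norm_bounded S.laplace_integrand(2)[OF gr lam \<phi> that]] .
  have pos: "0 < lam - w'" using lam by simp
  have "((\<lambda>s. ?f (t - s)) has_integral integral {0..} ?f) {..t}"
    by (rule exp_decay_integrals(4)[OF c b pos])
  moreover have "integral {0..} ?f = apply_bcontfun (S.laplace lam \<phi>) t"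
    using has_integral_linear[OF S.laplace_has_integral[OF gr lam \<phi>] bounded_linear_apply_bcontfun[of t]]
    by (intro integral_unique) (simp only: o_def)
  ultimately have "((\<lambda>s. ?f (t - s)) has_integral apply_bcontfun (S.laplace lam \<phi>) t) {..t}" by simp
  then show ?thesis
    by (rule has_integral_eq[rotated]) (simp add: evolution_semigroup_apply[OF \<phi>])
qed

end

section \<open>The operators \<open>L\<close> on almost periodic functions\<close>

context evolution_problem
begin

text \<open>The limit is taken in the supremum norm; that it exists is \<open>L_AP_tendsto\<close>.
  No growth constants occur here, so all admissible pairs lead to the same operator.\<close>

definition L_AP :: "real \<Rightarrow> (real \<Rightarrow>\<^sub>C 'a) \<Rightarrow> (real \<Rightarrow>\<^sub>C 'a)" where
  "L_AP lam \<phi> = Lim at_top (\<lambda>mu. S.laplace lam (yosida mu \<phi>))"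

text \<open>Solve \<open>duhamel_mild\<close> for the integral of \<open>g\<close>: a small solution
  forces a small integrated forcing, after \<open>R kap\<close>. The condition
  \<open>t \<le> a + 1\<close> lets interval lengths be estimated by 1.\<close>

lemma duhamel_controls_forcing:
  assumes kap: "w < kap" and t: "a \<le> t" "t \<le> a + 1"
    and v: "0 < v" "\<And>t x. x \<in> X0 \<Longrightarrow> norm (V t x) \<le> v * norm x"
    and g: "continuous_on UNIV g" and gX: "\<And>s. g s \<in> X0"
    and W: "\<And>s. s \<in> {a..t} \<Longrightarrow> norm (duhamel a g s) \<le> e"
  shows "norm (R kap (integral {a..t} g)) \<le> (1 + M / (kap - w) * (\<bar>kap\<bar> + 1 + v)) * e"
proof -
  let ?W = "duhamel a g"
  have e: "0 \<le> e" using order_trans[OF norm_ge_zero W[of a]] t by simp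
  have cW: "continuous_on {a..t} ?W" by (rule duhamel_continuous[OF g gX])
  have cV: "continuous_on {a..t} (\<lambda>r. V r (?W r))"
    by (intro V_continuous cW continuous_intros duhamel_X0[OF g gX])
  have 1: "norm (integral {a..t} ?W) \<le> e"
  proof -
    have "norm (integral {a..t} ?W) \<le> e * (t - a)" using t by (intro integral_bound cW W) auto
    also have "\<dots> \<le> e * 1" using t e by (intro mult_left_mono) auto
    finally show ?thesis by simp
  qed
  have 2: "norm (integral {a..t} (\<lambda>r. V r (?W r))) \<le> v * e"
  proof -
    have "norm (V r (?W r)) \<le> v * e" if "r \<in> {a..t}" for r
      using order_trans[OF v(2)[OF duhamel_X0[OF g gX]] mult_left_mono[OF W[OF that]]] v(1) by simp
    then have "norm (integral {a..t} (\<lambda>r. V r (?W r))) \<le> v * e * (t - a)"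
      using t by (intro integral_bound cV) auto
    also have "\<dots> \<le> v * e * 1" using t e v(1) by (intro mult_left_mono) auto
    finally show ?thesis by simp
  qed
  have 3: "norm (kap *\<^sub>R integral {a..t} ?W) \<le> \<bar>kap\<bar> * e"
    unfolding norm_scaleR by (rule mult_left_mono[OF 1 abs_ge_zero])
  have 4: "norm (?W t) \<le> e" by (rule W) (use t in simp)
  define z where "z = kap *\<^sub>R integral {a..t} ?W - ?W t - integral {a..t} (\<lambda>r. V r (?W r))"
  have "norm z \<le> \<bar>kap\<bar> * e + e + v * e"
    unfolding z_def
    by (rule order_trans[OF norm_triangle_ineq4 add_mono[OF order_trans[OF norm_triangle_ineq4 add_mono[OF 3 4]] 2]])
  then have z: "norm z \<le> (\<bar>kap\<bar> + 1 + v) * e" by (simp add: algebra_simps)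
  have "integral {a..t} ?W = R kap z + R kap (integral {a..t} g)"
    unfolding R_add[OF kap, symmetric] z_def by (rule duhamel_mild[OF g gX kap t(1)])
  then have "R kap (integral {a..t} g) = integral {a..t} ?W - R kap z" by (simp only: add_diff_cancel_left')
  also have "norm \<dots> \<le> e + M / (kap - w) * norm z"
    by (rule order_trans[OF norm_triangle_ineq4 add_mono[OF 1 R_bound[OF kap]]])
  also have "\<dots> \<le> e + M / (kap - w) * ((\<bar>kap\<bar> + 1 + v) * e)"
    using z M_ge_1 kap by (intro add_left_mono mult_left_mono) auto
  also have "\<dots> = (1 + M / (kap - w) * (\<bar>kap\<bar> + 1 + v)) * e"
    by (simp only: distrib_right mult_1_left mult.assoc)
  finally show ?thesis .
qed

section \<open>The limit operators for a fixed exponential bound below \<open>lam\<close>\<close>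

context
  fixes M' w' lam assumes M': "1 \<le> M'" and bd: "exp_bound X0 \<Gamma> M' w'" and lam: "w' < lam"
begin

lemmas laplace_closed = S.laplace_Z[OF S_growth[OF M' bd] lam]
  and laplace_lin = linear_on_subspaceD[OF S.laplace_linear[OF S_growth[OF M' bd] lam]]
  and laplace_tendsto = bounded_linear_on_tendsto[OF S.laplace_bounded_linear[OF S_growth[OF M' bd] lam]]
  and laplace_norm = S.laplace_bound[OF S_growth[OF M' bd] lam]

text \<open>Over the window \<open>[0,T0]\<close> the truncated integral is a Duhamel integral of
  Yosida differences of a differentiable function, so \<open>duhamel_yosida_difference\<close>
  applies uniformly in \<open>t\<close>; \<open>laplace_le_truncated\<close> then passes to the full
  integral.\<close>

lemma laplace_yosida_smooth:
  assumes \<phi>: "\<phi> \<in> AP UNIV" and d\<phi>: "\<And>t. (apply_bcontfun \<phi> has_vector_derivative \<phi>' t) (at t)"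
    and c\<phi>': "continuous_on UNIV \<phi>'" and K': "\<And>t. norm (\<phi>' t) \<le> K'"
  obtains C where "0 \<le> C" "\<And>mu nu. w < mu \<Longrightarrow> w < nu \<Longrightarrow>
    norm (S.laplace lam (yosida mu \<phi>) - S.laplace lam (yosida nu \<phi>)) \<le> C * (1 / (mu - w) + 1 / (nu - w))"
proof -
  obtain T0 C0 where T0: "0 < T0" "0 \<le> C0" and
    est: "\<forall>a b \<phi> \<phi>' K mu nu. a \<le> b \<longrightarrow> b - a \<le> T0 \<longrightarrow>
      (\<forall>t. (\<phi> has_vector_derivative \<phi>' t) (at t)) \<longrightarrow> continuous_on UNIV \<phi>' \<longrightarrow>
      (\<forall>t\<in>{a..b}. norm (\<phi> t) \<le> K \<and> norm (\<phi>' t) \<le> K) \<longrightarrow> w < mu \<longrightarrow> w < nu \<longrightarrow>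
      norm (duhamel a (\<lambda>s. mu *\<^sub>R R mu (\<phi> s) - nu *\<^sub>R R nu (\<phi> s)) b) \<le> C0 * (1 / (mu - w) + 1 / (nu - w)) * K"
    using duhamel_yosida_difference by (elim exE conjE) (rule that)
  define E where "E = exp (\<bar>lam\<bar> * T0)"
  have E: "0 < E" by (simp add: E_def)
  \<comment> \<open>Bounds the weighted function and its derivative on a window: \<open>E\<close>
    comes from the weight, \<open>\<bar>lam\<bar>\<close> from differentiating it.\<close>
  define K where "K = E * ((\<bar>lam\<bar> + 1) * norm \<phi> + K')"
  have K'0: "0 \<le> K'" using order_trans[OF norm_ge_zero K'] .
  have K0: "0 \<le> K" using E K'0 by (auto simp: K_def)
  define G where "G = M' / (1 - exp (- (lam - w') * T0))"
  have "exp (- (lam - w') * T0) \<le> 1" using mult_pos_pos[of "lam - w'" T0] lam T0(1) by (simp add: algebra_simps)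
  then have G0: "0 \<le> G" using M' by (auto simp: G_def)
  show ?thesis
  proof (rule that[of "G * (E * (C0 * K))"])
    show "0 \<le> G * (E * (C0 * K))" using G0 E T0(2) K0 by auto
    fix mu nu assume mu: "w < mu" and nu: "w < nu"
    define g where "g = yosida mu \<phi> - yosida nu \<phi>"
    have yAP: "yosida mu \<phi> \<in> AP X0" "yosida nu \<phi> \<in> AP X0" using yosida_AP mu nu \<phi> by auto
    have g: "g \<in> AP X0" unfolding g_def by (rule subspace_diff[OF S.subspace_Z yAP])
    have "norm (integral {0..T0} (\<lambda>r. exp (- lam * r) *\<^sub>R evolution_semigroup \<Gamma> r g)) \<le>
        E * (C0 * (1 / (mu - w) + 1 / (nu - w)) * K)"
    proof (rule norm_bound)
      fix t
      define a where "a = t - T0"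
      define \<psi> where "\<psi> s = exp (lam * (s - a)) *\<^sub>R apply_bcontfun \<phi> s" for s
      define \<psi>' where "\<psi>' s = exp (lam * (s - a)) *\<^sub>R \<phi>' s + (lam * exp (lam * (s - a))) *\<^sub>R apply_bcontfun \<phi> s" for s
      have d\<psi>: "(\<psi> has_vector_derivative \<psi>' s) (at s)" for s
        unfolding \<psi>_def \<psi>'_def
        by (intro has_vector_derivative_scaleR d\<phi>) (auto intro!: derivative_eq_intros)
      have c\<psi>': "continuous_on UNIV \<psi>'"
        unfolding \<psi>'_def by (intro continuous_intros c\<phi>' continuous_on_apply_bcontfun)
      have ex: "exp (lam * (s - a)) \<le> E" if "s \<in> {a..t}" for s
      proof -
        have "lam * (s - a) \<le> \<bar>lam\<bar> * (s - a)" using that by (intro mult_right_mono) auto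
        also have "\<dots> \<le> \<bar>lam\<bar> * T0" using that by (intro mult_left_mono) (auto simp: a_def)
        finally show ?thesis by (simp add: E_def)
      qed
      have bnd: "norm (\<psi> s) \<le> K" "norm (\<psi>' s) \<le> K" if s: "s \<in> {a..t}" for s
      proof -
        have 0: "norm (\<psi> s) \<le> E * norm \<phi>"
          unfolding \<psi>_def using mult_mono[OF ex[OF s] norm_bounded[of \<phi> s]] E by simp
        also have "\<dots> \<le> K"
          unfolding K_def using E K'0 by (intro mult_left_mono) (auto simp: algebra_simps)
        finally show "norm (\<psi> s) \<le> K" .
        have 1: "norm (exp (lam * (s - a)) *\<^sub>R \<phi>' s) \<le> E * K'"
          using mult_mono[OF ex[OF s] K'[of s]] E by simp
        have 2: "norm ((lam * exp (lam * (s - a))) *\<^sub>R apply_bcontfun \<phi> s) \<le> \<bar>lam\<bar> * (E * norm \<phi>)"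
        proof -
          have "norm ((lam * exp (lam * (s - a))) *\<^sub>R apply_bcontfun \<phi> s) = \<bar>lam\<bar> * norm (\<psi> s)"
            by (simp add: \<psi>_def abs_mult)
          also have "\<dots> \<le> \<bar>lam\<bar> * (E * norm \<phi>)" by (intro mult_left_mono 0) auto
          finally show ?thesis .
        qed
        have "norm (\<psi>' s) \<le> E * K' + \<bar>lam\<bar> * (E * norm \<phi>)"
          unfolding \<psi>'_def by (intro norm_triangle_mono 1 2)
        also have "\<dots> \<le> K" using E by (simp add: K_def algebra_simps)
        finally show "norm (\<psi>' s) \<le> K" .
      qed
      \<comment> \<open>The weight is scalar and commutes with \<open>R mu\<close>, so the weighted
        difference is again a difference of Yosida approximations, now of
        \<open>\<psi>\<close>.\<close>
      have "(\<lambda>s. exp (lam * (s - a)) *\<^sub>R apply_bcontfun g s) = (\<lambda>s. mu *\<^sub>R R mu (\<psi> s) - nu *\<^sub>R R nu (\<psi> s))"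
        by (simp add: g_def \<psi>_def yosida_apply mu nu \<phi> R_scaleR scaleR_diff_right mult.commute fun_eq_iff)
      then have "norm (duhamel a (\<lambda>s. exp (lam * (s - a)) *\<^sub>R apply_bcontfun g s) t) \<le> C0 * (1 / (mu - w) + 1 / (nu - w)) * K"
        using est[rule_format, OF _ _ d\<psi> c\<psi>' conjI[OF bnd] mu nu, of a t] T0(1) by (simp add: a_def)
      moreover have "exp (- lam * T0) \<le> E"
        using T0(1) mult_right_mono[of "- lam" "\<bar>lam\<bar>" T0] by (simp add: E_def)
      ultimately have "exp (- lam * T0) * norm (duhamel a (\<lambda>s. exp (lam * (s - a)) *\<^sub>R apply_bcontfun g s) t) \<le>
          E * (C0 * (1 / (mu - w) + 1 / (nu - w)) * K)"
        using E by (intro mult_mono) auto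
      then show "norm (apply_bcontfun (integral {0..T0} (\<lambda>r. exp (- lam * r) *\<^sub>R evolution_semigroup \<Gamma> r g)) t) \<le>
          E * (C0 * (1 / (mu - w) + 1 / (nu - w)) * K)"
        using truncated_laplace_apply[OF g, of T0 lam t] T0(1) by (simp add: a_def)
    qed
    then have "G * norm (integral {0..T0} (\<lambda>r. exp (- lam * r) *\<^sub>R evolution_semigroup \<Gamma> r g)) \<le>
        G * (E * (C0 * (1 / (mu - w) + 1 / (nu - w)) * K))"
      by (intro mult_left_mono G0)
    moreover have "norm (S.laplace lam g) \<le> G * norm (integral {0..T0} (\<lambda>r. exp (- lam * r) *\<^sub>R evolution_semigroup \<Gamma> r g))"
      unfolding G_def by (rule S.laplace_le_truncated[OF S_growth[OF M' bd] lam T0(1) g])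
    moreover have "S.laplace lam g = S.laplace lam (yosida mu \<phi>) - S.laplace lam (yosida nu \<phi>)"
      unfolding g_def by (rule laplace_lin(4)[OF yAP])
    ultimately show "norm (S.laplace lam (yosida mu \<phi>) - S.laplace lam (yosida nu \<phi>)) \<le>
        G * (E * (C0 * K)) * (1 / (mu - w) + 1 / (nu - w))"
      by (simp add: mult_ac)
  qed
qed

text \<open>A forward average of \<open>\<phi>\<close> gives a Cauchy family by
  \<open>laplace_yosida_smooth\<close>, and it is uniformly close to \<open>\<phi>\<close>, which is
  uniformly continuous. The operators involved are bounded uniformly in large \<open>mu\<close>, so
  the Cauchy property carries over.\<close>

lemma L_AP_tendsto:
  assumes \<phi>: "\<phi> \<in> AP UNIV"
  shows "((\<lambda>mu. S.laplace lam (yosida mu \<phi>)) \<longlongrightarrow> L_AP lam \<phi>) at_top"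
proof -
  have "\<exists>l. ((\<lambda>mu. S.laplace lam (yosida mu \<phi>)) \<longlongrightarrow> l) at_top"
  proof (rule real_at_top_cauchy)
    fix e :: real assume e: "e > 0"
    \<comment> \<open>A bound for \<open>laplace lam\<close> composed with \<open>yosida mu\<close>,
      valid for all \<open>mu\<close> from \<open>2 * \<bar>w\<bar> + 1\<close> on.\<close>
    define G where "G = M' / (lam - w') * (2 * M)"
    have G: "0 < G" using M' lam M_ge_1 by (simp add: G_def)
    obtain d where d: "d > 0"
      "\<And>s t. \<bar>s - t\<bar> < d \<Longrightarrow> dist (apply_bcontfun \<phi> s) (apply_bcontfun \<phi> t) < e / (8 * G)"
      using AP_uniformly_continuous[OF \<phi>, of "e / (8 * G)"] e G by auto
    define \<delta> where "\<delta> = d / 2"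
    have \<delta>: "0 < \<delta>" "\<delta> < d" using d(1) by (auto simp: \<delta>_def)
    define \<psi> where "\<psi> = Bcontfun (forward_average \<delta> (apply_bcontfun \<phi>))"
    have \<psi>: "\<psi> \<in> AP UNIV" and \<psi>_apply: "apply_bcontfun \<psi> = forward_average \<delta> (apply_bcontfun \<phi>)"
      unfolding \<psi>_def using AP_forward_average[OF \<phi> \<delta>(1)] by auto
    have near: "norm (\<phi> - \<psi>) \<le> e / (8 * G)"
    proof (rule norm_bound)
      fix t
      have "norm (forward_average \<delta> (apply_bcontfun \<phi>) t - apply_bcontfun \<phi> t) \<le> e / (8 * G)"
        using \<delta> d(2)[of _ t]
        by (intro forward_average_near continuous_on_apply_bcontfun) (auto simp: dist_norm intro!: less_imp_le)
      then show "norm (apply_bcontfun (\<phi> - \<psi>) t) \<le> e / (8 * G)" by (simp add: \<psi>_apply norm_minus_commute)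
    qed
    let ?\<psi>' = "\<lambda>t. (apply_bcontfun \<phi> (t + \<delta>) - apply_bcontfun \<phi> t) /\<^sub>R \<delta>"
    have "norm (?\<psi>' t) \<le> 2 * norm \<phi> / \<delta>" for t
    proof -
      have "norm (apply_bcontfun \<phi> (t + \<delta>) - apply_bcontfun \<phi> t) \<le> 2 * norm \<phi>"
        using norm_triangle_ineq4[of "apply_bcontfun \<phi> (t + \<delta>)" "apply_bcontfun \<phi> t"]
          norm_bounded[of \<phi> t] norm_bounded[of \<phi> "t + \<delta>"] by linarith
      from mult_right_mono[OF this, of "inverse \<delta>"] show ?thesis
        using \<delta>(1) by (simp add: divide_inverse mult.commute)
    qed
    moreover have "(apply_bcontfun \<psi> has_vector_derivative ?\<psi>' t) (at t)" for t
      unfolding \<psi>_apply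
      by (rule forward_average_has_vector_derivative[where a = "t - 1" and b = "t + \<delta> + 1"]) (use \<delta> in auto)
    moreover have "continuous_on UNIV ?\<psi>'"
      by (intro continuous_intros continuous_on_apply_bcontfun continuous_on_compose2[OF continuous_on_apply_bcontfun[of UNIV]]) auto
    ultimately obtain C where C: "0 \<le> C" "\<And>mu nu. w < mu \<Longrightarrow> w < nu \<Longrightarrow>
        norm (S.laplace lam (yosida mu \<psi>) - S.laplace lam (yosida nu \<psi>)) \<le> C * (1 / (mu - w) + 1 / (nu - w))"
      using laplace_yosida_smooth[OF \<psi>, of ?\<psi>' "2 * norm \<phi> / \<delta>"] by blast
    have approx: "norm (S.laplace lam (yosida mu \<phi>) - S.laplace lam (yosida mu \<psi>)) \<le> e / 8"
      if mu: "2 * \<bar>w\<bar> + 1 \<le> mu" for mu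
    proof -
      have wmu: "w < mu" using mu by linarith
      have "S.laplace lam (yosida mu \<phi>) - S.laplace lam (yosida mu \<psi>) = S.laplace lam (yosida mu (\<phi> - \<psi>))"
        by (simp add: yosida_linear(2)[OF wmu \<phi> \<psi>] laplace_lin(4) yosida_AP wmu \<phi> \<psi>)
      also have "norm \<dots> \<le> M' / (lam - w') * norm (yosida mu (\<phi> - \<psi>))"
        by (intro laplace_norm yosida_AP wmu AP_UNIV_closed \<phi> \<psi>)
      also have "\<dots> \<le> M' / (lam - w') * (2 * M * norm (\<phi> - \<psi>))"
        using M' lam by (intro mult_left_mono yosida_norm2 mu AP_UNIV_closed \<phi> \<psi>) auto
      also have "\<dots> = G * norm (\<phi> - \<psi>)" by (simp add: G_def)
      also have "\<dots> \<le> G * (e / (8 * G))" using near G by (intro mult_left_mono) auto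
      finally show ?thesis using G by simp
    qed
    \<comment> \<open>From \<open>N\<close> on each of the two terms of the smooth estimate is at
      most \<open>e / 4\<close>; with \<open>e / 8\<close> twice for smoothing, the total is
      \<open>3 * e / 4\<close>.\<close>
    define N where "N = max (2 * \<bar>w\<bar> + 1) (w + 1 + 4 * C / e)"
    have "dist (S.laplace lam (yosida mu \<phi>)) (S.laplace lam (yosida nu \<phi>)) < e" if "N \<le> mu" "N \<le> nu" for mu nu
    proof -
      have inv: "C * (1 / (x - w)) \<le> e / 4" "w < x" "2 * \<bar>w\<bar> + 1 \<le> x" if "N \<le> x" for x
      proof -
        have "4 * C / e < x - w" "0 < x - w"
          using that C(1) e divide_nonneg_pos[of "4 * C" e] by (auto simp: N_def)
        then show "C * (1 / (x - w)) \<le> e / 4" using e by (simp add: field_simps)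
        show "w < x" "2 * \<bar>w\<bar> + 1 \<le> x" using \<open>0 < x - w\<close> that by (auto simp: N_def)
      qed
      let ?a = "\<lambda>mu. S.laplace lam (yosida mu \<phi>)" and ?b = "\<lambda>mu. S.laplace lam (yosida mu \<psi>)"
      have eq: "?a mu - ?a nu = (?a mu - ?b mu) + (?b mu - ?b nu) + (?b nu - ?a nu)" by simp
      have "norm (?b mu - ?b nu) \<le> e / 4 + e / 4"
        using C(2)[OF inv(2)[OF that(1)] inv(2)[OF that(2)]] inv(1)[OF that(1)] inv(1)[OF that(2)]
        unfolding distrib_left by linarith
      then have "norm (?a mu - ?a nu) \<le> (e / 8 + (e / 4 + e / 4)) + e / 8"
        unfolding eq using approx[OF inv(3)[OF that(1)]] approx[OF inv(3)[OF that(2)]]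
        by (intro norm_triangle_mono) (auto simp: norm_minus_commute)
      then show ?thesis using e by (simp add: dist_norm)
    qed
    then show "\<exists>N. \<forall>mu\<ge>N. \<forall>nu\<ge>N. dist (S.laplace lam (yosida mu \<phi>)) (S.laplace lam (yosida nu \<phi>)) < e"
      by blast
  qed
  then show ?thesis unfolding L_AP_def using tendsto_Lim[OF trivial_limit_at_top_linorder] by fastforce
qed

lemma ev_yosida_AP: "\<phi> \<in> AP UNIV \<Longrightarrow> \<forall>\<^sub>F mu in at_top. w < mu \<and> yosida mu \<phi> \<in> AP X0"
  using eventually_gt_at_top[of w] by eventually_elim (auto intro: yosida_AP)

lemma L_AP_AP: assumes \<phi>: "\<phi> \<in> AP UNIV" shows "L_AP lam \<phi> \<in> AP X0"
proof (rule Lim_in_closed_set[OF S.closed_Z _ _ L_AP_tendsto[OF \<phi>]])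
  show "\<forall>\<^sub>F mu in at_top. S.laplace lam (yosida mu \<phi>) \<in> AP X0"
    using ev_yosida_AP[OF \<phi>] by eventually_elim (auto intro: laplace_closed)
qed simp

lemma L_AP_add:
  assumes "\<phi> \<in> AP UNIV" "\<psi> \<in> AP UNIV"
  shows "L_AP lam (\<phi> + \<psi>) = L_AP lam \<phi> + L_AP lam \<psi>"
proof (rule tendsto_unique[OF trivial_limit_at_top_linorder L_AP_tendsto])
  show "\<phi> + \<psi> \<in> AP UNIV" using assms by (rule AP_UNIV_closed)
  have ev: "\<forall>\<^sub>F mu in at_top. S.laplace lam (yosida mu \<phi>) + S.laplace lam (yosida mu \<psi>) =
      S.laplace lam (yosida mu (\<phi> + \<psi>))"
    using eventually_gt_at_top[of w]
    by eventually_elim (simp add: yosida_linear assms laplace_lin(2) yosida_AP)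
  show "((\<lambda>mu. S.laplace lam (yosida mu (\<phi> + \<psi>))) \<longlongrightarrow> L_AP lam \<phi> + L_AP lam \<psi>) at_top"
    by (rule Lim_transform_eventually[OF tendsto_add[OF L_AP_tendsto L_AP_tendsto] ev]) (use assms in auto)
qed

lemma L_AP_scaleR:
  assumes "\<phi> \<in> AP UNIV"
  shows "L_AP lam (c *\<^sub>R \<phi>) = c *\<^sub>R L_AP lam \<phi>"
proof (rule tendsto_unique[OF trivial_limit_at_top_linorder L_AP_tendsto])
  show "c *\<^sub>R \<phi> \<in> AP UNIV" using assms by (rule AP_UNIV_closed)
  have ev: "\<forall>\<^sub>F mu in at_top. c *\<^sub>R S.laplace lam (yosida mu \<phi>) = S.laplace lam (yosida mu (c *\<^sub>R \<phi>))"
    using eventually_gt_at_top[of w]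
    by eventually_elim (simp add: yosida_linear assms laplace_lin(3) yosida_AP)
  show "((\<lambda>mu. S.laplace lam (yosida mu (c *\<^sub>R \<phi>))) \<longlongrightarrow> c *\<^sub>R L_AP lam \<phi>) at_top"
    by (rule Lim_transform_eventually[OF tendsto_scaleR[OF tendsto_const L_AP_tendsto] ev]) (use assms in auto)
qed

lemma yosida_coefficient_tendsto: "((\<lambda>mu. mu * M / (mu - w)) \<longlongrightarrow> M) at_top"
proof -
  have "filterlim (\<lambda>mu. mu - w) at_top at_top"
    using filterlim_tendsto_add_at_top[OF tendsto_const[of "-w"] filterlim_ident] by simp
  then have "((\<lambda>mu. w / (mu - w)) \<longlongrightarrow> 0) at_top"
    by (rule real_tendsto_divide_at_top[OF tendsto_const])
  then have "((\<lambda>mu. M * (1 + w / (mu - w))) \<longlongrightarrow> M * (1 + 0)) at_top" by (intro tendsto_intros)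
  moreover have "\<forall>\<^sub>F mu in at_top. M * (1 + w / (mu - w)) = mu * M / (mu - w)"
    using eventually_gt_at_top[of w] by eventually_elim (simp add: field_simps)
  ultimately show ?thesis using Lim_transform_eventually by fastforce
qed

text \<open>For values in \<open>X0\<close> the Yosida approximations converge to
  \<open>\<psi>\<close> itself, and \<open>laplace lam\<close> is continuous.\<close>

lemma L_AP_eq_laplace:
  assumes \<psi>: "\<psi> \<in> AP X0"
  shows "L_AP lam \<psi> = S.laplace lam \<psi>"
proof (rule tendsto_unique[OF trivial_limit_at_top_linorder L_AP_tendsto])
  show U: "\<psi> \<in> AP UNIV" using \<psi> AP_mono[of X0 UNIV] by blast
  show "((\<lambda>mu. S.laplace lam (yosida mu \<psi>)) \<longlongrightarrow> S.laplace lam \<psi>) at_top"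
    by (rule laplace_tendsto[OF \<psi> eventually_mono[OF ev_yosida_AP[OF U]] yosida_AP_tendsto[OF \<psi>]]) simp
qed

text \<open>After one application the values lie in \<open>X0\<close>, where \<open>L_AP lam\<close>
  is \<open>laplace lam\<close>; the power is thus a limit of \<open>laplace lam ^^ n\<close> at
  Yosida approximations. \<open>M'\<close> enters once through \<open>laplace_power_bound\<close>,
  and \<open>M\<close> once as the limit of the coefficient in \<open>yosida_norm\<close>.\<close>

lemma L_AP_power_bound:
  assumes \<phi>: "\<phi> \<in> AP UNIV" and n: "1 \<le> n"
  shows "norm ((L_AP lam ^^ n) \<phi>) \<le> M' * M / (lam - w') ^ n * norm \<phi>"
proof -
  obtain m where m: "n = Suc m" using n by (cases n) auto
  note powb = S.laplace_power_bound[OF S_growth[OF M' bd] lam]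
  have pow_norm: "norm ((S.laplace lam ^^ k) \<psi>) \<le> M' / (lam - w') ^ k * norm \<psi>"
    and pow_AP: "(S.laplace lam ^^ k) \<psi> \<in> AP X0" if "\<psi> \<in> AP X0" for k \<psi>
    using powb[OF that, of k] by (auto simp: S.T_0 dest: spec[of _ "0::real"])
  have pow_tendsto: "((\<lambda>mu. (S.laplace lam ^^ k) (f mu)) \<longlongrightarrow> (S.laplace lam ^^ k) l) at_top"
    if f: "\<forall>\<^sub>F mu in at_top. f mu \<in> AP X0" "(f \<longlongrightarrow> l) at_top" and l: "l \<in> AP X0"
    for k l and f :: "real \<Rightarrow> real \<Rightarrow>\<^sub>C 'a"
  proof (induction k)
    case (Suc k)
    show ?case
      using laplace_tendsto[OF pow_AP[OF l] eventually_mono[OF f(1) pow_AP] Suc] by simp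
  qed (simp add: f(2))
  have pow_L: "(L_AP lam ^^ k) \<psi> = (S.laplace lam ^^ k) \<psi>" if "\<psi> \<in> AP X0" for k \<psi>
    by (induction k) (use that pow_AP L_AP_eq_laplace in auto)
  have L\<phi>: "L_AP lam \<phi> \<in> AP X0" by (rule L_AP_AP[OF \<phi>])
  let ?l = "\<lambda>mu. S.laplace lam (yosida mu \<phi>)"
  have lim: "((\<lambda>mu. norm ((S.laplace lam ^^ m) (?l mu))) \<longlongrightarrow> norm ((S.laplace lam ^^ m) (L_AP lam \<phi>))) at_top"
    by (intro tendsto_norm pow_tendsto[OF eventually_mono[OF ev_yosida_AP[OF \<phi>]] L_AP_tendsto[OF \<phi>] L\<phi>])
      (auto intro: laplace_closed)
  have "\<forall>\<^sub>F mu in at_top. norm ((S.laplace lam ^^ m) (?l mu)) \<le> M' / (lam - w') ^ n * (mu * M / (mu - w) * norm \<phi>)"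
    using ev_yosida_AP[OF \<phi>] eventually_ge_at_top[of 0]
  proof eventually_elim
    case (elim mu)
    then have y: "yosida mu \<phi> \<in> AP X0" and mu: "w < mu" "0 \<le> mu" by auto
    have "(S.laplace lam ^^ m) (?l mu) = (S.laplace lam ^^ n) (yosida mu \<phi>)"
      by (simp add: m funpow_swap1)
    also have "norm \<dots> \<le> M' / (lam - w') ^ n * norm (yosida mu \<phi>)" by (rule pow_norm[OF y])
    also have "\<dots> \<le> M' / (lam - w') ^ n * (mu * M / (mu - w) * norm \<phi>)"
      using M' lam by (intro mult_left_mono yosida_norm mu \<phi>) auto
    finally show ?case .
  qed
  moreover have "((\<lambda>mu. M' / (lam - w') ^ n * (mu * M / (mu - w) * norm \<phi>)) \<longlongrightarrow> M' / (lam - w') ^ n * (M * norm \<phi>)) at_top"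
    by (intro tendsto_intros yosida_coefficient_tendsto)
  ultimately have "norm ((S.laplace lam ^^ m) (L_AP lam \<phi>)) \<le> M' / (lam - w') ^ n * (M * norm \<phi>)"
    using tendsto_le[OF trivial_limit_at_top_linorder _ lim] by blast
  moreover have "(L_AP lam ^^ n) \<phi> = (S.laplace lam ^^ m) (L_AP lam \<phi>)"
    using pow_L[OF L\<phi>] by (simp add: m funpow_swap1)
  ultimately show ?thesis by simp
qed

lemma L_AP_bounded_linear: "bounded_linear_on (AP UNIV) (L_AP lam)"
  unfolding bounded_linear_on_def linear_on_subspace_def
  using L_AP_power_bound[of _ 1]
  by (auto simp: L_AP_add L_AP_scaleR subspace_AP mult.commute intro!: exI[of _ "M' * M / (lam - w')"])

text \<open>If \<open>L \<phi> = 0\<close>, the Duhamel integrals of the Yosida approximations tend to \<open>0\<close>; passing to the limit in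
  the mild equation leaves \<open>R(\<kappa>)\<close> of the integral of \<open>\<phi>\<close>, up to an exponential weight.\<close>

lemma L_AP_injective:
  assumes \<phi>: "\<phi> \<in> AP UNIV" and zero: "L_AP lam \<phi> = 0"
  shows "\<phi> = 0"
proof (rule bcontfun_eqI)
  fix a
  define kap where "kap = w + 1"
  have kap: "w < kap" by (simp add: kap_def)
  obtain v where v: "0 < v" "\<And>t x. x \<in> X0 \<Longrightarrow> norm (V t x) \<le> v * norm x"
    using V_uniformly_bounded by blast
  define \<psi> where "\<psi> s = exp (lam * (s - a)) *\<^sub>R apply_bcontfun \<phi> s" for s
  have c\<psi>: "continuous_on T \<psi>" for T
    unfolding \<psi>_def by (intro continuous_intros continuous_on_apply_bcontfun)
  let ?l = "\<lambda>mu. S.laplace lam (yosida mu \<phi>)"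
  let ?g = "\<lambda>mu s. exp (lam * (s - a)) *\<^sub>R apply_bcontfun (yosida mu \<phi>) s"
  \<comment> \<open>The Duhamel integral is \<open>exp (lam * q)\<close> times a truncated integral,
    which by \<open>laplace_shift\<close> involves only \<open>?l mu\<close> and its shift by a time
    \<open>q \<le> 1\<close>; the two summands of \<open>B\<close> belong to these.\<close>
  define B where "B = exp \<bar>lam\<bar> + M' * exp \<bar>w'\<bar>"
  have B: "0 \<le> B" using M' by (simp add: B_def add_nonneg_nonneg)
  have W: "norm (duhamel a (?g mu) t) \<le> B * norm (?l mu)" if mu: "w < mu" and t: "t \<in> {a..a + 1}" for mu t
  proof -
    define q where "q = t - a"
    have q: "0 \<le> q" "q \<le> 1" "t - q = a" using t by (auto simp: q_def)
    have y: "yosida mu \<phi> \<in> AP X0" by (rule yosida_AP[OF mu \<phi>])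
    have lZ: "?l mu \<in> AP X0" by (rule laplace_closed[OF y])
    define p where "p = integral {0..q} (\<lambda>r. exp (- lam * r) *\<^sub>R evolution_semigroup \<Gamma> r (yosida mu \<phi>))"
    have "duhamel a (?g mu) t = exp (lam * q) *\<^sub>R apply_bcontfun p t"
      unfolding p_def truncated_laplace_apply[OF y q(1)] q(3) by (simp flip: exp_add)
    also have "p = ?l mu - exp (- lam * q) *\<^sub>R evolution_semigroup \<Gamma> q (?l mu)"
      unfolding p_def using S.laplace_shift[OF S_growth[OF M' bd] lam y q(1)] by (simp add: algebra_simps)
    also have "exp (lam * q) *\<^sub>R apply_bcontfun (?l mu - exp (- lam * q) *\<^sub>R evolution_semigroup \<Gamma> q (?l mu)) t =
        exp (lam * q) *\<^sub>R apply_bcontfun (?l mu) t - apply_bcontfun (evolution_semigroup \<Gamma> q (?l mu)) t"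
      by (simp add: scaleR_diff_right flip: exp_add)
    also have "norm \<dots> \<le> exp (lam * q) * norm (?l mu) + M' * exp (w' * q) * norm (?l mu)"
      using norm_bounded[of "?l mu" t] order_trans[OF norm_bounded evolution_semigroup_bound[OF M' bd q(1) lZ]]
      by (intro order_trans[OF norm_triangle_ineq4] add_mono) auto
    also have "\<dots> \<le> exp \<bar>lam\<bar> * norm (?l mu) + M' * exp \<bar>w'\<bar> * norm (?l mu)"
    proof -
      have ab: "x * q \<le> \<bar>x\<bar>" for x :: real
        using q mult_mono[of x "\<bar>x\<bar>" q 1] by auto
      show ?thesis using M' ab by (intro add_mono mult_right_mono mult_left_mono) auto
    qed
    also have "\<dots> = B * norm (?l mu)" by (simp add: B_def algebra_simps)
    finally show ?thesis .
  qed
  have int0: "integral {a..t} \<psi> = 0" if t: "t \<in> {a..a + 1}" for t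
  proof -
    define x where "x = integral {a..t} \<psi>"
    define Q where "Q = (1 + M / (kap - w) * (\<bar>kap\<bar> + 1 + v)) * B"
    have est: "norm (mu *\<^sub>R R mu (R kap x)) \<le> Q * norm (?l mu)" if mu: "w < mu" for mu
    proof -
      have g: "continuous_on T (?g mu)" for T
        by (intro continuous_intros continuous_on_apply_bcontfun)
      have gX: "?g mu s \<in> X0" for s by (intro X0_closed AP_D(1)[OF yosida_AP[OF mu \<phi>]])
      have "?g mu = (\<lambda>y. mu *\<^sub>R R mu y) \<circ> \<psi>"
        by (simp add: \<psi>_def yosida_apply mu \<phi> R_scaleR fun_eq_iff)
      then have Ig: "integral {a..t} (?g mu) = mu *\<^sub>R R mu x"
        unfolding x_def
        using integral_linear[OF integrable_continuous_real[OF c\<psi>]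
            bounded_linear_compose[OF bounded_linear_scaleR_right R_bounded_linear[OF mu]], of a t mu]
        by simp
      have "norm (R kap (integral {a..t} (?g mu))) \<le> (1 + M / (kap - w) * (\<bar>kap\<bar> + 1 + v)) * (B * norm (?l mu))"
        by (rule duhamel_controls_forcing[OF kap _ _ v g gX W[OF mu]]) (use t in auto)
      then show ?thesis by (simp add: Ig R_scaleR[OF kap] R_commute[OF mu kap] Q_def)
    qed
    have "((\<lambda>mu. Q * norm (?l mu)) \<longlongrightarrow> Q * norm (0 :: real \<Rightarrow>\<^sub>C 'a)) at_top"
      using L_AP_tendsto[OF \<phi>] by (intro tendsto_intros) (simp add: zero)
    then have "((\<lambda>mu. Q * norm (?l mu)) \<longlongrightarrow> 0) at_top" by simp
    moreover have "\<forall>\<^sub>F mu in at_top. norm (mu *\<^sub>R R mu (R kap x)) \<le> Q * norm (?l mu)"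
      using eventually_gt_at_top[of w] by eventually_elim (rule est)
    ultimately have "((\<lambda>mu. mu *\<^sub>R R mu (R kap x)) \<longlongrightarrow> 0) at_top"
      by (rule Lim_null_comparison[rotated])
    \<comment> \<open>\<open>R kap x\<close> lies in \<open>D\<close>, so its Yosida approximations
      also converge to \<open>R kap x\<close> itself.\<close>
    from tendsto_unique[OF _ this yosida_tendsto_on_D[OF R_D(1)[OF kap]]]
    have "R kap x = 0" by simp
    then show ?thesis using R_inj[OF kap] by (simp add: x_def)
  qed
  \<comment> \<open>The weight equals 1 at \<open>a\<close>, and \<open>\<psi> a\<close> is a limit
    of forward averages that vanish by \<open>int0\<close>.\<close>
  have small: "norm (\<psi> a) \<le> e" if e: "e > 0" for e
  proof -
    obtain d where d: "d > 0" "\<And>s. dist s a < d \<Longrightarrow> dist (\<psi> s) (\<psi> a) < e"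
      using c\<psi>[of UNIV] e unfolding continuous_on_iff by blast
    define \<delta> where "\<delta> = min (d / 2) 1"
    have \<delta>: "0 < \<delta>" "\<delta> < d" "\<delta> \<le> 1" using d(1) by (auto simp: \<delta>_def)
    have "norm (forward_average \<delta> \<psi> a - \<psi> a) \<le> e"
      using \<delta> d(2) by (intro forward_average_near c\<psi>) (auto simp: dist_norm intro!: less_imp_le)
    moreover have "forward_average \<delta> \<psi> a = 0" using int0[of "a + \<delta>"] \<delta> by (simp add: forward_average_def)
    ultimately show ?thesis by simp
  qed
  have "norm (\<psi> a) \<le> 0" by (rule field_le_epsilon) (use small in auto)
  then show "apply_bcontfun \<phi> a = apply_bcontfun 0 a" by (simp add: \<psi>_def)
qed

text \<open>Evaluation at \<open>t\<close> identifies the integrals with values of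
  \<open>laplace\<close>, and convergence in the supremum norm is convergence uniform in
  \<open>t\<close>.\<close>

lemma L_AP_apply:
  assumes \<phi>: "\<phi> \<in> AP UNIV"
  shows "L_exists D A w \<Gamma> lam (apply_bcontfun \<phi>)"
    and "apply_bcontfun (L_AP lam \<phi>) = L_op D A \<Gamma> lam (apply_bcontfun \<phi>)"
proof -
  have has: "(L_integrand D A \<Gamma> lam (apply_bcontfun \<phi>) mu t has_integral
      apply_bcontfun (S.laplace lam (yosida mu \<phi>)) t) {..t}" if mu: "w < mu" for mu t
    using laplace_has_integral_apply[OF M' bd lam yosida_AP[OF mu \<phi>], of t]
    by (simp add: L_integrand_def[abs_def] yosida_apply[OF mu \<phi>])
  have unif: "uniform_limit UNIV (\<lambda>mu t. integral {..t} (L_integrand D A \<Gamma> lam (apply_bcontfun \<phi>) mu t))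
      (apply_bcontfun (L_AP lam \<phi>)) at_top"
  proof (rule uniform_limitI)
    fix e :: real assume "e > 0"
    then have "\<forall>\<^sub>F mu in at_top. dist (S.laplace lam (yosida mu \<phi>)) (L_AP lam \<phi>) < e"
      by (rule tendstoD[OF L_AP_tendsto[OF \<phi>]])
    then show "\<forall>\<^sub>F mu in at_top. \<forall>t\<in>UNIV. dist (integral {..t} (L_integrand D A \<Gamma> lam (apply_bcontfun \<phi>) mu t))
        (apply_bcontfun (L_AP lam \<phi>) t) < e"
      using eventually_gt_at_top[of w]
      by eventually_elim (simp add: integral_unique[OF has] dist_fun_lt_imp_dist_val_lt)
  qed
  have "L_op D A \<Gamma> lam (apply_bcontfun \<phi>) t = apply_bcontfun (L_AP lam \<phi>) t" for t
    unfolding L_op_def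
    by (rule tendsto_Lim[OF trivial_limit_at_top_linorder tendsto_uniform_limitI[OF unif UNIV_I]])
  then show eq: "apply_bcontfun (L_AP lam \<phi>) = L_op D A \<Gamma> lam (apply_bcontfun \<phi>)" by auto
  show "L_exists D A w \<Gamma> lam (apply_bcontfun \<phi>)"
    unfolding L_exists_def using has unif eq by (auto intro: has_integral_integrable)
qed

end

text \<open>Take the identity for \<open>laplace\<close> at the Yosida approximations of
  \<open>\<phi>\<close> and pass to the limit; the outer operator is \<open>laplace lam\<close>
  because the inner one has values in \<open>X0\<close>.\<close>

lemma L_AP_resolvent_identity:
  assumes Mw: "1 \<le> M'" "exp_bound X0 \<Gamma> M' w'" and lam: "w' < lam" and mu: "w' < mu" and \<phi>: "\<phi> \<in> AP UNIV"
  shows "L_AP lam \<phi> - L_AP mu \<phi> = (mu - lam) *\<^sub>R L_AP lam (L_AP mu \<phi>)"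
proof -
  have L\<phi>: "L_AP mu \<phi> \<in> AP X0" by (rule L_AP_AP[OF Mw mu \<phi>])
  let ?l = "\<lambda>nu. S.laplace mu (yosida nu \<phi>)"
  have "((\<lambda>nu. S.laplace lam (?l nu)) \<longlongrightarrow> S.laplace lam (L_AP mu \<phi>)) at_top"
    by (rule laplace_tendsto[OF Mw lam L\<phi> eventually_mono[OF ev_yosida_AP[OF Mw lam \<phi>]] L_AP_tendsto[OF Mw mu \<phi>]])
      (auto intro: laplace_closed[OF Mw mu])
  then have "((\<lambda>nu. S.laplace lam (?l nu)) \<longlongrightarrow> L_AP lam (L_AP mu \<phi>)) at_top"
    by (simp add: L_AP_eq_laplace[OF Mw lam L\<phi>])
  then have "((\<lambda>nu. (mu - lam) *\<^sub>R S.laplace lam (?l nu)) \<longlongrightarrow> (mu - lam) *\<^sub>R L_AP lam (L_AP mu \<phi>)) at_top"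
    by (intro tendsto_intros)
  moreover have "\<forall>\<^sub>F nu in at_top. (mu - lam) *\<^sub>R S.laplace lam (?l nu) =
      S.laplace lam (yosida nu \<phi>) - S.laplace mu (yosida nu \<phi>)"
    using ev_yosida_AP[OF Mw lam \<phi>]
    by eventually_elim (use S.laplace_resolvent_identity[OF S_growth[OF Mw] lam mu] in auto)
  ultimately have "((\<lambda>nu. S.laplace lam (yosida nu \<phi>) - S.laplace mu (yosida nu \<phi>)) \<longlongrightarrow>
      (mu - lam) *\<^sub>R L_AP lam (L_AP mu \<phi>)) at_top"
    by (rule Lim_transform_eventually)
  moreover have "((\<lambda>nu. S.laplace lam (yosida nu \<phi>) - S.laplace mu (yosida nu \<phi>)) \<longlongrightarrow> L_AP lam \<phi> - L_AP mu \<phi>) at_top"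
    by (intro tendsto_diff L_AP_tendsto[OF Mw] lam mu \<phi>)
  ultimately show ?thesis using tendsto_unique[OF trivial_limit_at_top_linorder] by blast
qed

lemma growth_bound_less:
  assumes "growth_bound X0 \<Gamma> < ereal lam"
  obtains M' w' where "1 \<le> M'" "exp_bound X0 \<Gamma> M' w'" "w' < lam"
  using assms unfolding growth_bound_def Inf_less_iff by auto

lemma generator_extension:
  "\<exists>DB B.
     (\<exists>M w. hille_yosida (AP UNIV) DB B M w) \<and>
     is_part (AP X0) DB B
       (generator_dom (AP X0) (evolution_semigroup \<Gamma>)) (generator (evolution_semigroup \<Gamma>)) \<and>
     {lam. growth_bound X0 \<Gamma> < ereal lam} \<subseteq> resolvent_set (AP UNIV) DB B \<and>
     (\<forall>\<phi>\<in>AP UNIV. \<forall>lam. growth_bound X0 \<Gamma> < ereal lam \<longrightarrow>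
        L_exists D A w \<Gamma> lam (apply_bcontfun \<phi>) \<and>
        apply_bcontfun (resolvent DB B lam \<phi>) = L_op D A \<Gamma> lam (apply_bcontfun \<phi>)) \<and>
     (\<forall>MG wG. MG \<ge> 1 \<longrightarrow> growth_bound X0 \<Gamma> = ereal wG \<longrightarrow> exp_bound X0 \<Gamma> MG wG \<longrightarrow>
        (\<forall>\<phi>\<in>AP UNIV. \<forall>lam>wG. \<forall>n\<ge>1.
           norm ((resolvent DB B lam ^^ n) \<phi>) \<le> MG\<^sup>2 * M / (lam - wG) ^ n * norm \<phi>))"
proof -
  obtain M0 w0 where Mw0: "1 \<le> M0" "exp_bound X0 \<Gamma> M0 w0" by (rule exp_bound_exists)
  define S where "S = {lam. growth_bound X0 \<Gamma> < ereal lam}"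
  have S_I: "lam \<in> S" if "1 \<le> M'" "exp_bound X0 \<Gamma> M' w'" "w' < lam" for lam M' w'
  proof -
    have "growth_bound X0 \<Gamma> \<le> ereal w'" unfolding growth_bound_def using that by (intro Inf_lower) auto
    also have "\<dots> < ereal lam" using that by simp
    finally show ?thesis by (simp add: S_def)
  qed
  have S_E: "\<exists>M' w'. 1 \<le> M' \<and> exp_bound X0 \<Gamma> M' w' \<and> w' < lam" if "lam \<in> S" for lam
    using growth_bound_less[of lam] that unfolding S_def by blast
  have sub: "AP X0 \<subseteq> AP (UNIV :: 'a set)" by (rule AP_mono) simp
  have lam0: "w0 + 1 \<in> S" by (rule S_I[OF Mw0]) simp
  obtain DB B where B: "linear_operator (AP UNIV) DB B" "S \<subseteq> resolvent_set (AP UNIV) DB B"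
    "\<And>lam \<phi>. lam \<in> S \<Longrightarrow> \<phi> \<in> AP UNIV \<Longrightarrow> resolvent DB B lam \<phi> = L_AP lam \<phi>"
    "\<And>lam. lam \<in> S \<Longrightarrow> DB = L_AP lam ` AP UNIV"
    "\<And>lam \<phi>. lam \<in> S \<Longrightarrow> \<phi> \<in> AP UNIV \<Longrightarrow> B (L_AP lam \<phi>) = lam *\<^sub>R L_AP lam \<phi> - \<phi>"
  proof (rule pseudo_resolvent_operator[OF lam0, of "AP UNIV" L_AP])
    fix DB B
    assume *: "linear_operator (AP UNIV) DB B" "S \<subseteq> resolvent_set (AP UNIV) DB B"
      "\<And>lam \<phi>. lam \<in> S \<Longrightarrow> \<phi> \<in> AP UNIV \<Longrightarrow> resolvent DB B lam \<phi> = L_AP lam \<phi>"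
      "\<And>lam. lam \<in> S \<Longrightarrow> DB = L_AP lam ` AP UNIV"
      "\<And>lam \<phi>. lam \<in> S \<Longrightarrow> \<phi> \<in> AP UNIV \<Longrightarrow> B (L_AP lam \<phi>) = lam *\<^sub>R L_AP lam \<phi> - \<phi>"
    show thesis by (rule that[OF *])
  next
    show "bounded_linear_on (AP UNIV) (L_AP lam)" if "lam \<in> S" for lam
      using S_E[OF that] L_AP_bounded_linear by blast
    show "L_AP lam \<phi> \<in> AP UNIV" if "lam \<in> S" "\<phi> \<in> AP UNIV" for lam \<phi>
      using S_E[OF that(1)] L_AP_AP that(2) sub by blast
    show "\<phi> = 0" if "lam \<in> S" "\<phi> \<in> AP UNIV" "L_AP lam \<phi> = 0" for lam \<phi>
      using S_E[OF that(1)] L_AP_injective that(2,3) by blast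
    show "L_AP lam \<phi> - L_AP mu \<phi> = (mu - lam) *\<^sub>R L_AP lam (L_AP mu \<phi>)"
      if "lam \<in> S" "mu \<in> S" "\<phi> \<in> AP UNIV" for lam mu \<phi>
    proof -
      \<comment> \<open>\<open>L_AP_resolvent_identity\<close> needs one exponential bound with
        exponent below both parameters.\<close>
      have "min lam mu \<in> S" using that(1,2) by (simp add: min_def)
      then obtain M' w' where *: "1 \<le> M'" "exp_bound X0 \<Gamma> M' w'" "w' < min lam mu" using S_E by blast
      show ?thesis by (rule L_AP_resolvent_identity[OF *(1,2) _ _ that(3)]) (use *(3) in auto)
    qed
  qed
  have pow: "(resolvent DB B lam ^^ n) \<phi> = (L_AP lam ^^ n) \<phi> \<and> (L_AP lam ^^ n) \<phi> \<in> AP UNIV"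
    if lam: "lam \<in> S" and \<phi>: "\<phi> \<in> AP UNIV" for lam n \<phi>
  proof (induction n)
    case (Suc n)
    obtain M' w' where *: "1 \<le> M'" "exp_bound X0 \<Gamma> M' w'" "w' < lam" using S_E[OF lam] by blast
    show ?case using Suc B(3)[OF lam] L_AP_AP[OF *] sub by auto
  qed (use \<phi> in simp)
  have powb: "norm ((resolvent DB B lam ^^ n) \<phi>) \<le> M' * M / (lam - w') ^ n * norm \<phi>"
    if "1 \<le> M'" "exp_bound X0 \<Gamma> M' w'" "w' < lam" "\<phi> \<in> AP UNIV" "1 \<le> n" for M' w' lam n \<phi>
    using L_AP_power_bound[OF that] pow[OF S_I[OF that(1-3)] that(4)] by simp
  \<comment> \<open>Any exponential bound of \<open>\<Gamma>\<close> will do here; \<open>w0\<close>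
    need not be close to the growth bound.\<close>
  have "hille_yosida (AP UNIV) DB B (M0 * M) w0"
    unfolding hille_yosida_def
  proof (intro conjI allI impI)
    show "1 \<le> M0 * M" using mult_mono[OF Mw0(1) M_ge_1] Mw0(1) by simp
    show "{w0<..} \<subseteq> resolvent_set (AP UNIV) DB B" using B(2) S_I[OF Mw0] by blast
    fix lam n assume "w0 < lam" "1 \<le> (n::nat)"
    moreover have "(0 :: real \<Rightarrow>\<^sub>C 'a) \<in> AP UNIV" by (rule subspace_0[OF subspace_AP[OF subspace_UNIV]])
    ultimately show "onorm_on (AP UNIV) (resolvent DB B lam ^^ n) \<le> M0 * M / (lam - w0) ^ n"
      using Mw0(1) M_ge_1
      by (intro onorm_on_le powb[OF Mw0]) auto
  qed (rule B(1))
  moreover have "is_part (AP X0) DB B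
      (generator_dom (AP X0) (evolution_semigroup \<Gamma>)) (generator (evolution_semigroup \<Gamma>))"
  proof -
    define lam where "lam = w0 + 1"
    have lam: "w0 < lam" "lam \<in> S" using lam0 by (auto simp: lam_def)
    note gd = S.generator_dom_eq[OF S_growth[OF Mw0] lam(1)]
      and gl = S.generator_laplace[OF S_growth[OF Mw0] lam(1)]
      and LX = L_AP_eq_laplace[OF Mw0 lam(1)]
    have lX: "S.laplace lam \<phi> \<in> AP X0" if "\<phi> \<in> AP X0" for \<phi> using laplace_closed[OF Mw0 lam(1) that] .
    have 1: "S.laplace lam \<phi> \<in> part_dom (AP X0) DB B \<and> generator (evolution_semigroup \<Gamma>) (S.laplace lam \<phi>) = B (S.laplace lam \<phi>)"
      if \<phi>: "\<phi> \<in> AP X0" for \<phi>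
    proof -
      have \<phi>U: "\<phi> \<in> AP UNIV" using \<phi> sub by blast
      have "S.laplace lam \<phi> \<in> DB" unfolding B(4)[OF lam(2)] LX[OF \<phi>, symmetric] by (rule imageI[OF \<phi>U])
      moreover have eq: "B (S.laplace lam \<phi>) = lam *\<^sub>R S.laplace lam \<phi> - \<phi>"
        using B(5)[OF lam(2) \<phi>U] by (simp add: LX[OF \<phi>])
      moreover have "lam *\<^sub>R S.laplace lam \<phi> - \<phi> \<in> AP X0"
        by (intro subspace_diff[OF S.subspace_Z] subspace_scale[OF S.subspace_Z] lX \<phi>)
      ultimately show ?thesis using lX[OF \<phi>] gl[OF \<phi>] by (simp add: part_dom_def)
    qed
    \<comment> \<open>If \<open>\<psi>\<close> and \<open>B \<psi>\<close> lie in
      \<open>AP X0\<close>, then so does the preimage \<open>\<phi> = lam \<psi> - B \<psi>\<close>,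
      and on \<open>AP X0\<close> the operator \<open>L_AP lam\<close> is the Laplace
      transform.\<close>
    have 2: "\<psi> \<in> S.laplace lam ` AP X0" if \<psi>: "\<psi> \<in> part_dom (AP X0) DB B" for \<psi>
    proof -
      obtain \<phi> where \<phi>: "\<phi> \<in> AP UNIV" "\<psi> = L_AP lam \<phi>" using \<psi> B(4)[OF lam(2)] by (auto simp: part_dom_def)
      have "\<phi> = lam *\<^sub>R \<psi> - B \<psi>" using B(5)[OF lam(2) \<phi>(1)] \<phi>(2) by simp
      also have "\<dots> \<in> AP X0"
        using \<psi> by (intro subspace_diff[OF S.subspace_Z] subspace_scale[OF S.subspace_Z]) (auto simp: part_dom_def)
      finally show ?thesis using \<phi>(2) LX by auto
    qed
    show ?thesis unfolding is_part_def gd using 1 2 by auto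
  qed
  moreover have "L_exists D A w \<Gamma> lam (apply_bcontfun \<phi>) \<and>
      apply_bcontfun (resolvent DB B lam \<phi>) = L_op D A \<Gamma> lam (apply_bcontfun \<phi>)"
    if \<phi>: "\<phi> \<in> AP UNIV" and lam: "growth_bound X0 \<Gamma> < ereal lam" for \<phi> lam
  proof -
    have S: "lam \<in> S" using lam by (simp add: S_def)
    obtain M' w' where *: "1 \<le> M'" "exp_bound X0 \<Gamma> M' w'" "w' < lam" using S_E[OF S] by blast
    show ?thesis using L_AP_apply[OF * \<phi>] B(3)[OF S \<phi>] by simp
  qed
  moreover have "norm ((resolvent DB B lam ^^ n) \<phi>) \<le> MG\<^sup>2 * M / (lam - wG) ^ n * norm \<phi>"
    if MG: "1 \<le> MG" "exp_bound X0 \<Gamma> MG wG" and \<phi>: "\<phi> \<in> AP UNIV" and lam: "wG < lam" and n: "1 \<le> n"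
    for MG wG \<phi> lam n
  proof -
    \<comment> \<open>\<open>powb\<close> gives the factor \<open>MG\<close>, which is dominated by
      its square since \<open>MG \<ge> 1\<close>.\<close>
    have "MG \<le> MG\<^sup>2" using mult_left_mono[OF MG(1), of MG] MG(1) by (simp add: power2_eq_square)
    then have "MG * M / (lam - wG) ^ n * norm \<phi> \<le> MG\<^sup>2 * M / (lam - wG) ^ n * norm \<phi>"
      using M_ge_1 lam by (intro mult_right_mono divide_right_mono) auto
    with powb[OF MG lam \<phi> n] show ?thesis by linarith
  qed
  ultimately show ?thesis using B(2) unfolding S_def by blast
qed

end

theorem theorem3p13:
  fixes DA X0 Xp :: "'a::banach set"
    and A :: "'a \<Rightarrow> 'a"
    and MA wA :: real
    and F V :: "real \<Rightarrow> 'a \<Rightarrow> 'a"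
    and \<Gamma> :: "real \<Rightarrow> real \<Rightarrow> 'a \<Rightarrow> 'a"
  assumes HY: "hille_yosida UNIV DA A MA wA"
    and X0: "X0 = closure DA"
    and cone_X: "ordered_with_cone UNIV Xp"
    and cone_X0: "ordered_with_cone X0 (X0 \<inter> Xp)"
    and F_L: "\<And>t. bounded_linear_on X0 (F t)"
    and F_ap: "almost_periodic (opdist X0) F"
    and V_L: "\<And>t. bounded_linear_on X0 (V t)"
    and V_ap: "almost_periodic (opdist X0) V"
    and Gamma: "solution_family DA A V \<Gamma>"
    and resolvent_pos:
      "\<exists>w. {w<..} \<subseteq> resolvent_set UNIV DA A \<and> (\<forall>lam>w. \<forall>x\<in>Xp. resolvent DA A lam x \<in> Xp)"
    and V_pos: "\<exists>lam1>wA. \<forall>t. \<forall>x\<in>X0 \<inter> Xp. lam1 *\<^sub>R x - V t x \<in> Xp"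
    and F_pos: "\<And>t x. x \<in> X0 \<inter> Xp \<Longrightarrow> F t x \<in> Xp"
    and growth_neg: "growth_bound X0 \<Gamma> < 0"
    and Gamma_ap:
      "\<And>eps nu. eps > 0 \<Longrightarrow> nu > 0 \<Longrightarrow>
         \<exists>eta>0. \<exists>delta<0. \<forall>t s. \<forall>tau\<in>translation_set (opdist X0) V eta.
           t \<ge> s \<longrightarrow> t - s \<ge> nu \<longrightarrow>
           onorm_on X0 (\<lambda>x. \<Gamma> (t + tau) (s + tau) x - \<Gamma> t s x) \<le> eps * exp (delta * (t - s))"
  shows
    "\<exists>DB B.
       (\<exists>M w. hille_yosida (AP UNIV) DB B M w) \<and>
       is_part (AP X0) DB B
         (generator_dom (AP X0) (evolution_semigroup \<Gamma>)) (generator (evolution_semigroup \<Gamma>)) \<and>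
       {lam. growth_bound X0 \<Gamma> < ereal lam} \<subseteq> resolvent_set (AP UNIV) DB B \<and>
       (\<forall>\<phi>\<in>AP UNIV. \<forall>lam. growth_bound X0 \<Gamma> < ereal lam \<longrightarrow>
          L_exists DA A wA \<Gamma> lam (apply_bcontfun \<phi>) \<and>
          apply_bcontfun (resolvent DB B lam \<phi>) = L_op DA A \<Gamma> lam (apply_bcontfun \<phi>)) \<and>
       (\<forall>MG wG. MG \<ge> 1 \<longrightarrow> growth_bound X0 \<Gamma> = ereal wG \<longrightarrow> exp_bound X0 \<Gamma> MG wG \<longrightarrow>
          (\<forall>\<phi>\<in>AP UNIV. \<forall>lam>wG. \<forall>n\<ge>1.
             norm ((resolvent DB B lam ^^ n) \<phi>) \<le> MG\<^sup>2 * MA / (lam - wG) ^ n * norm \<phi>))"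
proof -
  interpret evolution_problem DA A MA wA V \<Gamma>
    using HY V_L V_ap Gamma Gamma_ap unfolding X0 by unfold_locales
  show ?thesis unfolding X0 by (rule generator_extension)
qed

end
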